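(* (1) $wU_q^{\tau}(\mathcal G)=wU_q^{\tau}(\mathcal G)J^{m-1}\oplus wU_q^{\tau}(\mathcal G)(1-J^{m-1})$ is a direct sum of algebras. (2) $wU_q^{\tau}(\mathcal G)/(1-J)$ is isomorphic to the algebra $U_q'(\mathcal G)$. (3) The subalgebra $wU_q^{\tau}(\mathcal G)_{m-1}$ of $wU_q^{\tau}(\mathcal G)$, which is generated by $E_iJ^{m-1},F_iJ^{m-1},K_i,\bar K_i,D_i,\bar D_i$ ($i\in I$), is isomorphic to the algebra $U_q'(\mathcal G)$. (4) Let $U^{\tau}(\mathcal G)$ be the subalgebra of $wU_q^{\tau}(\mathcal G)$ generated by $E_i,F_i,K_i,\bar K_i,D_i,\bar D_i$ ($i\in I$). Suppose $\mathcal G$ is a semisimple Lie algebra. Then $U^{\tau}(\mathcal G)$ is isomorphic to Yang's algebra $\mathcal M_q^d(\mathcal G)$.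
   Context: **Cartan datum.** $I=\{1,\dots,n\}$ or $I$ is the set of positive integers. $A=(a_{ij})_{i,j\in I}$ is a Borcherds-Cartan matrix: $a_{ij}\in\mathbf Z$; $a_{ii}=2$ or $a_{ii}\le0$; $a_{ij}\le0$ for $i\ne j$; $a_{ij}=0$ if and only if $a_{ji}=0$. It is symmetrizable: there is $D=\mathrm{diag}\{s_i>0\mid i\in I\}$ with $DA$ symmetric. $\mathcal G$ is the associated generalized Kac-Moody algebra. $\mathbf K$ is a field of characteristic $0$, $q\in\mathbf K$, $q_i=q^{s_i}$, and $q_i\ne\pm1,0$ for all $i\in I$. Put $[k]_\nu=\frac{\nu^k-\nu^{-k}}{\nu-\nu^{-1}}$, $[k]!_\nu=[k]_\nu\cdots[1]_\nu$, $[0]!_\nu=1$, $\left[{k\atop r}\right]_\nu=\frac{[k]!_\nu}{[r]!_\nu[k-r]!_\nu}$, and let $\left[{k\atop r}\right]_i$ be its value at $\nu=q_i$. **The algebra $wU_q^\tau(\mathcal G)$.** Fix a positive integer $m$ and $\tau=(\{\kappa_i\}_{i\in I}\,|\,\{\kappa_i'\}_{i\in I})$, where $\kappa_i,\kappa_i'\in\{0,1\}$ are the types (zero or one) of $E_i$ and $F_i$ respectively. $wU_q^\tau(\mathcal G)$ is the associative $\mathbf K$-algebra with unit $1$ generated by $J$, $E_i,F_i,K_i,\bar K_i,D_i,\bar D_i$ ($i\in I$) with the following defining relations, for all $i,j\in I$: - $1\ne J^{m-1}=K_i\bar K_i=D_i\bar D_i$ (so $m\ge2$), $J^m=J$; -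 $J,K_i,\bar K_i,D_i,\bar D_i$ ($i\in I$) commute pairwise, and $XJ^{m-1}=X$ for $X=K_i,\bar K_i,D_i,\bar D_i$; - $E_i,F_i$ are of type $\tau$, that is: if $E_i$ is of type one, $K_jE_i=q_i^{a_{ij}}E_iK_j$ and $\bar K_jE_i=q_i^{-a_{ij}}E_i\bar K_j$; if $E_i$ is of type zero, $K_jE_i\bar K_j=q_i^{a_{ij}}E_i$; if $F_i$ is of type one, $K_jF_i=q_i^{-a_{ij}}F_iK_j$ and $\bar K_jF_i=q_i^{a_{ij}}F_i\bar K_j$; if $F_i$ is of type zero, $K_jF_i\bar K_j=q_i^{-a_{ij}}F_i$; - $E_iF_j-F_jE_i=\delta_{ij}\frac{K_i-\bar K_i}{q_i-q_i^{-1}}$; - $\sum_{r=0}^{1-a_{ij}}(-1)^r\left[{1-a_{ij}\atop r}\right]_iX_i^{1-a_{ij}-r}X_jX_i^r=0$ for $X=E$ and for $X=F$, if $a_{ii}=2$, $i\ne j$; - $E_iE_j-E_jE_i=F_iF_j-F_jF_i=0$ if $a_{ij}=0$. $wU_q^\tau(\mathcal G)/(1-J)$ is the quotient by the two-sided ideal generated by $1-J$. **$U_q(\mathcal G)$ and $U_q'(\mathcal G)$.** Let $P^\vee=(\oplus_{i\in I}\mathbf Zh_i)\oplus(\oplus_{i\in I}\mathbf Zd_i)$ be the free abelian group on $\{h_i,d_i\}$, and let $\alpha_i$ be the linear functionals with $\alpha_i(h_j)=a_{ji}$, $\alpha_i(d_j)=\delta_{ij}$. $U_q(\mathcal G)$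 is the associative $\mathbf K$-algebra with $1$ generated by $e_i,f_i$ ($i\in I$) and $q^h$ ($h\in P^\vee$) with relations $q^0=1$, $q^hq^{h'}=q^{h+h'}$; $q^he_iq^{-h}=q^{\alpha_i(h)}e_i$, $q^hf_iq^{-h}=q^{-\alpha_i(h)}f_i$; $e_if_j-f_je_i=\delta_{ij}\frac{k_i-k_i^{-1}}{q_i-q_i^{-1}}$ where $k_i=q^{s_ih_i}$; $\sum_{r=0}^{1-a_{ij}}(-1)^r\left[{1-a_{ij}\atop r}\right]_ix_i^{1-a_{ij}-r}x_jx_i^r=0$ for $x=e$ and for $x=f$ if $a_{ii}=2$, $i\ne j$; $e_ie_j-e_je_i=f_if_j-f_jf_i=0$ if $a_{ij}=0$. $U_q'(\mathcal G)$ is the subalgebra generated by $e_i,f_i$ ($i\in I$) and $q^h$ with $h\in\oplus_{i\in I}\mathbf Zs_ih_i\oplus\oplus_{i\in I}\mathbf Zd_i$. **Yang's algebra.** For a semisimple Lie algebra $\mathcal G$, $\mathcal M_q^d(\mathcal G)$ is the weak quantum algebra of S. Yang ("Weak Hopf algebras corresponding to Cartan matrices", J. Math. Phys. 46 (2005)), $d$ recording the types of the generators; it is the algebra $wU_q^\tau(\mathcal G)$ above in the case $m=2$ (Yang calls "type two" what is here called type zero).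
   Formalization: The algebra wU is given the missing relations between D_j and E_i, F_i (D_jE_i = q^{δ_ij}E_iD_j for type one, D_jE_iD̄_j = q^{δ_ij}E_i for type zero, likewise D̄_j and F_i with inverse powers), without which (2) and (3) fail. *)

theory Defs
  imports
    "HOL-Computational_Algebra.Polynomial"
    "HOL-Computational_Algebra.Fraction_Field"
    "HOL-Algebra.QuotRing"
    "HOL-Algebra.Module"
    "HOL-Algebra.Chinese_Remainder"
    "HOL-Algebra.Free_Abelian_Groups"
begin

section \<open>Associative unital algebras over a field\<close>

text \<open>The library locale \<open>algebra\<close> is restricted to commutative algebras, so only
  its record type \<open>module\<close> is used here. The scalar field is a type of class \<open>field\<close>.\<close>

definition scalars :: "'k::field ring" where
  "scalars = \<lparr>carrier = UNIV, mult = (*), one = 1, ring.zero = 0, add = (+)\<rparr>"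

definition assoc_algebra :: "('k::field, 'a) module \<Rightarrow> bool" where
  "assoc_algebra A \<longleftrightarrow> ring A \<and> module scalars A \<and>
     (\<forall>c. \<forall>x\<in>carrier A. \<forall>y\<in>carrier A.
        c \<odot>\<^bsub>A\<^esub> (x \<otimes>\<^bsub>A\<^esub> y) = (c \<odot>\<^bsub>A\<^esub> x) \<otimes>\<^bsub>A\<^esub> y \<and>
        c \<odot>\<^bsub>A\<^esub> (x \<otimes>\<^bsub>A\<^esub> y) = x \<otimes>\<^bsub>A\<^esub> (c \<odot>\<^bsub>A\<^esub> y))"

definition alg_iso :: "('k::field, 'a) module \<Rightarrow> ('k, 'b) module \<Rightarrow> ('a \<Rightarrow> 'b) set" where
  "alg_iso A B = {h \<in> ring_iso A B. \<forall>c. \<forall>x\<in>carrier A. h (c \<odot>\<^bsub>A\<^esub> x) = c \<odot>\<^bsub>B\<^esub> h x}"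

definition alg_isomorphic :: "('k::field, 'a) module \<Rightarrow> ('k, 'b) module \<Rightarrow> bool" where
  "alg_isomorphic A B \<longleftrightarrow> assoc_algebra A \<and> assoc_algebra B \<and> alg_iso A B \<noteq> {}"

definition alg_prod :: "('k::field, 'a) module \<Rightarrow> ('k, 'b) module \<Rightarrow> ('k, 'a \<times> 'b) module" where
  "alg_prod A B = ring.extend (RDirProd A B)
     (module.fields (\<lambda>c (x, y). (c \<odot>\<^bsub>A\<^esub> x, c \<odot>\<^bsub>B\<^esub> y)))"

text \<open>\<open>A = B \<oplus> C\<close> as algebras: \<open>B\<close> and \<open>C\<close> are algebras inside \<open>A\<close> (with their own
  units), and addition is an isomorphism of algebras from \<open>B \<times> C\<close> onto \<open>A\<close>.\<close>

definition alg_direct_sum ::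
  "('k::field, 'a) module \<Rightarrow> ('k, 'a) module \<Rightarrow> ('k, 'a) module \<Rightarrow> bool" where
  "alg_direct_sum A B C \<longleftrightarrow> assoc_algebra A \<and> assoc_algebra B \<and> assoc_algebra C \<and>
     carrier B \<subseteq> carrier A \<and> carrier C \<subseteq> carrier A \<and>
     (\<lambda>(b, c). b \<oplus>\<^bsub>A\<^esub> c) \<in> alg_iso (alg_prod B C) A"

text \<open>\<open>Ae\<close>, with the multiplication of \<open>A\<close> and unit \<open>e\<close>.\<close>

definition alg_part :: "('k::field, 'a) module \<Rightarrow> 'a \<Rightarrow> ('k, 'a) module" where
  "alg_part A e = A\<lparr>carrier := (\<lambda>x. x \<otimes>\<^bsub>A\<^esub> e) ` carrier A, one := e\<rparr>"

definition lin_span :: "('k::field, 'a) module \<Rightarrow> 'a set \<Rightarrow> 'a set" where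
  "lin_span A S = \<Inter>{U. submodule U scalars A \<and> S \<subseteq> U}"

definition alg_span :: "('k::field, 'a) module \<Rightarrow> 'a set \<Rightarrow> 'a set" where
  "alg_span A S = \<Inter>{U. submodule U scalars A \<and> (\<forall>x\<in>U. \<forall>y\<in>U. x \<otimes>\<^bsub>A\<^esub> y \<in> U) \<and> S \<subseteq> U}"

text \<open>The subalgebra of \<open>A\<close> generated by \<open>S\<close> with unit \<open>u\<close>. The unit need not be the
  unit of \<open>A\<close>: \<open>u\<close> may be any idempotent that acts as identity on \<open>S\<close>.\<close>

definition gen_subalgebra :: "('k::field, 'a) module \<Rightarrow> 'a \<Rightarrow> 'a set \<Rightarrow> ('k, 'a) module" where
  "gen_subalgebra A u S = A\<lparr>carrier := alg_span A (insert u S), one := u\<rparr>"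

definition alg_quot :: "('k::field, 'a) module \<Rightarrow> 'a set \<Rightarrow> ('k, 'a set) module" where
  "alg_quot A N = ring.extend (A Quot N) (module.fields (\<lambda>c X. \<Union>x\<in>X. N +>\<^bsub>A\<^esub> (c \<odot>\<^bsub>A\<^esub> x)))"


section \<open>Generators and relations\<close>

text \<open>The free monoid, written additively so that \<open>'x word \<Rightarrow>\<^sub>0 'k\<close> is the
  free associative algebra with its convolution product.\<close>

datatype 'x word = Word (letters: "'x list")

instantiation word :: (type) monoid_add
begin

definition zero_word :: "'a word" where "0 = Word []"

definition plus_word :: "'a word \<Rightarrow> 'a word \<Rightarrow> 'a word" where
  "v + w = Word (letters v @ letters w)"

instance
  by standard (simp_all add: zero_word_def plus_word_def)

end

type_synonym ('x, 'k) free = "'x word \<Rightarrow>\<^sub>0 'k"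

definition var :: "'x \<Rightarrow> ('x, 'k::field) free" where
  "var x = Poly_Mapping.single (Word [x]) 1"

definition scal :: "'k \<Rightarrow> ('x, 'k::field) free \<Rightarrow> ('x, 'k) free"  (infixr \<open>\<star>\<close> 69) where
  "c \<star> p = Poly_Mapping.single 0 c * p"

definition free_algebra :: "'x set \<Rightarrow> ('k::field, ('x, 'k) free) module" where
  "free_algebra X =
     \<lparr>carrier = {p. \<forall>w\<in>Poly_Mapping.keys p. set (letters w) \<subseteq> X},
      mult = (*), one = 1, ring.zero = 0, add = (+), smult = (\<star>)\<rparr>"

text \<open>A relation \<open>l = r\<close> is a pair \<open>(l, r)\<close>.\<close>

definition rel_ideal ::
  "'x set \<Rightarrow> (('x, 'k::field) free \<times> ('x, 'k) free) set \<Rightarrow> ('x, 'k) free set" where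
  "rel_ideal X R = Idl\<^bsub>free_algebra X\<^esub> {l - r | l r. (l, r) \<in> R}"

definition presented ::
  "'x set \<Rightarrow> (('x, 'k::field) free \<times> ('x, 'k) free) set \<Rightarrow> ('k, ('x, 'k) free set) module" where
  "presented X R = alg_quot (free_algebra X) (rel_ideal X R)"

definition presented_gen ::
  "'x set \<Rightarrow> (('x, 'k::field) free \<times> ('x, 'k) free) set \<Rightarrow> 'x \<Rightarrow> ('x, 'k) free set" where
  "presented_gen X R x = rel_ideal X R +>\<^bsub>free_algebra X\<^esub> var x"


section \<open>Gaussian binomial coefficients\<close>

text \<open>They are formed for an indeterminate \<open>\<nu>\<close> and only then evaluated, since the
  factorials may vanish at a root of unity.\<close>

definition nu :: "'k::field poly fract" where
  "nu = Fract [:0, 1:] 1"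

definition gauss_int :: "nat \<Rightarrow> 'k::field poly fract" where
  "gauss_int k = (nu ^ k - inverse nu ^ k) / (nu - inverse nu)"

definition gauss_fact :: "nat \<Rightarrow> 'k::field poly fract" where
  "gauss_fact k = (\<Prod>j\<in>{1..k}. gauss_int j)"

definition gauss_binomial :: "nat \<Rightarrow> nat \<Rightarrow> 'k::field poly fract" where
  "gauss_binomial k r = gauss_fact k / (gauss_fact r * gauss_fact (k - r))"

text \<open>Unspecified if \<open>c\<close> is a pole of \<open>f\<close>. Gaussian binomials are Laurent polynomials,
  so have no pole at \<open>c \<noteq> 0\<close>.\<close>

definition fract_value :: "'k::field poly fract \<Rightarrow> 'k \<Rightarrow> 'k" where
  "fract_value f c = (THE y. \<exists>a b. f = Fract a b \<and> poly b c \<noteq> 0 \<and> y = poly a c / poly b c)"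

definition serre :: "'k::field \<Rightarrow> int \<Rightarrow> ('x, 'k) free \<Rightarrow> ('x, 'k) free \<Rightarrow> ('x, 'k) free" where
  "serre c a x y =
     (let n = nat (1 - a) in
      \<Sum>r\<in>{0..n}. ((- 1) ^ r * fract_value (gauss_binomial n r) c) \<star> (x ^ (n - r) * y * x ^ r))"


section \<open>Borcherds-Cartan data\<close>

definition borcherds_cartan :: "'i set \<Rightarrow> ('i \<Rightarrow> 'i \<Rightarrow> int) \<Rightarrow> bool" where
  "borcherds_cartan I A \<longleftrightarrow>
     (\<forall>i\<in>I. A i i = 2 \<or> A i i \<le> 0) \<and>
     (\<forall>i\<in>I. \<forall>j\<in>I. i \<noteq> j \<longrightarrow> A i j \<le> 0) \<and>
     (\<forall>i\<in>I. \<forall>j\<in>I. A i j = 0 \<longleftrightarrow> A j i = 0)"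

text \<open>The \<open>s\<^sub>i\<close> are integers, because \<open>s\<^sub>i h\<^sub>i\<close> has to lie in \<open>P\<^sup>\<or>\<close>.\<close>

definition symmetrized_by :: "'i set \<Rightarrow> ('i \<Rightarrow> 'i \<Rightarrow> int) \<Rightarrow> ('i \<Rightarrow> nat) \<Rightarrow> bool" where
  "symmetrized_by I A s \<longleftrightarrow>
     (\<forall>i\<in>I. s i > 0) \<and> (\<forall>i\<in>I. \<forall>j\<in>I. int (s i) * A i j = int (s j) * A j i)"

abbreviation kron :: "'i \<Rightarrow> 'i \<Rightarrow> int" where
  "kron i j \<equiv> (if i = j then 1 else 0)"


section \<open>The Lie algebra of the datum, and semisimplicity\<close>

datatype 'i chevalley = LE 'i | LF 'i | LH 'i

definition comm :: "('x, 'k::field) free \<Rightarrow> ('x, 'k) free \<Rightarrow> ('x, 'k) free" where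
  "comm x y = x * y - y * x"

inductive_set lie_rels :: "'i set \<Rightarrow> ('i \<Rightarrow> 'i \<Rightarrow> int) \<Rightarrow>
    (('i chevalley, 'k::field) free \<times> ('i chevalley, 'k) free) set"
  for I A where
  "\<lbrakk>i \<in> I; j \<in> I\<rbrakk> \<Longrightarrow> (comm (var (LH i)) (var (LH j)), 0) \<in> lie_rels I A"
| "\<lbrakk>i \<in> I; j \<in> I\<rbrakk> \<Longrightarrow> (comm (var (LH i)) (var (LE j)), of_int (A i j) \<star> var (LE j)) \<in> lie_rels I A"
| "\<lbrakk>i \<in> I; j \<in> I\<rbrakk> \<Longrightarrow> (comm (var (LH i)) (var (LF j)), (- of_int (A i j)) \<star> var (LF j)) \<in> lie_rels I A"
| "\<lbrakk>i \<in> I; j \<in> I\<rbrakk> \<Longrightarrow>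
    (comm (var (LE i)) (var (LF j)), if i = j then var (LH i) else 0) \<in> lie_rels I A"
| "\<lbrakk>i \<in> I; j \<in> I; A i i = 2; i \<noteq> j\<rbrakk> \<Longrightarrow>
    ((comm (var (LE i)) ^^ nat (1 - A i j)) (var (LE j)), 0) \<in> lie_rels I A"
| "\<lbrakk>i \<in> I; j \<in> I; A i i = 2; i \<noteq> j\<rbrakk> \<Longrightarrow>
    ((comm (var (LF i)) ^^ nat (1 - A i j)) (var (LF j)), 0) \<in> lie_rels I A"
| "\<lbrakk>i \<in> I; j \<in> I; A i j = 0\<rbrakk> \<Longrightarrow> (comm (var (LE i)) (var (LE j)), 0) \<in> lie_rels I A"
| "\<lbrakk>i \<in> I; j \<in> I; A i j = 0\<rbrakk> \<Longrightarrow> (comm (var (LF i)) (var (LF j)), 0) \<in> lie_rels I A"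

definition lie_gens :: "'i set \<Rightarrow> 'i chevalley set" where
  "lie_gens I = (\<Union>i\<in>I. {LE i, LF i, LH i})"

text \<open>The associative algebra with these generators and relations is the universal
  enveloping algebra of the Lie algebra so presented. By the theorem of Poincare, Birkhoff
  and Witt, that Lie algebra is the Lie subalgebra spanned by the generators. It does not
  contain the derivations \<open>d\<^sub>i\<close>: with them the centre would never be trivial, and the
  semisimple Lie algebra with Cartan matrix \<open>A\<close> is the one without them.\<close>

definition envelope :: "'i set \<Rightarrow> ('i \<Rightarrow> 'i \<Rightarrow> int) \<Rightarrow> ('k::field, ('i chevalley, 'k) free set) module"
  where "envelope I A = presented (lie_gens I) (lie_rels I A)"

definition lie_bracket :: "('k::field, 'a) module \<Rightarrow> 'a \<Rightarrow> 'a \<Rightarrow> 'a" where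
  "lie_bracket U x y = x \<otimes>\<^bsub>U\<^esub> y \<ominus>\<^bsub>U\<^esub> y \<otimes>\<^bsub>U\<^esub> x"

definition lie_span :: "('k::field, 'a) module \<Rightarrow> 'a set \<Rightarrow> 'a set" where
  "lie_span U S = \<Inter>{L. submodule L scalars U \<and> (\<forall>x\<in>L. \<forall>y\<in>L. lie_bracket U x y \<in> L) \<and> S \<subseteq> L}"

definition kac_moody :: "'i set \<Rightarrow> ('i \<Rightarrow> 'i \<Rightarrow> int) \<Rightarrow> ('i chevalley, 'k::field) free set set" where
  "kac_moody I A = lie_span (envelope I A)
     (presented_gen (lie_gens I) (lie_rels I A) ` lie_gens I)"

definition lie_ideal :: "('k::field, 'a) module \<Rightarrow> 'a set \<Rightarrow> 'a set \<Rightarrow> bool" where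
  "lie_ideal U L N \<longleftrightarrow> submodule N scalars U \<and> N \<subseteq> L \<and>
     (\<forall>x\<in>L. \<forall>y\<in>N. lie_bracket U x y \<in> N)"

definition derived :: "('k::field, 'a) module \<Rightarrow> 'a set \<Rightarrow> 'a set" where
  "derived U N = lin_span U {lie_bracket U x y | x y. x \<in> N \<and> y \<in> N}"

definition semisimple :: "('k::field, 'a) module \<Rightarrow> 'a set \<Rightarrow> bool" where
  "semisimple U L \<longleftrightarrow>
     (\<exists>S. finite S \<and> S \<subseteq> carrier U \<and> L = lin_span U S) \<and>
     (\<forall>N. lie_ideal U L N \<and> (\<exists>k. (derived U ^^ k) N = {\<zero>\<^bsub>U\<^esub>}) \<longrightarrow> N = {\<zero>\<^bsub>U\<^esub>})"


section \<open>The weak quantum algebra\<close>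

datatype 'i wgen = J | E 'i | F 'i | K 'i | Kbar 'i | D 'i | Dbar 'i

definition wtorus :: "'i set \<Rightarrow> 'i wgen set" where
  "wtorus I = (\<Union>i\<in>I. {K i, Kbar i, D i, Dbar i})"

definition wgens :: "'i set \<Rightarrow> 'i wgen set" where
  "wgens I = {J} \<union> wtorus I \<union> (\<Union>i\<in>I. {E i, F i})"

text \<open>The relations between \<open>D\<^sub>j\<close> and \<open>E\<^sub>i, F\<^sub>i\<close> have the same
  shape as those for \<open>K\<^sub>j\<close>, with \<open>q\<close> to the power \<open>\<alpha>\<^sub>i(d\<^sub>j) = \<delta>\<^sub>i\<^sub>j\<close>. Without them
  the \<open>D\<^sub>j\<close> would not satisfy the relations of the \<open>q\<close>-powers of the \<open>d\<^sub>j\<close> in \<open>U\<^sub>q'\<close>, even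
  modulo \<open>1 - J\<close>. The condition \<open>1 \<noteq> J\<^bsup>m-1\<^esup>\<close> is not
  imposed but holds for \<open>m \<ge> 2\<close>: see \<open>one_neq_J_power\<close> below.\<close>

inductive_set wrels :: "'i set \<Rightarrow> ('i \<Rightarrow> 'i \<Rightarrow> int) \<Rightarrow> ('i \<Rightarrow> nat) \<Rightarrow> 'k::field \<Rightarrow> nat \<Rightarrow>
    ('i \<Rightarrow> nat) \<Rightarrow> ('i \<Rightarrow> nat) \<Rightarrow> (('i wgen, 'k) free \<times> ('i wgen, 'k) free) set"
  for I A s q m \<kappa> \<kappa>' where
  "i \<in> I \<Longrightarrow> (var J ^ (m - 1), var (K i) * var (Kbar i)) \<in> wrels I A s q m \<kappa> \<kappa>'"
| "i \<in> I \<Longrightarrow> (var J ^ (m - 1), var (D i) * var (Dbar i)) \<in> wrels I A s q m \<kappa> \<kappa>'"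
| "(var J ^ m, var J) \<in> wrels I A s q m \<kappa> \<kappa>'"
| "\<lbrakk>x \<in> insert J (wtorus I); y \<in> insert J (wtorus I)\<rbrakk> \<Longrightarrow>
    (var x * var y, var y * var x) \<in> wrels I A s q m \<kappa> \<kappa>'"
| "x \<in> wtorus I \<Longrightarrow> (var x * var J ^ (m - 1), var x) \<in> wrels I A s q m \<kappa> \<kappa>'"

| "\<lbrakk>i \<in> I; j \<in> I; \<kappa> i = 1\<rbrakk> \<Longrightarrow>
    (var (K j) * var (E i), ((q ^ s i) powi A i j) \<star> (var (E i) * var (K j))) \<in> wrels I A s q m \<kappa> \<kappa>'"
| "\<lbrakk>i \<in> I; j \<in> I; \<kappa> i = 1\<rbrakk> \<Longrightarrow>
    (var (Kbar j) * var (E i), ((q ^ s i) powi (- A i j)) \<star> (var (E i) * var (Kbar j)))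
      \<in> wrels I A s q m \<kappa> \<kappa>'"
| "\<lbrakk>i \<in> I; j \<in> I; \<kappa> i = 0\<rbrakk> \<Longrightarrow>
    (var (K j) * var (E i) * var (Kbar j), ((q ^ s i) powi A i j) \<star> var (E i)) \<in> wrels I A s q m \<kappa> \<kappa>'"
| "\<lbrakk>i \<in> I; j \<in> I; \<kappa>' i = 1\<rbrakk> \<Longrightarrow>
    (var (K j) * var (F i), ((q ^ s i) powi (- A i j)) \<star> (var (F i) * var (K j)))
      \<in> wrels I A s q m \<kappa> \<kappa>'"
| "\<lbrakk>i \<in> I; j \<in> I; \<kappa>' i = 1\<rbrakk> \<Longrightarrow>
    (var (Kbar j) * var (F i), ((q ^ s i) powi A i j) \<star> (var (F i) * var (Kbar j)))
      \<in> wrels I A s q m \<kappa> \<kappa>'"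
| "\<lbrakk>i \<in> I; j \<in> I; \<kappa>' i = 0\<rbrakk> \<Longrightarrow>
    (var (K j) * var (F i) * var (Kbar j), ((q ^ s i) powi (- A i j)) \<star> var (F i))
      \<in> wrels I A s q m \<kappa> \<kappa>'"

| "\<lbrakk>i \<in> I; j \<in> I; \<kappa> i = 1\<rbrakk> \<Longrightarrow>
    (var (D j) * var (E i), (q powi kron i j) \<star> (var (E i) * var (D j))) \<in> wrels I A s q m \<kappa> \<kappa>'"
| "\<lbrakk>i \<in> I; j \<in> I; \<kappa> i = 1\<rbrakk> \<Longrightarrow>
    (var (Dbar j) * var (E i), (q powi (- kron i j)) \<star> (var (E i) * var (Dbar j)))
      \<in> wrels I A s q m \<kappa> \<kappa>'"
| "\<lbrakk>i \<in> I; j \<in> I; \<kappa> i = 0\<rbrakk> \<Longrightarrow>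
    (var (D j) * var (E i) * var (Dbar j), (q powi kron i j) \<star> var (E i)) \<in> wrels I A s q m \<kappa> \<kappa>'"
| "\<lbrakk>i \<in> I; j \<in> I; \<kappa>' i = 1\<rbrakk> \<Longrightarrow>
    (var (D j) * var (F i), (q powi (- kron i j)) \<star> (var (F i) * var (D j))) \<in> wrels I A s q m \<kappa> \<kappa>'"
| "\<lbrakk>i \<in> I; j \<in> I; \<kappa>' i = 1\<rbrakk> \<Longrightarrow>
    (var (Dbar j) * var (F i), (q powi kron i j) \<star> (var (F i) * var (Dbar j)))
      \<in> wrels I A s q m \<kappa> \<kappa>'"
| "\<lbrakk>i \<in> I; j \<in> I; \<kappa>' i = 0\<rbrakk> \<Longrightarrow>
    (var (D j) * var (F i) * var (Dbar j), (q powi (- kron i j)) \<star> var (F i))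
      \<in> wrels I A s q m \<kappa> \<kappa>'"

| "\<lbrakk>i \<in> I; j \<in> I\<rbrakk> \<Longrightarrow>
    (var (E i) * var (F j) - var (F j) * var (E i),
     if i = j then inverse (q ^ s i - inverse (q ^ s i)) \<star> (var (K i) - var (Kbar i)) else 0)
      \<in> wrels I A s q m \<kappa> \<kappa>'"
| "\<lbrakk>i \<in> I; j \<in> I; A i i = 2; i \<noteq> j\<rbrakk> \<Longrightarrow>
    (serre (q ^ s i) (A i j) (var (E i)) (var (E j)), 0) \<in> wrels I A s q m \<kappa> \<kappa>'"
| "\<lbrakk>i \<in> I; j \<in> I; A i i = 2; i \<noteq> j\<rbrakk> \<Longrightarrow>
    (serre (q ^ s i) (A i j) (var (F i)) (var (F j)), 0) \<in> wrels I A s q m \<kappa> \<kappa>'"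
| "\<lbrakk>i \<in> I; j \<in> I; A i j = 0\<rbrakk> \<Longrightarrow>
    (var (E i) * var (E j) - var (E j) * var (E i), 0) \<in> wrels I A s q m \<kappa> \<kappa>'"
| "\<lbrakk>i \<in> I; j \<in> I; A i j = 0\<rbrakk> \<Longrightarrow>
    (var (F i) * var (F j) - var (F j) * var (F i), 0) \<in> wrels I A s q m \<kappa> \<kappa>'"

definition wU :: "'i set \<Rightarrow> ('i \<Rightarrow> 'i \<Rightarrow> int) \<Rightarrow> ('i \<Rightarrow> nat) \<Rightarrow> 'k::field \<Rightarrow> nat \<Rightarrow>
    ('i \<Rightarrow> nat) \<Rightarrow> ('i \<Rightarrow> nat) \<Rightarrow> ('k, ('i wgen, 'k) free set) module" where
  "wU I A s q m \<kappa> \<kappa>' = presented (wgens I) (wrels I A s q m \<kappa> \<kappa>')"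

definition wU_gen :: "'i set \<Rightarrow> ('i \<Rightarrow> 'i \<Rightarrow> int) \<Rightarrow> ('i \<Rightarrow> nat) \<Rightarrow> 'k::field \<Rightarrow> nat \<Rightarrow>
    ('i \<Rightarrow> nat) \<Rightarrow> ('i \<Rightarrow> nat) \<Rightarrow> 'i wgen \<Rightarrow> ('i wgen, 'k) free set" where
  "wU_gen I A s q m \<kappa> \<kappa>' = presented_gen (wgens I) (wrels I A s q m \<kappa> \<kappa>')"

lemma free_ring: "ring (free_algebra X :: ('k::field, ('x, 'k) free) module)"
proof -
  let ?A = "free_algebra X :: ('k, ('x, 'k) free) module"
  have ops: "x \<otimes>\<^bsub>?A\<^esub> y = x * y" "x \<oplus>\<^bsub>?A\<^esub> y = x + y" "\<one>\<^bsub>?A\<^esub> = 1" "\<zero>\<^bsub>?A\<^esub> = 0" for x y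
    by (simp_all add: free_algebra_def)
  have car: "p \<in> carrier ?A \<longleftrightarrow> (\<forall>w\<in>Poly_Mapping.keys p. set (letters w) \<subseteq> X)" for p
    by (simp add: free_algebra_def)
  have m: "p * r \<in> carrier ?A" if p: "p \<in> carrier ?A" and r: "r \<in> carrier ?A" for p r
    unfolding car
  proof
    fix w assume "w \<in> Poly_Mapping.keys (p * r)"
    then obtain u v where "w = u + v" "u \<in> Poly_Mapping.keys p" "v \<in> Poly_Mapping.keys r"
      using keys_mult[of p r] by blast
    then show "set (letters w) \<subseteq> X"
      using p r by (simp add: car plus_word_def)
  qed
  have a: "p + r \<in> carrier ?A" if "p \<in> carrier ?A" "r \<in> carrier ?A" for p r
    using that Poly_Mapping.keys_add[of p r] unfolding car by blast
  have n: "- p \<in> carrier ?A" if "p \<in> carrier ?A" for p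
    using that by (simp add: car)
  have c: "0 \<in> carrier ?A" "1 \<in> carrier ?A"
    by (simp_all add: car zero_word_def)
  show ?thesis
  proof (rule ringI)
    show "abelian_group ?A"
    proof (rule abelian_groupI)
      fix p assume "p \<in> carrier ?A"
      then show "\<exists>r\<in>carrier ?A. r \<oplus>\<^bsub>?A\<^esub> p = \<zero>\<^bsub>?A\<^esub>"
        using n[of p] by (intro bexI[of _ "- p"]) (simp_all add: ops)
    qed (simp_all add: ops a c add.assoc add.commute)
    show "monoid ?A"
      by (rule monoidI) (simp_all add: ops m c mult.assoc)
  qed (simp_all add: ops distrib_left distrib_right)
qed

lemma lookup_mult_0: "Poly_Mapping.lookup (p * r) 0 = Poly_Mapping.lookup p 0 * Poly_Mapping.lookup r 0"
  for p r :: "('x, 'k::field) free"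
proof -
  have z: "0 = l + k \<longleftrightarrow> l = 0 \<and> k = 0" for l k :: "'x word"
    by (cases l; cases k) (auto simp: zero_word_def plus_word_def)
  have "Sum_any (\<lambda>k. Poly_Mapping.lookup r k when 0 = l + k) = (Poly_Mapping.lookup r 0 when l = 0)" for l
    by (cases "l = 0") (simp_all add: z when_def)
  then show ?thesis
    by (simp add: lookup_mult mult_when)
qed

lemma lookup_power_0: "Poly_Mapping.lookup (p ^ n) 0 = Poly_Mapping.lookup p 0 ^ n"
  for p :: "('x, 'k::field) free"
  by (induction n) (simp_all add: lookup_mult_0 lookup_one)

lemma lookup_var_0 [simp]: "Poly_Mapping.lookup (var x) 0 = 0"
  by (simp add: var_def lookup_single zero_word_def)

lemma lookup_scal_0: "Poly_Mapping.lookup (c \<star> p) 0 = c * Poly_Mapping.lookup p 0"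
  by (simp add: scal_def lookup_mult_0)

lemma lookup_serre_0: "Poly_Mapping.lookup (serre c a (var x) (var y)) 0 = 0"
  by (simp add: serre_def Let_def lookup_sum lookup_scal_0 lookup_mult_0)

lemmas lookup_0 = lookup_mult_0 lookup_power_0 lookup_scal_0 lookup_serre_0
  lookup_minus lookup_add lookup_one

lemma one_neq_J_power:
  fixes I :: "'i set" and q :: "'k::field"
  assumes m: "m \<ge> 2"
  shows "\<one>\<^bsub>wU I A s q m \<kappa> \<kappa>'\<^esub> \<noteq>
    wU_gen I A s q m \<kappa> \<kappa>' J [^]\<^bsub>wU I A s q m \<kappa> \<kappa>'\<^esub> (m - 1)"
proof
  let ?X = "wgens I" and ?R = "wrels I A s q m \<kappa> \<kappa>'"
  let ?A = "free_algebra ?X :: ('k, ('i wgen, 'k) free) module"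
  let ?S = "{l - r | l r. (l, r) \<in> ?R}" and ?N = "rel_ideal ?X ?R"
  interpret ring ?A by (rule free_ring)
  define Z where "Z = {p \<in> carrier ?A. Poly_Mapping.lookup p 0 = 0}"
  have minus: "\<ominus>\<^bsub>?A\<^esub> p = - p" if "p \<in> carrier ?A" for p
    using that by (intro minus_equality) (auto simp: free_algebra_def)
  have Z: "ideal Z ?A"
  proof (rule idealI)
    show "subgroup Z (add_monoid ?A)"
    proof (rule subgroup.intro)
      fix p assume p: "p \<in> Z"
      then have "inv\<^bsub>add_monoid ?A\<^esub> p = - p"
        using minus by (auto simp: Z_def a_inv_def)
      with p show "inv\<^bsub>add_monoid ?A\<^esub> p \<in> Z"
        by (auto simp: Z_def free_algebra_def)
    next
      fix p r assume "p \<in> Z" "r \<in> Z"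
      then show "p \<otimes>\<^bsub>add_monoid ?A\<^esub> r \<in> Z"
        using a_closed[of p r] by (auto simp: Z_def free_algebra_def lookup_add)
    qed (auto simp: Z_def free_algebra_def)
  next
    fix a x assume "a \<in> Z" "x \<in> carrier ?A"
    then show "x \<otimes>\<^bsub>?A\<^esub> a \<in> Z" "a \<otimes>\<^bsub>?A\<^esub> x \<in> Z"
      using m_closed[of x a] m_closed[of a x] by (auto simp: Z_def free_algebra_def lookup_mult_0)
  qed (rule ring_axioms)
  have R0: "Poly_Mapping.lookup l 0 = Poly_Mapping.lookup r 0" if "(l, r) \<in> ?R" for l r
    
  proof -
    have z: "(0::'k) ^ (m - 1) = 0" "(0::'k) ^ m = 0"
      using m by (auto intro!: zero_power)
    show ?thesis
      using that
      by (induction rule: wrels.induct) (simp_all add: lookup_0 z del: One_nat_def)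
  qed
  have var: "var x \<in> carrier ?A" if "x \<in> ?X" for x
    using that by (auto simp: free_algebra_def var_def)
  have sc: "Poly_Mapping.single 0 c \<in> carrier ?A" for c
    by (auto simp: free_algebra_def zero_word_def)
  have clo: "p * r \<in> carrier ?A" "p + r \<in> carrier ?A" "p - r \<in> carrier ?A"
    if "p \<in> carrier ?A" "r \<in> carrier ?A" for p r
    using m_closed[OF that] a_closed[OF that] minus_closed[OF that] minus[OF that(2)]
    by (simp_all add: free_algebra_def a_minus_def)
  have scal: "c \<star> p \<in> carrier ?A" if "p \<in> carrier ?A" for c p
    using m_closed[OF sc[of c] that] by (simp add: free_algebra_def scal_def)
  have one: "1 \<in> carrier ?A" "0 \<in> carrier ?A"
    using one_closed zero_closed by (simp_all add: free_algebra_def)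
  have pow: "p ^ n \<in> carrier ?A" if "p \<in> carrier ?A" for p and n :: nat
    using that by (induction n) (auto intro: clo one)
  have sum: "(\<Sum>r\<in>T. f r) \<in> carrier ?A" if "\<And>r. f r \<in> carrier ?A" for f and T :: "nat set"
    using that by (induction T rule: infinite_finite_induct) (auto intro: clo one)
  have serre: "serre c a (var x) (var y) \<in> carrier ?A" if "x \<in> ?X" "y \<in> ?X" for c a x y
    unfolding serre_def Let_def using that by (intro sum clo scal pow var)
  have gens: "J \<in> ?X" "i \<in> I \<Longrightarrow> E i \<in> ?X" "i \<in> I \<Longrightarrow> F i \<in> ?X" "i \<in> I \<Longrightarrow> K i \<in> ?X"
    "i \<in> I \<Longrightarrow> Kbar i \<in> ?X" "i \<in> I \<Longrightarrow> D i \<in> ?X" "wtorus I \<subseteq> ?X" "i \<in> I \<Longrightarrow> Dbar i \<in> ?X" for i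
    by (auto simp: wgens_def wtorus_def)
  have "l \<in> carrier ?A \<and> r \<in> carrier ?A" if "(l, r) \<in> ?R" for l r
    using that
    by (induction rule: wrels.induct)
      (auto intro!: clo scal pow var serre one simp: gens gens(7)[THEN subsetD])
  then have "?S \<subseteq> Z"
    using R0 clo by (auto simp: Z_def lookup_minus)
  then have NZ: "?N \<subseteq> Z"
    using Z unfolding rel_ideal_def genideal_def by blast
  have "?S \<subseteq> carrier ?A"
    using \<open>?S \<subseteq> Z\<close> by (auto simp: Z_def)
  then interpret N: ideal ?N ?A
    unfolding rel_ideal_def by (rule genideal_ideal)
  let ?W = "wU I A s q m \<kappa> \<kappa>'"
  have W: "monoid.mult ?W = rcoset_mult ?A ?N" "\<one>\<^bsub>?W\<^esub> = ?N +>\<^bsub>?A\<^esub> 1"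
    by (simp_all add: wU_def presented_def alg_quot_def ring.defs FactRing_def)
      (simp add: free_algebra_def)
  have J: "var J \<in> carrier ?A" by (rule var) (simp add: wgens_def)
  have "wU_gen I A s q m \<kappa> \<kappa>' J [^]\<^bsub>?W\<^esub> n = ?N +>\<^bsub>?A\<^esub> (var J ^ n)" for n :: nat
  proof (induction n)
    case (Suc n)
    have "monoid.mult ?A (var J ^ n) (var J) = var J ^ Suc n"
      by (simp add: free_algebra_def power_commutes)
    with Suc N.rcoset_mult_add[OF pow[OF J] J, of n] show ?case
      by (simp add: W wU_gen_def presented_gen_def)
  qed (simp add: W)
  moreover assume "\<one>\<^bsub>?W\<^esub> = wU_gen I A s q m \<kappa> \<kappa>' J [^]\<^bsub>?W\<^esub> (m - 1)"
  ultimately have "?N +>\<^bsub>?A\<^esub> 1 = ?N +>\<^bsub>?A\<^esub> (var J ^ (m - 1))"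
    by (simp add: W)
  then have "1 \<ominus>\<^bsub>?A\<^esub> var J ^ (m - 1) \<in> ?N"
    using quotient_eq_iff_same_a_r_cos[OF N.ideal_axioms one(1) pow[OF J]] by simp
  then have "1 - var J ^ (m - 1) \<in> Z"
    using NZ minus[OF pow[OF J]] by (auto simp: a_minus_def free_algebra_def)
  then have "(0::'k) ^ (m - 1) = 1"
    by (simp add: Z_def lookup_0)
  moreover have "(0::'k) ^ (m - 1) = 0"
    using m by (intro zero_power) simp
  ultimately show False by simp
qed

definition yang_algebra :: "'i set \<Rightarrow> ('i \<Rightarrow> 'i \<Rightarrow> int) \<Rightarrow> ('i \<Rightarrow> nat) \<Rightarrow> 'k::field \<Rightarrow>
    ('i \<Rightarrow> nat) \<Rightarrow> ('i \<Rightarrow> nat) \<Rightarrow> ('k, ('i wgen, 'k) free set) module" where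
  "yang_algebra I A s q \<kappa> \<kappa>' = wU I A s q 2 \<kappa> \<kappa>'"


section \<open>The quantum algebras \<open>U\<^sub>q\<close> and \<open>U\<^sub>q'\<close>\<close>

datatype 'i coroot = Hc 'i | Dc 'i

definition coweights :: "'i set \<Rightarrow> ('i coroot \<Rightarrow>\<^sub>0 int) set" where
  "coweights I = carrier (free_Abelian_group (Hc ` I \<union> Dc ` I))"

definition simple_root :: "('i \<Rightarrow> 'i \<Rightarrow> int) \<Rightarrow> 'i \<Rightarrow> ('i coroot \<Rightarrow>\<^sub>0 int) \<Rightarrow> int" where
  "simple_root A i h = (\<Sum>b\<in>Poly_Mapping.keys h.
     Poly_Mapping.lookup h b * (case b of Hc j \<Rightarrow> A j i | Dc j \<Rightarrow> kron i j))"

datatype 'i ugen = Ue 'i | Uf 'i | Uq "'i coroot \<Rightarrow>\<^sub>0 int"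

definition ugens :: "'i set \<Rightarrow> 'i ugen set" where
  "ugens I = (\<Union>i\<in>I. {Ue i, Uf i}) \<union> Uq ` coweights I"

inductive_set urels :: "'i set \<Rightarrow> ('i \<Rightarrow> 'i \<Rightarrow> int) \<Rightarrow> ('i \<Rightarrow> nat) \<Rightarrow> 'k::field \<Rightarrow>
    (('i ugen, 'k) free \<times> ('i ugen, 'k) free) set"
  for I A s q where
  "(var (Uq 0), 1) \<in> urels I A s q"
| "\<lbrakk>h \<in> coweights I; h' \<in> coweights I\<rbrakk> \<Longrightarrow>
    (var (Uq h) * var (Uq h'), var (Uq (h + h'))) \<in> urels I A s q"
| "\<lbrakk>h \<in> coweights I; i \<in> I\<rbrakk> \<Longrightarrow>
    (var (Uq h) * var (Ue i) * var (Uq (- h)), (q powi simple_root A i h) \<star> var (Ue i))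
      \<in> urels I A s q"
| "\<lbrakk>h \<in> coweights I; i \<in> I\<rbrakk> \<Longrightarrow>
    (var (Uq h) * var (Uf i) * var (Uq (- h)), (q powi (- simple_root A i h)) \<star> var (Uf i))
      \<in> urels I A s q"
| "\<lbrakk>i \<in> I; j \<in> I\<rbrakk> \<Longrightarrow>
    (var (Ue i) * var (Uf j) - var (Uf j) * var (Ue i),
     if i = j
     then inverse (q ^ s i - inverse (q ^ s i)) \<star>
       (var (Uq (Poly_Mapping.single (Hc i) (int (s i)))) -
        var (Uq (- Poly_Mapping.single (Hc i) (int (s i)))))
     else 0) \<in> urels I A s q"
| "\<lbrakk>i \<in> I; j \<in> I; A i i = 2; i \<noteq> j\<rbrakk> \<Longrightarrow>
    (serre (q ^ s i) (A i j) (var (Ue i)) (var (Ue j)), 0) \<in> urels I A s q"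
| "\<lbrakk>i \<in> I; j \<in> I; A i i = 2; i \<noteq> j\<rbrakk> \<Longrightarrow>
    (serre (q ^ s i) (A i j) (var (Uf i)) (var (Uf j)), 0) \<in> urels I A s q"
| "\<lbrakk>i \<in> I; j \<in> I; A i j = 0\<rbrakk> \<Longrightarrow>
    (var (Ue i) * var (Ue j) - var (Ue j) * var (Ue i), 0) \<in> urels I A s q"
| "\<lbrakk>i \<in> I; j \<in> I; A i j = 0\<rbrakk> \<Longrightarrow>
    (var (Uf i) * var (Uf j) - var (Uf j) * var (Uf i), 0) \<in> urels I A s q"

definition U_q :: "'i set \<Rightarrow> ('i \<Rightarrow> 'i \<Rightarrow> int) \<Rightarrow> ('i \<Rightarrow> nat) \<Rightarrow> 'k::field \<Rightarrow>
    ('k, ('i ugen, 'k) free set) module" where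
  "U_q I A s q = presented (ugens I) (urels I A s q)"

text \<open>\<open>\<Oplus>\<^sub>i \<int> s\<^sub>i h\<^sub>i \<oplus> \<Oplus>\<^sub>i \<int> d\<^sub>i\<close>\<close>

definition coweights' :: "'i set \<Rightarrow> ('i \<Rightarrow> nat) \<Rightarrow> ('i coroot \<Rightarrow>\<^sub>0 int) set" where
  "coweights' I s = {h \<in> coweights I. \<forall>i\<in>I. int (s i) dvd Poly_Mapping.lookup h (Hc i)}"

definition U_q' :: "'i set \<Rightarrow> ('i \<Rightarrow> 'i \<Rightarrow> int) \<Rightarrow> ('i \<Rightarrow> nat) \<Rightarrow> 'k::field \<Rightarrow>
    ('k, ('i ugen, 'k) free set) module" where
  "U_q' I A s q = gen_subalgebra (U_q I A s q) \<one>\<^bsub>U_q I A s q\<^esub>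
     (presented_gen (ugens I) (urels I A s q) `
        ((\<Union>i\<in>I. {Ue i, Uf i}) \<union> Uq ` coweights' I s))"

end

theory Submission
  imports Defs "HOL-Library.Function_Algebras"
begin

text \<open>Write \<open>W\<^sub>m\<close> for the weak quantum algebra with parameter \<open>m\<close>, and \<open>e = J\<^bsup>m-1\<^esup>\<close>.

  The element \<open>e\<close> is a central idempotent. It is the unit of the group generated by the torus
  generators, and \<open>e = K\<^sub>i Kbar\<^sub>i\<close> commutes with \<open>E\<^sub>i\<close>: for type one the two scalars cancel when the
  factors are moved past \<open>E\<^sub>i\<close>, and for type zero \<open>E\<^sub>i\<close> is a multiple of \<open>K\<^sub>i E\<^sub>i Kbar\<^sub>i\<close>, on
  which \<open>e\<close> acts as identity from both sides (\<open>J_power_central\<close>); the same holds for \<open>F\<^sub>i\<close>. This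
  gives the direct sum.

  For the quotient by \<open>1 - J\<close>, let \<open>P\<close> be the lattice of coweights, \<open>P'\<close> the sublattice that defines \<open>U\<^sub>q'\<close>, and
  \<open>V = W\<^sub>m / (1 - J)\<close>. In \<open>V\<close> the \<open>K\<^sub>i\<close> and \<open>D\<^sub>i\<close> are invertible and both types of relations become
  the relations of \<open>U\<^sub>q\<close>, so \<open>K\<^sub>i \<mapsto> q\<close> to the power \<open>s\<^sub>i h\<^sub>i\<close>, \<open>D\<^sub>i \<mapsto> q\<close> to the power \<open>d\<^sub>i\<close> defines
  \<open>\<phi>: W\<^sub>m \<rightarrow> U\<^sub>q\<close> with image \<open>U\<^sub>q'\<close>. The point is that its kernel is no larger than \<open>(1 - J)\<close>:
  since \<open>U\<^sub>q'\<close> is defined as a subalgebra and not by relations, \<open>V\<close> has to be embedded into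
  \<open>U\<^sub>q\<close>. For this \<open>U\<^sub>q\<close> is made to act on functions \<open>\<Phi>: P \<rightarrow> V\<close> by
    \<open>(e\<^sub>i \<Phi>)(x) = q\<^bsup>-\<alpha>\<^esup> E\<^sub>i \<Phi>(x)\<close>, \<open>(f\<^sub>i \<Phi>)(x) = q\<^bsup>\<alpha>\<^esup> F\<^sub>i \<Phi>(x)\<close> where \<open>\<alpha> = \<alpha>\<^sub>i(x)\<close>,
    and translation by \<open>h\<close> for the generator that belongs to \<open>h\<close>.
  On the functions with \<open>\<Phi>(x - s\<^sub>i h\<^sub>i) = K\<^sub>i \<Phi>(x)\<close> and \<open>\<Phi>(x - d\<^sub>i) = D\<^sub>i \<Phi>(x)\<close> all relations of
  \<open>U\<^sub>q\<close> hold (\<open>act_relation\<close>), and there \<open>(\<phi>(v) \<Phi>)(0) = v \<Phi>(0)\<close> (\<open>act_phi\<close>). As the torus of \<open>V\<close>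
  is a homomorphic image of the free abelian group \<open>P'\<close>, there is such a function with
  \<open>\<Phi>(0) = 1\<close>, supported on \<open>P'\<close> (\<open>torus_section_equivariant\<close>). So \<open>\<phi>(v) = 0\<close> implies \<open>v = 0\<close> in
  \<open>V\<close> (\<open>phi_kernel\<close>).

  For the two generated subalgebras, let \<open>\<theta>: W\<^sub>2 \<rightarrow> W\<^sub>m\<close> map \<open>J\<close> to \<open>e\<close> and fix the other generators. Its image is
  generated by the generators other than \<open>J\<close>, and the map \<open>W\<^sub>m \<rightarrow> W\<^sub>2\<close> that fixes all generators is a
  left inverse, because \<open>J\<close> is idempotent in \<open>W\<^sub>2\<close>; so this image is isomorphic to \<open>W\<^sub>2\<close>. The map
  \<open>x \<mapsto> \<theta>(x) e\<close> is multiplicative, maps onto the subalgebra with unit \<open>e\<close>, and kills \<open>1 - J\<close>.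
  Followed by \<open>\<phi>\<close> it is the map \<open>\<phi>\<close> of \<open>W\<^sub>2\<close>, whose kernel is \<open>(1 - J)\<close>. So \<open>\<phi>\<close> is injective on
  that image, and maps it onto \<open>U\<^sub>q'\<close>.\<close>

section \<open>Two-sided ideals and congruences\<close>

text \<open>The quotient algebras depend on parameters, so they are not types. All computations in them
  are carried out with representatives, in the ring type of the free algebra. The ideal is that of
  the whole type, so that no membership in carriers has to be checked along the way.\<close>

inductive_set tideal :: "('r::ring_1 \<times> 'r) set \<Rightarrow> 'r set" for R where
  zero: "0 \<in> tideal R"
| step: "\<lbrakk>(l, r) \<in> R; x \<in> tideal R\<rbrakk> \<Longrightarrow> x + u * (l - r) * v \<in> tideal R"

definition cong_rel :: "('r::ring_1 \<times> 'r) set \<Rightarrow> 'r \<Rightarrow> 'r \<Rightarrow> bool" where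
  "cong_rel R x y \<longleftrightarrow> x - y \<in> tideal R"

lemma tideal_add: "y \<in> tideal R \<Longrightarrow> x \<in> tideal R \<Longrightarrow> x + y \<in> tideal R"
  by (induction rule: tideal.induct) (auto simp: tideal.step add.assoc[symmetric])

lemma tideal_mult: "x \<in> tideal R \<Longrightarrow> a * x * b \<in> tideal R"
proof (induction rule: tideal.induct)
  case (step l r x u v)
  then show ?case
    using tideal.step[of l r R "a * x * b" "a * u" "v * b"] by (simp add: algebra_simps)
qed (simp add: tideal.zero)

lemma tideal_mult_left: "x \<in> tideal R \<Longrightarrow> a * x \<in> tideal R"
  using tideal_mult[of x R a 1] by simp

lemma tideal_mult_right: "x \<in> tideal R \<Longrightarrow> x * b \<in> tideal R"
  using tideal_mult[of x R 1 b] by simp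

lemma tideal_minus: "x \<in> tideal R \<Longrightarrow> - x \<in> tideal R"
  using tideal_mult_left[of x R "- 1"] by simp

lemma tideal_diff: "x \<in> tideal R \<Longrightarrow> y \<in> tideal R \<Longrightarrow> x - y \<in> tideal R"
  using tideal_add[OF tideal_minus, of y R x] by simp

lemma cong_base: "(l, r) \<in> R \<Longrightarrow> cong_rel R l r"
  using tideal.step[OF _ tideal.zero, of l r R 1 1] by (simp add: cong_rel_def)

lemma cong_refl [simp, intro]: "cong_rel R x x"
  by (simp add: cong_rel_def tideal.zero)

lemma cong_sym: "cong_rel R x y \<Longrightarrow> cong_rel R y x"
  using tideal_minus[of "x - y" R] by (simp add: cong_rel_def)

lemma cong_trans [trans]: "cong_rel R x y \<Longrightarrow> cong_rel R y z \<Longrightarrow> cong_rel R x z"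
  using tideal_add[of "y - z" R "x - y"] by (simp add: cong_rel_def)

lemma cong_add: "cong_rel R x y \<Longrightarrow> cong_rel R x' y' \<Longrightarrow> cong_rel R (x + x') (y + y')"
  using tideal_add[of "x' - y'" R "x - y"] by (simp add: cong_rel_def algebra_simps)

lemma cong_diff: "cong_rel R x y \<Longrightarrow> cong_rel R x' y' \<Longrightarrow> cong_rel R (x - x') (y - y')"
  using tideal_diff[of "x - y" R "x' - y'"] by (simp add: cong_rel_def algebra_simps)

lemma cong_mult: "cong_rel R x y \<Longrightarrow> cong_rel R x' y' \<Longrightarrow> cong_rel R (x * x') (y * y')"
  using tideal_add[OF tideal_mult_left[of "x' - y'" R y] tideal_mult_right[of "x - y" R x']]
  by (simp add: cong_rel_def algebra_simps)

lemma cong_left: "cong_rel R x y \<Longrightarrow> cong_rel R (a * x) (a * y)"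
  and cong_right: "cong_rel R x y \<Longrightarrow> cong_rel R (x * a) (y * a)"
  by (simp_all add: cong_mult)

lemma cong_0_iff: "cong_rel R x 0 \<longleftrightarrow> x \<in> tideal R"
  by (simp add: cong_rel_def)

lemma cong_in_tideal: "cong_rel R x y \<Longrightarrow> x \<in> tideal R \<longleftrightarrow> y \<in> tideal R"
  by (metis cong_0_iff cong_sym cong_trans)

lemma cong_mono: "R \<subseteq> R' \<Longrightarrow> cong_rel R x y \<Longrightarrow> cong_rel R' x y"
proof -
  assume R: "R \<subseteq> R'" and xy: "cong_rel R x y"
  have "z \<in> tideal R'" if "z \<in> tideal R" for z
    using that by induction (use R in \<open>auto intro: tideal.intros\<close>)
  with xy show ?thesis
    by (simp add: cong_rel_def)
qed

text \<open>This turns a commutation relation of type zero into one of type one, once the torus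
  generators are invertible.\<close>

lemma cong_move_right:
  assumes "cong_rel R (k * x * w) y" and "cong_rel R (w * k) 1"
  shows "cong_rel R (k * x) (y * k)"
proof -
  have "cong_rel R (k * x * (w * k)) (k * x * 1)"
    by (rule cong_left[OF assms(2)])
  moreover have "cong_rel R (k * x * w * k) (y * k)"
    by (rule cong_right[OF assms(1)])
  ultimately show ?thesis
    by (simp add: mult.assoc) (metis cong_sym cong_trans)
qed

lemma cong_inverse_unique:
  assumes "cong_rel R (w * k) 1" and "cong_rel R x (k * y)"
  shows "cong_rel R (w * x) y"
proof -
  have "cong_rel R (w * x) (w * (k * y))"
    by (rule cong_left[OF assms(2)])
  also have "w * (k * y) = (w * k) * y"
    by (simp add: mult.assoc)
  also have "cong_rel R ((w * k) * y) (1 * y)"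
    by (rule cong_right[OF assms(1)])
  finally show ?thesis by simp
qed

lemma cong_commute_power:
  assumes "cong_rel R (x * y) (y * x)"
  shows "cong_rel R (x ^ n * y) (y * x ^ n)"
proof (induction n)
  case (Suc n)
  have "cong_rel R (x * (x ^ n * y)) (x * (y * x ^ n))"
    by (rule cong_left[OF Suc])
  also have "x * (y * x ^ n) = (x * y) * x ^ n"
    by (simp add: mult.assoc)
  also have "cong_rel R ((x * y) * x ^ n) ((y * x) * x ^ n)"
    by (rule cong_right[OF assms])
  finally show ?case by (simp add: mult.assoc)
qed simp


section \<open>Free algebras acting on vector spaces\<close>

lemma sum_keys_superset:
  assumes "finite S" "Poly_Mapping.keys p \<subseteq> S" "\<And>w. f 0 w = 0"
  shows "(\<Sum>w\<in>Poly_Mapping.keys p. f (Poly_Mapping.lookup p w) w) =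
    (\<Sum>w\<in>S. f (Poly_Mapping.lookup p w) w)"
  using assms by (intro sum.mono_neutral_left) (auto simp: in_keys_iff)

lemma sum_keys_add:
  fixes f :: "'b::monoid_add \<Rightarrow> 'w \<Rightarrow> 'm::ab_group_add"
  assumes add: "\<And>a b w. f (a + b) w = f a w + f b w"
  shows "(\<Sum>w\<in>Poly_Mapping.keys (p + r). f (Poly_Mapping.lookup (p + r) w) w) =
    (\<Sum>w\<in>Poly_Mapping.keys p. f (Poly_Mapping.lookup p w) w) +
    (\<Sum>w\<in>Poly_Mapping.keys r. f (Poly_Mapping.lookup r w) w)"
proof -
  let ?S = "Poly_Mapping.keys p \<union> Poly_Mapping.keys r"
  have z: "f 0 w = 0" for w
    using add[of 0 0 w] by simp
  have "Poly_Mapping.keys (p + r) \<subseteq> ?S"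
    by (rule Poly_Mapping.keys_add)
  then show ?thesis
    using sum_keys_superset[of ?S "p + r" f] sum_keys_superset[of ?S p f]
      sum_keys_superset[of ?S r f]
    by (simp add: z lookup_add add sum.distrib)
qed

lemma poly_mapping_add_induct [case_names zero single add]:
  assumes "P 0" "\<And>w c. P (Poly_Mapping.single w c)" "\<And>p r. P p \<Longrightarrow> P r \<Longrightarrow> P (p + r)"
  shows "P (p :: 'w \<Rightarrow>\<^sub>0 'b::comm_monoid_add)"
proof (induction p rule: update_induct)
  case (update p a b)
  have "Poly_Mapping.update a b p = p + Poly_Mapping.single a b"
    using update.hyps
    by (intro poly_mapping_eqI) (auto simp: update.rep_eq lookup_add lookup_single when_def in_keys_iff)
  with update show ?case using assms by simp
qed (fact assms)

text \<open>A free algebra acts on a vector space as soon as each letter does. Both the substitution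
  homomorphisms and the module of equivariant functions below are instances.\<close>

definition act :: "('k::field \<Rightarrow> 'm \<Rightarrow> 'm) \<Rightarrow> ('x \<Rightarrow> 'm \<Rightarrow> 'm) \<Rightarrow> ('x, 'k) free \<Rightarrow> 'm::ab_group_add \<Rightarrow> 'm"
  where "act sc op p m =
    (\<Sum>w\<in>Poly_Mapping.keys p. sc (Poly_Mapping.lookup p w) (foldr op (letters w) m))"

locale free_action =
  fixes sc :: "'k::field \<Rightarrow> 'm::ab_group_add \<Rightarrow> 'm" and op :: "'x \<Rightarrow> 'm \<Rightarrow> 'm"
  assumes sc_add_right: "sc a (m + m') = sc a m + sc a m'"
    and sc_add_left: "sc (a + b) m = sc a m + sc b m"
    and sc_sc: "sc a (sc b m) = sc (a * b) m"
    and sc_one: "sc 1 m = m"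
    and op_add: "op x (m + m') = op x m + op x m'"
    and op_sc: "op x (sc a m) = sc a (op x m)"
begin

abbreviation act' where "act' \<equiv> act sc op"

lemma sc_zero [simp]: "sc a 0 = 0" "sc 0 m = 0"
  using sc_add_right[of a 0 0] sc_add_left[of 0 0 m] by auto

lemma act_add: "act' (p + r) m = act' p m + act' r m"
  unfolding act_def
  by (rule sum_keys_add[of "\<lambda>c w. sc c (foldr op (letters w) m)"]) (rule sc_add_left)

lemma act_zero [simp]: "act' 0 m = 0"
  by (simp add: act_def)

lemma act_minus: "act' (- p) m = - act' p m"
  using act_add[of "- p" p m] by (simp add: eq_neg_iff_add_eq_0)

lemma act_diff: "act' (p - r) m = act' p m - act' r m"
  using act_add[of p "- r" m] by (simp add: act_minus)

lemma act_single: "act' (Poly_Mapping.single w c) m = sc c (foldr op (letters w) m)"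
  by (simp add: act_def)

lemma act_one [simp]: "act' 1 m = m"
  using act_single[of 0 1 m] by (simp only: single_one sc_one) (simp add: zero_word_def)

lemma act_var [simp]: "act' (var x) m = op x m"
  by (simp add: var_def act_single sc_one)

lemma foldr_add: "foldr op xs (m + m') = foldr op xs m + foldr op xs m'"
  by (induction xs) (simp_all add: op_add)

lemma foldr_sc: "foldr op xs (sc a m) = sc a (foldr op xs m)"
  by (induction xs) (simp_all add: op_sc)

lemma foldr_zero: "foldr op xs 0 = 0"
  using foldr_add[of xs 0 0] by simp

lemma act_add_right: "act' p (m + m') = act' p m + act' p m'"
  by (simp add: act_def foldr_add sc_add_right sum.distrib)

lemma act_zero_right [simp]: "act' p 0 = 0"
  by (simp add: act_def foldr_zero)

lemma act_mult: "act' (p * r) m = act' p (act' r m)"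
proof (induction p rule: poly_mapping_add_induct)
  case (single u a)
  show ?case
  proof (induction r rule: poly_mapping_add_induct)
    case (single v b)
    show ?case
      by (simp add: mult_single act_single plus_word_def foldr_sc sc_sc)
  qed (simp_all add: distrib_left act_add act_add_right)
qed (simp_all add: distrib_right act_add)

lemma act_scal: "act' (c \<star> p) m = sc c (act' p m)"
  by (simp add: scal_def act_mult act_single zero_word_def)

lemma act_sum: "act' (\<Sum>a\<in>T. f a) m = (\<Sum>a\<in>T. act' (f a) m)"
  by (induction T rule: infinite_finite_induct) (simp_all add: act_add)

end


section \<open>Substitution homomorphisms\<close>

lemma scal_commute: "Poly_Mapping.single 0 c * p = p * Poly_Mapping.single 0 c"
  for p :: "('x, 'k::field) free"
  by (induction p rule: poly_mapping_add_induct)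
    (simp_all add: mult_single mult.commute distrib_left distrib_right)

lemma scal_mult_left: "(c \<star> p) * r = c \<star> (p * r)"
  by (simp add: scal_def mult.assoc)

lemma scal_mult_right: "p * (c \<star> r) = c \<star> (p * r)"
  unfolding scal_def by (metis scal_commute mult.assoc)

lemma scal_scal: "c \<star> d \<star> p = (c * d) \<star> p"
  by (simp add: scal_def mult.assoc[symmetric] mult_single)

lemma scal_one [simp]: "1 \<star> p = p"
  by (simp add: scal_def)

lemma scal_add_right: "c \<star> (p + r) = c \<star> p + c \<star> r"
  by (simp add: scal_def distrib_left)

lemma scal_diff_right: "c \<star> (p - r) = c \<star> p - c \<star> r"
  by (simp add: scal_def right_diff_distrib)

lemma scal_add_left: "(c + d) \<star> p = c \<star> p + d \<star> p"
  by (simp add: scal_def distrib_right single_add)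

lemma scal_zero_right [simp]: "c \<star> 0 = 0"
  by (simp add: scal_def)

lemma cong_scal: "cong_rel R x y \<Longrightarrow> cong_rel R (c \<star> x) (c \<star> y)"
  unfolding scal_def by (rule cong_left)

definition subst :: "('x \<Rightarrow> ('y, 'k::field) free) \<Rightarrow> ('x, 'k) free \<Rightarrow> ('y, 'k) free" where
  "subst g p = act (\<star>) (\<lambda>x m. g x * m) p 1"

lemma free_action_subst: "free_action (\<star>) (\<lambda>x m. g x * m)"
  by standard (simp_all add: scal_add_right scal_add_left scal_scal distrib_left scal_mult_right)

lemma act_subst: "act (\<star>) (\<lambda>x m. g x * m) p m = subst g p * m"
proof -
  have foldr: "foldr (\<lambda>x m. g x * m) xs m = foldr (\<lambda>x m. g x * m) xs 1 * m" for xs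
    by (induction xs) (simp_all add: mult.assoc)
  show ?thesis
    by (simp add: subst_def act_def sum_distrib_right scal_mult_left foldr[symmetric])
qed

context
  fixes g :: "'x \<Rightarrow> ('y, 'k::field) free"
begin

interpretation free_action "(\<star>)" "\<lambda>x m. g x * m"
  by (rule free_action_subst)

lemma subst_hom [simp]:
  "subst g (p + r) = subst g p + subst g r" "subst g (p - r) = subst g p - subst g r"
  "subst g (p * r) = subst g p * subst g r" "subst g (c \<star> p) = c \<star> subst g p"
  "subst g 0 = 0" "subst g 1 = 1" "subst g (var x) = g x"
  using act_mult[of p r 1] by (simp_all add: act_subst) (simp_all add: subst_def act_add act_diff act_scal)

lemma subst_power [simp]: "subst g (p ^ n) = subst g p ^ n"
  by (induction n) simp_all

lemma subst_sum: "subst g (\<Sum>a\<in>T. f a) = (\<Sum>a\<in>T. subst g (f a))"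
  by (simp add: subst_def act_sum)

lemma subst_serre [simp]: "subst g (serre c a x y) = serre c a (subst g x) (subst g y)"
  by (simp add: serre_def Let_def subst_sum)

end

text \<open>A substitution that respects the relations induces a homomorphism of the presented algebras;
  on the level of representatives, this is the following inclusion.\<close>

lemma subst_tideal:
  assumes "\<And>l r. (l, r) \<in> R \<Longrightarrow> cong_rel S (subst g l) (subst g r)" and "p \<in> tideal R"
  shows "subst g p \<in> tideal S"
  using assms(2)
proof induction
  case (step l r x u v)
  then show ?case
    using assms(1)[of l r] by (simp add: cong_rel_def tideal_add tideal_mult)
qed (simp add: tideal.zero)


section \<open>Presented algebras in terms of congruences\<close>

lemma free_carrier_induct [consumes 1, case_names zero one var add mult scal]:
  fixes p :: "('x, 'k::field) free"
  assumes "p \<in> carrier (free_algebra X)"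
    and "P 0" "P 1" "\<And>x. x \<in> X \<Longrightarrow> P (var x)"
    and "\<And>p r. P p \<Longrightarrow> P r \<Longrightarrow> P (p + r)" "\<And>p r. P p \<Longrightarrow> P r \<Longrightarrow> P (p * r)"
    and "\<And>c p. P p \<Longrightarrow> P (c \<star> p)"
  shows "P p"
proof -
  have word: "P (Poly_Mapping.single (Word xs) 1)" if "set xs \<subseteq> X" for xs
    using that
  proof (induction xs)
    case Nil
    have "Poly_Mapping.single (Word []) 1 = (1 :: ('x, 'k) free)"
      by (metis single_one zero_word_def)
    then show ?case using assms by simp
  next
    case (Cons x xs)
    have "(Poly_Mapping.single (Word (x # xs)) 1 :: ('x, 'k) free) = var x * Poly_Mapping.single (Word xs) 1"
      by (simp add: var_def mult_single plus_word_def)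
    with Cons show ?case using assms by simp
  qed
  have single: "P (Poly_Mapping.single w c)" if "set (letters w) \<subseteq> X" for w c
  proof -
    have "Poly_Mapping.single w c = c \<star> Poly_Mapping.single (Word (letters w)) 1"
      by (simp add: scal_def mult_single)
    then show ?thesis using word[OF that] assms by simp
  qed
  have "p \<in> carrier (free_algebra X) \<longrightarrow> P p"
  proof (induction p rule: update_induct)
    case (update p a b)
    show ?case
    proof
      assume up: "Poly_Mapping.update a b p \<in> carrier (free_algebra X)"
      have eq: "Poly_Mapping.update a b p = p + Poly_Mapping.single a b"
        using update.hyps
        by (intro poly_mapping_eqI) (auto simp: update.rep_eq lookup_add lookup_single when_def in_keys_iff)
      have keys: "Poly_Mapping.keys (Poly_Mapping.update a b p) = insert a (Poly_Mapping.keys p)"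
        using update.hyps by (auto simp: in_keys_iff update.rep_eq split: if_splits)
      with up have "P p" "set (letters a) \<subseteq> X"
        using update.IH by (auto simp: free_algebra_def)
      then show "P (Poly_Mapping.update a b p)"
        unfolding eq by (intro assms single)
    qed
  qed (use assms in simp)
  then show ?thesis using assms(1) by blast
qed

lemma free_carrier [simp, intro]:
  "x \<in> X \<Longrightarrow> var x \<in> carrier (free_algebra X)"
  "0 \<in> carrier (free_algebra X)" "1 \<in> carrier (free_algebra X)"
  "p \<in> carrier (free_algebra X) \<Longrightarrow> r \<in> carrier (free_algebra X) \<Longrightarrow> p + r \<in> carrier (free_algebra X)"
  "p \<in> carrier (free_algebra X) \<Longrightarrow> r \<in> carrier (free_algebra X) \<Longrightarrow> p * r \<in> carrier (free_algebra X)"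
  "p \<in> carrier (free_algebra X) \<Longrightarrow> - p \<in> carrier (free_algebra X)"
  "p \<in> carrier (free_algebra X) \<Longrightarrow> r \<in> carrier (free_algebra X) \<Longrightarrow> p - r \<in> carrier (free_algebra X)"
  "p \<in> carrier (free_algebra X) \<Longrightarrow> c \<star> p \<in> carrier (free_algebra X)"
  "p \<in> carrier (free_algebra X) \<Longrightarrow> p ^ n \<in> carrier (free_algebra X)"
proof -
  interpret A: ring "free_algebra X" by (rule free_ring)
  show var: "x \<in> X \<Longrightarrow> var x \<in> carrier (free_algebra X)" for x
    by (simp add: free_algebra_def var_def)
  show zo: "0 \<in> carrier (free_algebra X)" "1 \<in> carrier (free_algebra X)"
    using A.one_closed A.zero_closed by (simp_all add: free_algebra_def)
  show add: "p + r \<in> carrier (free_algebra X)" 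
    if "p \<in> carrier (free_algebra X)" "r \<in> carrier (free_algebra X)" for p r
    using A.a_closed[OF that] by (simp add: free_algebra_def)
  show mult: "p * r \<in> carrier (free_algebra X)" 
    if "p \<in> carrier (free_algebra X)" "r \<in> carrier (free_algebra X)" for p r
    using A.m_closed[OF that] by (simp add: free_algebra_def)
  show min: "- p \<in> carrier (free_algebra X)" if "p \<in> carrier (free_algebra X)" for p
    using that by (simp add: free_algebra_def)
  show "p - r \<in> carrier (free_algebra X)" 
    if "p \<in> carrier (free_algebra X)" "r \<in> carrier (free_algebra X)" for p r
    using add[OF that(1) min[OF that(2)]] by simp
  show "c \<star> p \<in> carrier (free_algebra X)" if "p \<in> carrier (free_algebra X)" for c p
    unfolding scal_def using that by (intro mult) (simp_all add: free_algebra_def zero_word_def)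
  show "p ^ n \<in> carrier (free_algebra X)" if "p \<in> carrier (free_algebra X)" for n p
    using that by (induction n) (auto intro: zo mult)
qed

lemma free_carrier_sum:
  "(\<And>a. a \<in> T \<Longrightarrow> f a \<in> carrier (free_algebra X)) \<Longrightarrow> (\<Sum>a\<in>T. f a) \<in> carrier (free_algebra X)"
  by (induction T rule: infinite_finite_induct) auto

lemma free_carrier_serre:
  "\<lbrakk>x \<in> carrier (free_algebra X); y \<in> carrier (free_algebra X)\<rbrakk> \<Longrightarrow> serre c a x y \<in> carrier (free_algebra X)"
  unfolding serre_def Let_def by (intro free_carrier_sum free_carrier)

lemma free_ops [simp]:
  "x \<otimes>\<^bsub>free_algebra X\<^esub> y = x * y" "x \<oplus>\<^bsub>free_algebra X\<^esub> y = x + y" "\<one>\<^bsub>free_algebra X\<^esub> = 1"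
  "\<zero>\<^bsub>free_algebra X\<^esub> = 0" "c \<odot>\<^bsub>free_algebra X\<^esub> x = c \<star> x"
  by (simp_all add: free_algebra_def)

lemma free_minus [simp]:
  "p \<in> carrier (free_algebra X) \<Longrightarrow> \<ominus>\<^bsub>free_algebra X\<^esub> p = - p"
  "\<lbrakk>p \<in> carrier (free_algebra X); r \<in> carrier (free_algebra X)\<rbrakk> \<Longrightarrow> p \<ominus>\<^bsub>free_algebra X\<^esub> r = p - r"
proof -
  interpret A: ring "free_algebra X" by (rule free_ring)
  show *: "\<ominus>\<^bsub>free_algebra X\<^esub> p = - p" if "p \<in> carrier (free_algebra X)" for p
    by (rule A.minus_equality) (use that in auto)
  show "p \<ominus>\<^bsub>free_algebra X\<^esub> r = p - r"
    if "p \<in> carrier (free_algebra X)" "r \<in> carrier (free_algebra X)" for p r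
    by (simp add: a_minus_def that *)
qed

lemma subst_carrier:
  assumes "\<And>x. x \<in> X \<Longrightarrow> g x \<in> carrier (free_algebra Y)" and "p \<in> carrier (free_algebra X)"
  shows "subst g p \<in> carrier (free_algebra Y)"
  using assms(2) by (induction rule: free_carrier_induct) (auto intro: assms(1))

lemma subst_var: "subst var p = p"
proof -
  have "p \<in> carrier (free_algebra UNIV)"
    by (simp add: free_algebra_def)
  then show ?thesis
    by (induction rule: free_carrier_induct) simp_all
qed

definition presented_by :: "'x set \<Rightarrow> (('x, 'k::field) free \<times> ('x, 'k) free) set \<Rightarrow> bool" where
  "presented_by X R \<longleftrightarrow> (\<forall>(l, r)\<in>R. l \<in> carrier (free_algebra X) \<and> r \<in> carrier (free_algebra X))"

lemma ideal_rel_ideal: "presented_by X R \<Longrightarrow> ideal (rel_ideal X R) (free_algebra X)"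
  unfolding rel_ideal_def
  by (rule ring.genideal_ideal[OF free_ring]) (auto simp: presented_by_def)

text \<open>Enlarging the alphabet adds nothing to the ideal on the old carrier: substituting \<open>0\<close> for the
  letters outside \<open>X\<close> maps the larger ideal into the smaller one and fixes \<open>p\<close>.\<close>

lemma rel_ideal_iff:
  assumes "presented_by X R" and "p \<in> carrier (free_algebra X)"
  shows "p \<in> rel_ideal X R \<longleftrightarrow> p \<in> tideal R"
proof
  interpret A: ring "free_algebra X" by (rule free_ring)
  interpret N: ideal "rel_ideal X R" "free_algebra X"
    by (rule ideal_rel_ideal[OF assms(1)])
  define g where "g x = (if x \<in> X then var x else 0 :: ('a, 'b) free)" for x
  have g: "subst g r = r" if "r \<in> carrier (free_algebra X)" for r
    using that by (induction rule: free_carrier_induct) (simp_all add: g_def)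
  have gc: "subst g r \<in> carrier (free_algebra X)" for r
  proof (rule subst_carrier[of UNIV])
    show "r \<in> carrier (free_algebra UNIV)" by (simp add: free_algebra_def)
  qed (auto simp: g_def)
  assume "p \<in> tideal R"
  then have "subst g p \<in> rel_ideal X R"
  proof induction
    case zero
    then show ?case using N.zero_closed by simp
  next
    case (step l r x u v)
    then have lr: "l \<in> carrier (free_algebra X)" "r \<in> carrier (free_algebra X)"
      using assms(1) by (auto simp: presented_by_def)
    have "l - r \<in> rel_ideal X R"
      unfolding rel_ideal_def
      by (rule subsetD[OF A.genideal_self]) (use assms(1) step in \<open>auto simp: presented_by_def\<close>)
    then have "subst g u * (l - r) * subst g v \<in> rel_ideal X R"
      using N.I_l_closed[of "l - r" "subst g u"] N.I_r_closed[of "subst g u * (l - r)" "subst g v"] gc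
      by simp
    then show ?case
      using N.a_closed step lr by (simp add: g)
  qed
  then show "p \<in> rel_ideal X R"
    by (simp add: g assms)
next
  assume p: "p \<in> rel_ideal X R"
  interpret A: ring "free_algebra X" by (rule free_ring)
  have "ideal (tideal R \<inter> carrier (free_algebra X)) (free_algebra X)"
  proof (rule idealI)
    show "subgroup (tideal R \<inter> carrier (free_algebra X)) (add_monoid (free_algebra X))"
      using A.add.inv_closed
      by (intro A.add.subgroupI) (auto simp: tideal_add tideal_minus a_inv_def[symmetric] intro: tideal.zero)
  qed (auto simp: free_ring tideal_mult_left tideal_mult_right)
  moreover have "{l - r |l r. (l, r) \<in> R} \<subseteq> tideal R \<inter> carrier (free_algebra X)"
    using assms(1) by (auto simp: presented_by_def cong_base cong_rel_def[symmetric])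
  ultimately show "p \<in> tideal R"
    using p A.genideal_minimal[of "tideal R \<inter> carrier (free_algebra X)"]
    unfolding rel_ideal_def by blast
qed

section \<open>Associative algebras and their homomorphisms\<close>

lemma scalars_simps [simp]:
  "carrier scalars = UNIV" "x \<otimes>\<^bsub>scalars\<^esub> y = x * y" "\<one>\<^bsub>scalars\<^esub> = 1" "\<zero>\<^bsub>scalars\<^esub> = 0"
  "x \<oplus>\<^bsub>scalars\<^esub> y = x + y"
  by (simp_all add: scalars_def)

lemma cring_scalars: "cring (scalars :: 'k::field ring)"
proof (rule cringI)
  show "abelian_group (scalars :: 'k ring)"
  proof (rule abelian_groupI)
    fix x :: 'k
    show "\<exists>y\<in>carrier scalars. y \<oplus>\<^bsub>scalars\<^esub> x = \<zero>\<^bsub>scalars\<^esub>"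
      by (rule bexI[of _ "- x"]) simp_all
  qed (simp_all add: add.assoc add.commute)
  show "Group.comm_monoid (scalars :: 'k ring)"
    by (rule comm_monoidI) (simp_all add: mult.assoc mult.commute)
qed (simp_all add: distrib_right)

locale assoc_alg = ring A for A :: "('k::field, 'a) module" (structure) +
  assumes smult_closed [simp, intro]: "x \<in> carrier A \<Longrightarrow> c \<odot> x \<in> carrier A"
    and smult_l_distr: "x \<in> carrier A \<Longrightarrow> (c + d) \<odot> x = c \<odot> x \<oplus> d \<odot> x"
    and smult_r_distr: "\<lbrakk>x \<in> carrier A; y \<in> carrier A\<rbrakk> \<Longrightarrow> c \<odot> (x \<oplus> y) = c \<odot> x \<oplus> c \<odot> y"
    and smult_smult: "x \<in> carrier A \<Longrightarrow> (c * d) \<odot> x = c \<odot> (d \<odot> x)"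
    and smult_one [simp]: "x \<in> carrier A \<Longrightarrow> 1 \<odot> x = x"
    and smult_mult_left: "\<lbrakk>x \<in> carrier A; y \<in> carrier A\<rbrakk> \<Longrightarrow> (c \<odot> x) \<otimes> y = c \<odot> (x \<otimes> y)"
    and smult_mult_right: "\<lbrakk>x \<in> carrier A; y \<in> carrier A\<rbrakk> \<Longrightarrow> x \<otimes> (c \<odot> y) = c \<odot> (x \<otimes> y)"
begin

lemma diff_eq_zero_iff: "\<lbrakk>x \<in> carrier A; y \<in> carrier A\<rbrakk> \<Longrightarrow> x \<ominus> y = \<zero> \<longleftrightarrow> x = y"
  by (metis a_minus_def a_inv_closed minus_equality minus_minus r_neg)

end

lemma assoc_algebra_iff: "assoc_algebra A \<longleftrightarrow> assoc_alg A"
proof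
  assume A: "assoc_algebra A"
  then interpret ring A by (simp add: assoc_algebra_def)
  interpret M: Module.module scalars A using A by (simp add: assoc_algebra_def)
  have "c \<odot>\<^bsub>A\<^esub> x \<otimes>\<^bsub>A\<^esub> y = c \<odot>\<^bsub>A\<^esub> (x \<otimes>\<^bsub>A\<^esub> y)" "x \<otimes>\<^bsub>A\<^esub> (c \<odot>\<^bsub>A\<^esub> y) = c \<odot>\<^bsub>A\<^esub> (x \<otimes>\<^bsub>A\<^esub> y)"
    if "x \<in> carrier A" "y \<in> carrier A" for x y c
    using A that unfolding assoc_algebra_def by metis+
  then show "assoc_alg A"
    using M.smult_closed M.smult_l_distr M.smult_r_distr M.smult_assoc1 M.smult_one
    by unfold_locales auto
next
  assume "assoc_alg A"
  then interpret assoc_alg A .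
  have "Module.module scalars A"
    by (rule moduleI)
      (auto simp: cring_scalars is_abelian_group smult_l_distr smult_r_distr smult_smult)
  then show "assoc_algebra A"
    by (simp add: assoc_algebra_def ring_axioms smult_mult_left smult_mult_right)
qed

text \<open>The unit need not be preserved, so that multiplication by a central idempotent is included.\<close>

definition alg_map :: "('k::field, 'a) module \<Rightarrow> ('k, 'b) module \<Rightarrow> ('a \<Rightarrow> 'b) set" where
  "alg_map A B = {h \<in> carrier A \<rightarrow> carrier B.
     (\<forall>x\<in>carrier A. \<forall>y\<in>carrier A. h (x \<oplus>\<^bsub>A\<^esub> y) = h x \<oplus>\<^bsub>B\<^esub> h y \<and> h (x \<otimes>\<^bsub>A\<^esub> y) = h x \<otimes>\<^bsub>B\<^esub> h y) \<and>
     (\<forall>c. \<forall>x\<in>carrier A. h (c \<odot>\<^bsub>A\<^esub> x) = c \<odot>\<^bsub>B\<^esub> h x)}"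

lemma alg_mapD:
  assumes "h \<in> alg_map A B"
  shows "x \<in> carrier A \<Longrightarrow> h x \<in> carrier B"
    and "\<lbrakk>x \<in> carrier A; y \<in> carrier A\<rbrakk> \<Longrightarrow> h (x \<oplus>\<^bsub>A\<^esub> y) = h x \<oplus>\<^bsub>B\<^esub> h y"
    and "\<lbrakk>x \<in> carrier A; y \<in> carrier A\<rbrakk> \<Longrightarrow> h (x \<otimes>\<^bsub>A\<^esub> y) = h x \<otimes>\<^bsub>B\<^esub> h y"
    and "x \<in> carrier A \<Longrightarrow> h (c \<odot>\<^bsub>A\<^esub> x) = c \<odot>\<^bsub>B\<^esub> h x"
  using assms by (auto simp: alg_map_def)

lemma alg_map_comp: "f \<in> alg_map A B \<Longrightarrow> g \<in> alg_map B C \<Longrightarrow> (\<lambda>x. g (f x)) \<in> alg_map A C"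
  by (auto simp: alg_map_def Pi_iff)

definition sub_alg :: "('k::field, 'a) module \<Rightarrow> 'a set \<Rightarrow> 'a \<Rightarrow> ('k, 'a) module" where
  "sub_alg A S u = A\<lparr>carrier := S, one := u\<rparr>"

lemma sub_alg_simps [simp]:
  "carrier (sub_alg A S u) = S" "x \<otimes>\<^bsub>sub_alg A S u\<^esub> y = x \<otimes>\<^bsub>A\<^esub> y" "\<one>\<^bsub>sub_alg A S u\<^esub> = u"
  "\<zero>\<^bsub>sub_alg A S u\<^esub> = \<zero>\<^bsub>A\<^esub>" "x \<oplus>\<^bsub>sub_alg A S u\<^esub> y = x \<oplus>\<^bsub>A\<^esub> y" "c \<odot>\<^bsub>sub_alg A S u\<^esub> x = c \<odot>\<^bsub>A\<^esub> x"
  by (simp_all add: sub_alg_def)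

lemma sub_alg_carrier: "sub_alg A (carrier A) \<one>\<^bsub>A\<^esub> = A"
  by (simp add: sub_alg_def)

locale alg_map_locale = A: assoc_alg A + B: assoc_alg B
  for A :: "('k::field, 'a) module" and B :: "('k, 'b) module" +
  fixes h
  assumes h: "h \<in> alg_map A B"
begin

lemmas hom = alg_mapD[OF h]

lemma hom_zero: "h \<zero>\<^bsub>A\<^esub> = \<zero>\<^bsub>B\<^esub>"
proof -
  have "h \<zero>\<^bsub>A\<^esub> \<oplus>\<^bsub>B\<^esub> h \<zero>\<^bsub>A\<^esub> = h \<zero>\<^bsub>A\<^esub>"
    using hom(2)[of "\<zero>\<^bsub>A\<^esub>" "\<zero>\<^bsub>A\<^esub>"] by simp
  then show ?thesis
    by (metis A.zero_closed B.add.r_cancel_one' hom(1))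
qed

lemma hom_minus: "x \<in> carrier A \<Longrightarrow> h (\<ominus>\<^bsub>A\<^esub> x) = \<ominus>\<^bsub>B\<^esub> h x"
  using hom(2)[of "\<ominus>\<^bsub>A\<^esub> x" x] hom_zero
  by (metis A.a_inv_closed A.l_neg B.minus_equality hom(1))

lemma hom_diff: "x \<in> carrier A \<Longrightarrow> y \<in> carrier A \<Longrightarrow> h (x \<ominus>\<^bsub>A\<^esub> y) = h x \<ominus>\<^bsub>B\<^esub> h y"
  by (simp add: a_minus_def hom hom_minus)

lemma image_assoc_alg: "assoc_alg (sub_alg B (h ` carrier A) (h \<one>\<^bsub>A\<^esub>))"
proof -
  let ?S = "sub_alg B (h ` carrier A) (h \<one>\<^bsub>A\<^esub>)"
  have "ring ?S"
  proof (rule ringI)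
    show "abelian_group ?S"
    proof (rule abelian_groupI)
      show "x \<oplus>\<^bsub>?S\<^esub> y \<in> carrier ?S" if "x \<in> carrier ?S" "y \<in> carrier ?S" for x y
        using that by (auto simp: hom(2)[symmetric])
      show "\<zero>\<^bsub>?S\<^esub> \<in> carrier ?S"
        using hom_zero by (auto intro: image_eqI[of _ _ "\<zero>\<^bsub>A\<^esub>"])
      show "\<exists>y\<in>carrier ?S. y \<oplus>\<^bsub>?S\<^esub> x = \<zero>\<^bsub>?S\<^esub>" if "x \<in> carrier ?S" for x
        using that by (auto simp: hom_minus intro!: bexI[of _ "\<ominus>\<^bsub>A\<^esub> _"] B.l_neg hom(1))
    qed (auto intro!: B.add.m_assoc B.add.m_comm hom(1) simp: hom(1))
    show "monoid ?S"
    proof (rule monoidI)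
      show "x \<otimes>\<^bsub>?S\<^esub> y \<in> carrier ?S" if "x \<in> carrier ?S" "y \<in> carrier ?S" for x y
        using that by (auto simp: hom(3)[symmetric])
    qed (auto intro!: B.m_assoc simp: hom(1) hom(3)[symmetric])
  qed (auto simp: B.l_distr B.r_distr hom(1))
  then interpret S: ring ?S .
  show ?thesis
  proof unfold_locales
    show "c \<odot>\<^bsub>?S\<^esub> x \<in> carrier ?S" if "x \<in> carrier ?S" for c x
      using that by (auto simp: hom(4)[symmetric])
  qed (auto simp: B.smult_l_distr B.smult_r_distr B.smult_smult B.smult_mult_left
      B.smult_mult_right hom(1))
qed

end

lemma (in alg_map_locale) kernel_ideal: "ideal {x \<in> carrier A. h x = \<zero>\<^bsub>B\<^esub>} A"
proof (rule idealI)
  show "subgroup {x \<in> carrier A. h x = \<zero>\<^bsub>B\<^esub>} (add_monoid A)"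
    by (rule A.add.subgroupI) (auto simp: hom hom_minus hom_zero intro: exI[of _ "\<zero>\<^bsub>A\<^esub>"])
qed (auto simp: hom A.ring_axioms)

lemma alg_map_localeI: "assoc_alg A \<Longrightarrow> assoc_alg B \<Longrightarrow> h \<in> alg_map A B \<Longrightarrow> alg_map_locale A B h"
  by (simp add: alg_map_locale_def alg_map_locale_axioms_def)

text \<open>Every isomorphism below has this shape: the image of one homomorphism \<open>f\<close> is identified by
  another one that is injective on it.\<close>

lemma image_alg_isomorphic:
  assumes "assoc_alg C" "assoc_alg A" "assoc_alg B" and f: "f \<in> alg_map C A" and h: "h \<in> alg_map A B"
    and ker: "\<And>c. c \<in> carrier C \<Longrightarrow> h (f c) = \<zero>\<^bsub>B\<^esub> \<Longrightarrow> f c = \<zero>\<^bsub>A\<^esub>"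
  shows "alg_isomorphic (sub_alg A (f ` carrier C) (f \<one>\<^bsub>C\<^esub>))
    (sub_alg B ((\<lambda>x. h (f x)) ` carrier C) (h (f \<one>\<^bsub>C\<^esub>)))"
proof -
  interpret C: assoc_alg C by fact
  interpret f: alg_map_locale C A f
    using assms by (simp add: alg_map_locale_def alg_map_locale_axioms_def)
  interpret h: alg_map_locale A B h
    using assms by (simp add: alg_map_locale_def alg_map_locale_axioms_def)
  interpret hf: alg_map_locale C B "\<lambda>x. h (f x)"
    using assms alg_map_comp[OF f h] by (simp add: alg_map_locale_def alg_map_locale_axioms_def)
  let ?S = "sub_alg A (f ` carrier C) (f \<one>\<^bsub>C\<^esub>)"
  let ?T = "sub_alg B ((\<lambda>x. h (f x)) ` carrier C) (h (f \<one>\<^bsub>C\<^esub>))"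
  have "inj_on h (f ` carrier C)"
  proof (rule inj_onI, clarify)
    fix x y assume xy: "x \<in> carrier C" "y \<in> carrier C" "h (f x) = h (f y)"
    then have "h (f (x \<ominus>\<^bsub>C\<^esub> y)) = \<zero>\<^bsub>B\<^esub>"
      by (simp add: hf.hom_diff hf.hom(1)) (simp add: a_minus_def h.B.r_neg hf.hom(1))
    then have "f x \<ominus>\<^bsub>A\<^esub> f y = \<zero>\<^bsub>A\<^esub>"
      using ker xy by (simp add: f.hom_diff[symmetric])
    then show "f x = f y"
      using xy f.B.diff_eq_zero_iff f.hom(1) by blast
  qed
  then have "bij_betw h (carrier ?S) (carrier ?T)"
    by (auto simp: bij_betw_def image_image)
  moreover have "h \<in> ring_hom ?S ?T"
    by (rule ring_hom_memI) (auto simp: h.hom f.hom(1))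
  ultimately have "h \<in> alg_iso ?S ?T"
    by (auto simp: alg_iso_def ring_iso_def h.hom f.hom(1))
  then show ?thesis
    using f.image_assoc_alg hf.image_assoc_alg by (auto simp: alg_isomorphic_def assoc_algebra_iff)
qed


section \<open>Quotients and generated subalgebras\<close>

context assoc_alg
begin

context
  fixes N assumes N: "ideal N A"
begin

interpretation N: ideal N A by (rule N)

lemma coset_eq_iff: "\<lbrakk>x \<in> carrier A; y \<in> carrier A\<rbrakk> \<Longrightarrow> N +> x = N +> y \<longleftrightarrow> x \<ominus> y \<in> N"
  using quotient_eq_iff_same_a_r_cos[OF N] by blast

lemma ideal_smult: "n \<in> N \<Longrightarrow> c \<odot> n \<in> N"
  using N.I_l_closed[of n "c \<odot> \<one>"] by (simp add: smult_mult_left N.Icarr)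

lemma alg_quot_simps:
  "carrier (alg_quot A N) = (\<lambda>x. N +> x) ` carrier A"
  "\<one>\<^bsub>alg_quot A N\<^esub> = N +> \<one>" "\<zero>\<^bsub>alg_quot A N\<^esub> = N +> \<zero>"
  "\<lbrakk>x \<in> carrier A; y \<in> carrier A\<rbrakk> \<Longrightarrow> (N +> x) \<otimes>\<^bsub>alg_quot A N\<^esub> (N +> y) = N +> (x \<otimes> y)"
  "\<lbrakk>x \<in> carrier A; y \<in> carrier A\<rbrakk> \<Longrightarrow> (N +> x) \<oplus>\<^bsub>alg_quot A N\<^esub> (N +> y) = N +> (x \<oplus> y)"
  "x \<in> carrier A \<Longrightarrow> c \<odot>\<^bsub>alg_quot A N\<^esub> (N +> x) = N +> (c \<odot> x)"
proof -
  show "carrier (alg_quot A N) = (\<lambda>x. N +> x) ` carrier A"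
    by (auto simp: alg_quot_def ring.defs FactRing_def A_RCOSETS_def')
  show "\<one>\<^bsub>alg_quot A N\<^esub> = N +> \<one>" "\<zero>\<^bsub>alg_quot A N\<^esub> = N +> \<zero>"
    using a_coset_join2[OF zero_closed N.is_additive_subgroup[THEN additive_subgroup.a_subgroup] N.zero_closed]
    by (simp_all add: alg_quot_def ring.defs FactRing_def)
  show "(N +> x) \<otimes>\<^bsub>alg_quot A N\<^esub> (N +> y) = N +> (x \<otimes> y)" if "x \<in> carrier A" "y \<in> carrier A" for x y
    using N.rcoset_mult_add[OF that] by (simp add: alg_quot_def ring.defs FactRing_def)
  show "(N +> x) \<oplus>\<^bsub>alg_quot A N\<^esub> (N +> y) = N +> (x \<oplus> y)" if "x \<in> carrier A" "y \<in> carrier A" for x y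
    using N.a_rcos_sum[OF that] by (simp add: alg_quot_def ring.defs FactRing_def)
  show "c \<odot>\<^bsub>alg_quot A N\<^esub> (N +> x) = N +> (c \<odot> x)" if x: "x \<in> carrier A"
  proof -
    have "N +> (c \<odot> y) = N +> (c \<odot> x)" if y: "y \<in> N +> x" for y
    proof -
      from y obtain n where n: "n \<in> N" "y = n \<oplus> x"
        by (auto simp: a_r_coset_def')
      have "c \<odot> y \<ominus> c \<odot> x = c \<odot> n"
        using n x N.Icarr[OF n(1)] by (simp add: smult_r_distr a_minus_def a_assoc r_neg)
      moreover have "y \<in> carrier A"
        using n x N.Icarr by simp
      ultimately show ?thesis
        using x n by (subst coset_eq_iff) (simp_all add: ideal_smult)
    qed
    moreover have "x \<in> N +> x"
      by (rule N.a_rcos_self[OF x])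
    ultimately have "(\<Union>y\<in>N +> x. N +> (c \<odot> y)) = N +> (c \<odot> x)"
      by blast
    then show ?thesis
      by (simp add: alg_quot_def ring.defs module.defs)
  qed
qed

lemma alg_quot_assoc_alg: "assoc_alg (alg_quot A N)"
proof -
  let ?Q = "alg_quot A N"
  interpret Q': ring "A Quot N"
    by (rule ideal.quotient_is_ring[OF N])
  have ops: "carrier ?Q = carrier (A Quot N)" "monoid.mult ?Q = monoid.mult (A Quot N)"
    "add ?Q = add (A Quot N)" "\<one>\<^bsub>?Q\<^esub> = \<one>\<^bsub>A Quot N\<^esub>" "\<zero>\<^bsub>?Q\<^esub> = \<zero>\<^bsub>A Quot N\<^esub>"
    by (simp_all add: alg_quot_def ring.defs)
  have "ring ?Q"
  proof (rule ringI)
    show "abelian_group ?Q"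
    proof (rule abelian_groupI)
      fix x assume "x \<in> carrier ?Q"
      then show "\<exists>y\<in>carrier ?Q. y \<oplus>\<^bsub>?Q\<^esub> x = \<zero>\<^bsub>?Q\<^esub>"
        unfolding ops by (intro bexI[of _ "\<ominus>\<^bsub>A Quot N\<^esub> x"] Q'.l_neg Q'.a_inv_closed)
    qed (simp_all only: ops Q'.a_closed Q'.zero_closed Q'.l_zero Q'.r_zero Q'.a_ac)
    show "monoid ?Q"
      by (rule monoidI)
        (simp_all only: ops Q'.m_closed Q'.one_closed Q'.m_assoc Q'.l_one Q'.r_one)
  qed (simp_all only: ops Q'.l_distr Q'.r_distr)
  then interpret Q: ring ?Q .
  show ?thesis
    by (intro assoc_alg.intro assoc_alg_axioms.intro Q.ring_axioms)
      (auto simp: alg_quot_simps smult_l_distr smult_r_distr smult_smult smult_mult_left smult_mult_right)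
qed

lemma quot_map: "(\<lambda>x. N +> x) \<in> alg_map A (alg_quot A N)"
  by (auto simp: alg_map_def alg_quot_simps)

lemma alg_quot_lift:
  assumes "assoc_alg B" and h: "h \<in> alg_map A B" and ker: "\<And>n. n \<in> N \<Longrightarrow> h n = \<zero>\<^bsub>B\<^esub>"
  obtains k where "k \<in> alg_map (alg_quot A N) B" and "\<And>x. x \<in> carrier A \<Longrightarrow> k (N +> x) = h x"
proof -
  interpret h: alg_map_locale A B h
    by (rule alg_map_localeI[OF assoc_alg_axioms assms(1) h])
  define k where "k X = h (SOME x. x \<in> carrier A \<and> X = N +> x)" for X
  have k: "k (N +> x) = h x" if x: "x \<in> carrier A" for x
  proof -
    define y where "y = (SOME y. y \<in> carrier A \<and> N +> x = N +> y)"
    have y: "y \<in> carrier A \<and> N +> x = N +> y"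
      unfolding y_def by (rule someI[of _ x]) (simp add: x)
    then have "x \<ominus> y \<in> N"
      using coset_eq_iff[of x y] x by simp
    then have "h x \<ominus>\<^bsub>B\<^esub> h y = \<zero>\<^bsub>B\<^esub>"
      using ker x y by (simp add: h.hom_diff[symmetric])
    then have "h x = h y"
      using h.B.diff_eq_zero_iff h.hom(1) x y by simp
    then show ?thesis
      unfolding k_def y_def by simp
  qed
  moreover from k have "k \<in> alg_map (alg_quot A N) B"
    by (auto simp: alg_map_def alg_quot_simps h.hom)
  ultimately show ?thesis
    using that by blast
qed

end

lemma mult_map:
  assumes "e \<in> carrier A" "e \<otimes> e = e" "\<And>x. x \<in> carrier A \<Longrightarrow> e \<otimes> x = x \<otimes> e"
  shows "(\<lambda>x. x \<otimes> e) \<in> alg_map A A"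
proof -
  have "(x \<otimes> e) \<otimes> (y \<otimes> e) = x \<otimes> y \<otimes> e" if "x \<in> carrier A" "y \<in> carrier A" for x y
  proof -
    have "(x \<otimes> e) \<otimes> (y \<otimes> e) = x \<otimes> (e \<otimes> y) \<otimes> e"
      using that assms(1) by (simp add: m_assoc)
    also have "\<dots> = x \<otimes> y \<otimes> (e \<otimes> e)"
      unfolding assms(3)[OF that(2)] using that assms(1) by (simp add: m_assoc)
    finally show ?thesis
      using assms(2) by simp
  qed
  then show ?thesis
    using assms(1) by (auto simp: alg_map_def l_distr smult_mult_left)
qed

text \<open>The inverse of the addition is \<open>x \<mapsto> (x e, x (1 - e))\<close>; mixed products vanish because
  \<open>e (1 - e) = 0\<close> and \<open>e\<close> can be moved across.\<close>

lemma central_idempotent_direct_sum: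
  assumes e: "e \<in> carrier A" "e \<otimes> e = e" and central: "\<And>x. x \<in> carrier A \<Longrightarrow> e \<otimes> x = x \<otimes> e"
  shows "alg_direct_sum A (alg_part A e) (alg_part A (\<one> \<ominus> e))"
proof -
  let ?f = "\<one> \<ominus> e"
  have f: "?f \<in> carrier A"
    using e by simp
  have xf: "x \<otimes> ?f = x \<ominus> x \<otimes> e" and fx: "?f \<otimes> x = x \<ominus> e \<otimes> x" if "x \<in> carrier A" for x
    using that e by (simp_all add: a_minus_def l_distr r_distr l_minus r_minus)
  have ef: "e \<otimes> ?f = \<zero>" "?f \<otimes> e = \<zero>"
    using xf[OF e(1)] fx[OF e(1)] e by (simp_all add: a_minus_def r_neg)
  have ff: "?f \<otimes> ?f = ?f"
    using xf[OF f] ef f by (simp add: a_minus_def)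
  have fc: "?f \<otimes> x = x \<otimes> ?f" if "x \<in> carrier A" for x
    using that by (simp add: xf fx central[OF that])
  have part: "alg_part A u = sub_alg A ((\<lambda>x. x \<otimes> u) ` carrier A) (\<one> \<otimes> u)" if "u \<in> carrier A" for u
    using that by (simp add: alg_part_def sub_alg_def)
  have part_alg: "assoc_algebra (alg_part A u)"
    if "u \<in> carrier A" "u \<otimes> u = u" "\<And>x. x \<in> carrier A \<Longrightarrow> u \<otimes> x = x \<otimes> u" for u
  proof -
    interpret alg_map_locale A A "\<lambda>x. x \<otimes> u"
      using mult_map[OF that] assoc_alg_axioms by (simp add: alg_map_locale_def alg_map_locale_axioms_def)
    show ?thesis
      unfolding part[OF that(1)] assoc_algebra_iff by (rule image_assoc_alg)
  qed
  define B C where BC: "B = (\<lambda>x. x \<otimes> e) ` carrier A" "C = (\<lambda>x. x \<otimes> ?f) ` carrier A"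
  let ?P = "alg_prod (alg_part A e) (alg_part A ?f)" and ?s = "\<lambda>(b, c). b \<oplus> c"
  have Pc: "carrier ?P = B \<times> C"
    by (simp add: alg_prod_def ring.defs RDirProd_carrier alg_part_def BC)
  have Pm: "(b, c) \<otimes>\<^bsub>?P\<^esub> (b', c') = (b \<otimes> b', c \<otimes> c')" "(b, c) \<oplus>\<^bsub>?P\<^esub> (b', c') = (b \<oplus> b', c \<oplus> c')"
    "\<one>\<^bsub>?P\<^esub> = (e, ?f)" "k \<odot>\<^bsub>?P\<^esub> (b, c) = (k \<odot> b, k \<odot> c)" for b c b' c' k
    by (simp_all add: alg_prod_def ring.defs module.defs RDirProd_def DirProd_def alg_part_def monoid.defs)
  have e_part: "b \<otimes> e = b" "b \<in> carrier A" "b \<otimes> ?f = \<zero>" if "b \<in> B" for b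
    using that e f ef by (auto simp: BC m_assoc)
  have f_part: "c \<otimes> ?f = c" "c \<in> carrier A" "c \<otimes> e = \<zero>" if "c \<in> C" for c
    using that e(1) f ef ff by (auto simp: BC m_assoc)
  have cross: "b \<otimes> c = \<zero>" "c \<otimes> b = \<zero>"
    if b: "b \<in> B" and c: "c \<in> C" for b c
  proof -
    have "b \<otimes> c = b \<otimes> (e \<otimes> c)"
      using e_part[OF b] f_part[OF c] e by (simp add: m_assoc[symmetric])
    also have "\<dots> = \<zero>"
      using e_part[OF b] f_part[OF c] by (simp add: central[of c])
    finally show "b \<otimes> c = \<zero>" .
    have "c \<otimes> b = c \<otimes> (?f \<otimes> b)"
      using e_part[OF b] f_part[OF c] f by (simp add: m_assoc[symmetric])
    also have "\<dots> = \<zero>"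
      using e_part[OF b] f_part[OF c] by (simp add: fc[of b])
    finally show "c \<otimes> b = \<zero>" .
  qed
  have "?s \<in> ring_hom ?P A"
  proof (rule ring_hom_memI)
    show "?s x \<in> carrier A" if "x \<in> carrier ?P" for x
      using that e_part f_part by (auto simp: Pc)
    show "?s (x \<otimes>\<^bsub>?P\<^esub> y) = ?s x \<otimes> ?s y" if xy: "x \<in> carrier ?P" "y \<in> carrier ?P" for x y
    proof -
      obtain b c b' c' where x: "x = (b, c)" "b \<in> B" "c \<in> C"
        and y: "y = (b', c')" "b' \<in> B" "c' \<in> C"
        using xy unfolding Pc by (metis mem_Times_iff surjective_pairing)
      note in_A = e_part(2)[OF x(2)] f_part(2)[OF x(3)] e_part(2)[OF y(2)] f_part(2)[OF y(3)]
      show ?thesis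
        using in_A cross[OF x(2) y(3)] cross[OF y(2) x(3)]
        by (simp add: x(1) y(1) Pm l_distr r_distr)
    qed
    show "?s (x \<oplus>\<^bsub>?P\<^esub> y) = ?s x \<oplus> ?s y" if xy: "x \<in> carrier ?P" "y \<in> carrier ?P" for x y
      using xy e_part(2) f_part(2) by (auto simp: Pc Pm a_ac)
    show "?s \<one>\<^bsub>?P\<^esub> = \<one>"
      unfolding Pm using e(1) a_lcomm[of e \<one> "\<ominus> e"] by (simp add: a_minus_def r_neg)
  qed
  moreover have "bij_betw ?s (carrier ?P) (carrier A)"
  proof (rule bij_betw_byWitness[where f' = "\<lambda>x. (x \<otimes> e, x \<otimes> ?f)"])
    show "\<forall>x\<in>carrier ?P. (?s x \<otimes> e, ?s x \<otimes> ?f) = x"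
      using e_part f_part e f by (auto simp: Pc l_distr)
    show "\<forall>x\<in>carrier A. ?s (x \<otimes> e, x \<otimes> ?f) = x"
    proof
      fix x assume x: "x \<in> carrier A"
      have "x \<otimes> e \<oplus> (x \<ominus> x \<otimes> e) = x"
        using x e(1) a_lcomm[of "x \<otimes> e" x] by (simp add: a_minus_def r_neg)
      then show "?s (x \<otimes> e, x \<otimes> ?f) = x"
        by (simp add: xf[OF x])
    qed
    show "?s ` carrier ?P \<subseteq> carrier A"
      using e_part f_part by (auto simp: Pc)
  qed (auto simp: Pc BC)
  ultimately have "?s \<in> alg_iso ?P A"
    using e_part f_part by (auto simp: alg_iso_def ring_iso_def Pc Pm smult_r_distr)
  then show ?thesis
    using part_alg[OF e central] part_alg[OF f ff fc] assoc_alg_axioms e(1) f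
    by (auto simp: alg_direct_sum_def assoc_algebra_iff) (auto simp: alg_part_def)
qed

end

lemma free_assoc_alg: "assoc_alg (free_algebra X)"
proof -
  interpret ring "free_algebra X" by (rule free_ring)
  show ?thesis
    by unfold_locales
      (auto simp: scal_add_left scal_add_right scal_scal scal_mult_left scal_mult_right)
qed

definition cls :: "'x set \<Rightarrow> (('x, 'k::field) free \<times> ('x, 'k) free) set \<Rightarrow> ('x, 'k) free \<Rightarrow> ('x, 'k) free set"
  where "cls X R p = rel_ideal X R +>\<^bsub>free_algebra X\<^esub> p"

lemma presented_gen_cls: "presented_gen X R x = cls X R (var x)"
  by (simp add: presented_gen_def cls_def)

context
  fixes X :: "'x set" and R :: "(('x, 'k::field) free \<times> ('x, 'k) free) set"
  assumes R: "presented_by X R"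
begin

interpretation F: assoc_alg "free_algebra X :: ('k, ('x, 'k) free) module"
  by (rule free_assoc_alg)

lemma presented_assoc_alg: "assoc_alg (presented X R)"
  unfolding presented_def by (rule F.alg_quot_assoc_alg[OF ideal_rel_ideal[OF R]])

lemma cls_eq_iff:
  "\<lbrakk>p \<in> carrier (free_algebra X); r \<in> carrier (free_algebra X)\<rbrakk> \<Longrightarrow> cls X R p = cls X R r \<longleftrightarrow> cong_rel R p r"
  unfolding cls_def cong_rel_def
  by (subst F.coset_eq_iff[OF ideal_rel_ideal[OF R]]) (simp_all add: rel_ideal_iff[OF R])

lemma presented_simps:
  "carrier (presented X R) = cls X R ` carrier (free_algebra X)"
  "\<one>\<^bsub>presented X R\<^esub> = cls X R 1" "\<zero>\<^bsub>presented X R\<^esub> = cls X R 0"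
  "\<lbrakk>p \<in> carrier (free_algebra X); r \<in> carrier (free_algebra X)\<rbrakk> \<Longrightarrow>
     cls X R p \<otimes>\<^bsub>presented X R\<^esub> cls X R r = cls X R (p * r)"
  "\<lbrakk>p \<in> carrier (free_algebra X); r \<in> carrier (free_algebra X)\<rbrakk> \<Longrightarrow>
     cls X R p \<oplus>\<^bsub>presented X R\<^esub> cls X R r = cls X R (p + r)"
  "p \<in> carrier (free_algebra X) \<Longrightarrow> c \<odot>\<^bsub>presented X R\<^esub> cls X R p = cls X R (c \<star> p)"
  using F.alg_quot_simps[OF ideal_rel_ideal[OF R]] by (simp_all add: presented_def cls_def)

lemma presented_minus:
  assumes "p \<in> carrier (free_algebra X)" "r \<in> carrier (free_algebra X)"
  shows "cls X R p \<ominus>\<^bsub>presented X R\<^esub> cls X R r = cls X R (p - r)"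
proof -
  interpret P: assoc_alg "presented X R" by (rule presented_assoc_alg)
  have "\<ominus>\<^bsub>presented X R\<^esub> cls X R r = cls X R (- r)"
    using assms by (intro P.minus_equality) (auto simp: presented_simps)
  then show ?thesis
    using assms by (simp add: a_minus_def presented_simps)
qed

lemma presented_power:
  "p \<in> carrier (free_algebra X) \<Longrightarrow> cls X R p [^]\<^bsub>presented X R\<^esub> (n::nat) = cls X R (p ^ n)"
  by (induction n) (simp_all add: presented_simps power_commutes)

end

lemma presented_lift:
  fixes g :: "'x \<Rightarrow> ('y, 'k::field) free"
  assumes R: "presented_by X R" and S: "presented_by Y S"
    and g: "\<And>x. x \<in> X \<Longrightarrow> g x \<in> carrier (free_algebra Y)"
    and rel: "\<And>l r. (l, r) \<in> R \<Longrightarrow> cong_rel S (subst g l) (subst g r)"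
  obtains h where "h \<in> alg_map (presented X R) (presented Y S)"
    and "\<And>p. p \<in> carrier (free_algebra X) \<Longrightarrow> h (cls X R p) = cls Y S (subst g p)"
proof -
  interpret F: assoc_alg "free_algebra X :: ('k, ('x, 'k) free) module"
    by (rule free_assoc_alg)
  have gc: "subst g p \<in> carrier (free_algebra Y)" if "p \<in> carrier (free_algebra X)" for p
    using g that by (rule subst_carrier)
  have "(\<lambda>p. cls Y S (subst g p)) \<in> alg_map (free_algebra X) (presented Y S)"
    using gc by (auto simp: alg_map_def presented_simps[OF S])
  moreover have "cls Y S (subst g n) = \<zero>\<^bsub>presented Y S\<^esub>" if n: "n \<in> rel_ideal X R" for n
  proof -
    have nc: "n \<in> carrier (free_algebra X)"
      using ideal.Icarr[OF ideal_rel_ideal[OF R] n] .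
    then have "n \<in> tideal R"
      using rel_ideal_iff[OF R] n by blast
    then have "subst g n \<in> tideal S"
      using rel by (rule subst_tideal[rotated])
    then show ?thesis
      using gc[OF nc] by (simp add: presented_simps[OF S] cls_eq_iff[OF S] cong_0_iff)
  qed
  ultimately show ?thesis
    using F.alg_quot_lift[OF ideal_rel_ideal[OF R] presented_assoc_alg[OF S]] that
    unfolding cls_def presented_def by blast
qed

lemma (in assoc_alg) alg_span_superset: "S \<subseteq> alg_span A S"
  and alg_span_mult: "x \<in> alg_span A S \<Longrightarrow> y \<in> alg_span A S \<Longrightarrow> x \<otimes> y \<in> alg_span A S"
  unfolding alg_span_def by blast+

text \<open>The image of a presented algebra is a subalgebra, so it suffices to compare generators.\<close>

lemma gen_subalgebra_eq_image:
  assumes R: "presented_by X R" and "assoc_alg B" and h: "h \<in> alg_map (presented X R) B"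
    and S: "S \<subseteq> h ` carrier (presented X R)"
    and gens: "\<And>x. x \<in> X \<Longrightarrow> h (presented_gen X R x) \<in> alg_span B (insert (h \<one>\<^bsub>presented X R\<^esub>) S)"
  shows "gen_subalgebra B (h \<one>\<^bsub>presented X R\<^esub>) S =
    sub_alg B (h ` carrier (presented X R)) (h \<one>\<^bsub>presented X R\<^esub>)"
proof -
  let ?P = "presented X R"
  let ?u = "h \<one>\<^bsub>?P\<^esub>"
  interpret h: alg_map_locale ?P B h
    using assms presented_assoc_alg[OF R] by (simp add: alg_map_locale_def alg_map_locale_axioms_def)
  interpret I: assoc_alg "sub_alg B (h ` carrier ?P) ?u"
    by (rule h.image_assoc_alg)
  have sub: "submodule (h ` carrier ?P) scalars B"
  proof -
    have "subgroup (h ` carrier ?P) (add_monoid B)"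
    proof (rule h.B.add.subgroupI)
      fix a assume "a \<in> h ` carrier ?P"
      then show "\<ominus>\<^bsub>B\<^esub> a \<in> h ` carrier ?P"
        by (auto simp: h.hom_minus[symmetric])
    qed (auto simp: h.hom(1) h.hom(2)[symmetric])
    then show ?thesis
      by (auto simp: submodule_def submodule_axioms_def h.hom(4)[symmetric])
  qed
  have "h ` carrier ?P \<subseteq> U"
    if U: "submodule U scalars B" "\<forall>x\<in>U. \<forall>y\<in>U. x \<otimes>\<^bsub>B\<^esub> y \<in> U" "insert ?u S \<subseteq> U" for U
  proof -
    interpret U: submodule U scalars B by (rule U(1))
    have gU: "h (presented_gen X R x) \<in> U" if "x \<in> X" for x
      using gens[OF that] U unfolding alg_span_def by blast
    have "p \<in> carrier (free_algebra X) \<and> h (cls X R p) \<in> U" if "p \<in> carrier (free_algebra X)" for p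
      using that
    proof (induction rule: free_carrier_induct)
      case zero
      have "h (cls X R 0) = \<zero>\<^bsub>B\<^esub>"
        using h.hom_zero by (simp add: presented_simps[OF R])
      then show ?case using U.one_closed by simp
    next
      case one
      then show ?case using U(3) by (simp add: presented_simps[OF R])
    next
      case (var x)
      then show ?case using gU by (simp add: presented_gen_cls)
    next
      case (add p r)
      then show ?case
        using h.hom(2)[of "cls X R p" "cls X R r"] U.m_closed by (simp add: presented_simps[OF R])
    next
      case (mult p r)
      then show ?case
        using h.hom(3)[of "cls X R p" "cls X R r"] U(2) by (simp add: presented_simps[OF R])
    next
      case (scal c p)
      then show ?case
        using h.hom(4)[of "cls X R p" c] U.smult_closed by (simp add: presented_simps[OF R])
    qed
    then show ?thesis
      by (auto simp: presented_simps[OF R])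
  qed
  moreover have "\<forall>x\<in>h ` carrier ?P. \<forall>y\<in>h ` carrier ?P. x \<otimes>\<^bsub>B\<^esub> y \<in> h ` carrier ?P"
    using I.m_closed by simp
  ultimately have "alg_span B (insert ?u S) = h ` carrier ?P"
    unfolding alg_span_def using sub S by (intro equalityI Inter_lower Inter_greatest) auto
  then show ?thesis
    by (simp add: gen_subalgebra_def sub_alg_def)
qed

section \<open>The weak quantum algebra modulo its relations\<close>

lemma coweights_iff: "h \<in> coweights I \<longleftrightarrow> Poly_Mapping.keys h \<subseteq> Hc ` I \<union> Dc ` I"
  by (simp add: coweights_def free_Abelian_group_def)

lemma coweights_closed [simp, intro]:
  "0 \<in> coweights I" "h \<in> coweights I \<Longrightarrow> h' \<in> coweights I \<Longrightarrow> h + h' \<in> coweights I"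
  "h \<in> coweights I \<Longrightarrow> - h \<in> coweights I"
  "h \<in> coweights I \<Longrightarrow> h' \<in> coweights I \<Longrightarrow> h - h' \<in> coweights I"
  "i \<in> I \<Longrightarrow> Poly_Mapping.single (Hc i) c \<in> coweights I"
  "i \<in> I \<Longrightarrow> Poly_Mapping.single (Dc i) c \<in> coweights I"
  using Poly_Mapping.keys_add[of h h'] keys_diff[of h h']
  by (auto simp: coweights_iff)

lemma simple_root_add: "simple_root A i (h + h') = simple_root A i h + simple_root A i h'"
  unfolding simple_root_def
  by (rule sum_keys_add[of "\<lambda>c b. c * (case b of Hc j \<Rightarrow> A j i | Dc j \<Rightarrow> kron i j)"])
    (simp add: distrib_right)

lemma simple_root_0 [simp]: "simple_root A i 0 = 0"
  by (simp add: simple_root_def)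

lemma simple_root_uminus: "simple_root A i (- h) = - simple_root A i h"
  using simple_root_add[of A i h "- h"] by simp

lemma simple_root_diff: "simple_root A i (h - h') = simple_root A i h - simple_root A i h'"
  using simple_root_add[of A i h "- h'"] by (simp add: simple_root_uminus)

lemma simple_root_single [simp]:
  "simple_root A i (Poly_Mapping.single (Hc j) c) = c * A j i"
  "simple_root A i (Poly_Mapping.single (Dc j) c) = c * kron i j"
  by (cases "c = 0"; simp add: simple_root_def)+

locale quantum_datum =
  fixes I :: "nat set" and A :: "nat \<Rightarrow> nat \<Rightarrow> int" and s :: "nat \<Rightarrow> nat" and q :: "'k::field"
    and \<kappa> \<kappa>' :: "nat \<Rightarrow> nat"
  assumes s_pos: "i \<in> I \<Longrightarrow> s i > 0"
    and sym: "\<lbrakk>i \<in> I; j \<in> I\<rbrakk> \<Longrightarrow> int (s i) * A i j = int (s j) * A j i"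
    and q0: "q \<noteq> 0"
    and types: "i \<in> I \<Longrightarrow> \<kappa> i = 0 \<or> \<kappa> i = 1" "i \<in> I \<Longrightarrow> \<kappa>' i = 0 \<or> \<kappa>' i = 1"
    and nonempty: "I \<noteq> {}"
begin

abbreviation WR where "WR m \<equiv> wrels I A s q m \<kappa> \<kappa>'"
abbreviation UR where "UR \<equiv> urels I A s q"
abbreviation FW :: "(nat wgen, 'k) free set" where "FW \<equiv> carrier (free_algebra (wgens I))"
abbreviation FU :: "(nat ugen, 'k) free set" where "FU \<equiv> carrier (free_algebra (ugens I))"

lemma wgens_simps [simp]:
  "J \<in> wgens I" "E i \<in> wgens I \<longleftrightarrow> i \<in> I" "F i \<in> wgens I \<longleftrightarrow> i \<in> I" "K i \<in> wgens I \<longleftrightarrow> i \<in> I"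
  "Kbar i \<in> wgens I \<longleftrightarrow> i \<in> I" "D i \<in> wgens I \<longleftrightarrow> i \<in> I" "Dbar i \<in> wgens I \<longleftrightarrow> i \<in> I"
  by (auto simp: wgens_def wtorus_def)

lemma wtorus_wgens: "x \<in> wtorus I \<Longrightarrow> x \<in> wgens I"
  by (simp add: wgens_def)

lemma ugens_simps [simp]:
  "Ue i \<in> ugens I \<longleftrightarrow> i \<in> I" "Uf i \<in> ugens I \<longleftrightarrow> i \<in> I" "Uq h \<in> ugens I \<longleftrightarrow> h \<in> coweights I"
  by (auto simp: ugens_def)

lemma presented_by_WR: "presented_by (wgens I) (WR m)"
proof -
  have "l \<in> FW \<and> r \<in> FW" if "(l, r) \<in> WR m" for l r
    using that
    by (induction rule: wrels.induct) (auto intro!: free_carrier free_carrier_serre dest: wtorus_wgens)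
  then show ?thesis
    by (auto simp: presented_by_def)
qed

lemma presented_by_UR: "presented_by (ugens I) UR"
proof -
  have "l \<in> FU \<and> r \<in> FU" if "(l, r) \<in> UR" for l r
    using that by (induction rule: urels.induct) (auto intro!: free_carrier free_carrier_serre)
  then show ?thesis
    by (auto simp: presented_by_def)
qed

lemma torus_rel:
  assumes "m \<ge> 2"
  shows "i \<in> I \<Longrightarrow> cong_rel (WR m) (var (K i) * var (Kbar i)) (var J ^ (m - 1))"
    and "i \<in> I \<Longrightarrow> cong_rel (WR m) (var (D i) * var (Dbar i)) (var J ^ (m - 1))"
    and "\<lbrakk>x \<in> insert J (wtorus I); y \<in> insert J (wtorus I)\<rbrakk> \<Longrightarrow> cong_rel (WR m) (var x * var y) (var y * var x)"
    and "x \<in> wtorus I \<Longrightarrow> cong_rel (WR m) (var x * var J ^ (m - 1)) (var x)"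
  subgoal by (rule cong_sym[OF cong_base], rule wrels.intros)
  subgoal by (rule cong_sym[OF cong_base], rule wrels.intros)
  subgoal by (rule cong_base, rule wrels.intros)
  subgoal by (rule cong_base, rule wrels.intros)
  done

lemma J_power_torus: "x \<in> wtorus I \<Longrightarrow> m \<ge> 2 \<Longrightarrow> cong_rel (WR m) (var J ^ (m - 1) * var x) (var x)"
  by (meson cong_commute_power cong_trans insertCI torus_rel(3,4))

text \<open>\<open>2 (m - 1) = (m - 2) + m\<close>, and \<open>J\<^sup>m = J\<close>.\<close>

lemma J_power_idem:
  assumes "m \<ge> 2"
  shows "cong_rel (WR m) (var J ^ (m - 1) * var J ^ (m - 1)) (var J ^ (m - 1))"
proof -
  have "cong_rel (WR m) (var J ^ m) (var J)"
    by (intro cong_base wrels.intros)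
  then have "cong_rel (WR m) (var J ^ (m - 2) * var J ^ m) (var J ^ (m - 2) * var J)"
    by (rule cong_left)
  moreover have "m - 2 + m = (m - 1) + (m - 1)" "Suc (m - 2) = m - 1"
    using assms by auto
  ultimately show ?thesis
    by (simp add: power_add[symmetric] power_Suc2[symmetric] del: power_Suc)
qed

text \<open>For type one, \<open>k\<close> and \<open>k'\<close> contribute inverse scalars when moved past \<open>x\<close>. For type zero,
  \<open>x\<close> is a multiple of \<open>k x k'\<close>, so even \<open>e x = x = x e\<close>.\<close>

lemma idem_commute:
  fixes k :: "('x, 'a::field) free"
  assumes e: "cong_rel R (k * k') e" and ke: "cong_rel R (e * k) k" "cong_rel R (k' * e) k'"
    and c: "c \<noteq> 0"
    and rel: "cong_rel R (k * x) (c \<star> (x * k)) \<and> cong_rel R (k' * x) (inverse c \<star> (x * k')) \<or>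
      cong_rel R (k * x * k') (c \<star> x)"
  shows "cong_rel R (e * x) (x * e)"
  using rel
proof
  assume r: "cong_rel R (k * x) (c \<star> (x * k)) \<and> cong_rel R (k' * x) (inverse c \<star> (x * k'))"
  have "cong_rel R (e * x) (k * k' * x)"
    by (rule cong_right[OF cong_sym[OF e]])
  also have "k * k' * x = k * (k' * x)"
    by (simp add: mult.assoc)
  also have "cong_rel R (k * (k' * x)) (k * (inverse c \<star> (x * k')))"
    by (rule cong_left) (use r in simp)
  also have "k * (inverse c \<star> (x * k')) = inverse c \<star> ((k * x) * k')"
    by (simp add: scal_mult_right mult.assoc)
  also have "cong_rel R (inverse c \<star> ((k * x) * k')) (inverse c \<star> ((c \<star> (x * k)) * k'))"
    by (intro cong_scal cong_right) (use r in simp)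
  also have "inverse c \<star> ((c \<star> (x * k)) * k') = x * (k * k')"
    using c by (simp add: scal_mult_left scal_scal mult.assoc)
  also have "cong_rel R (x * (k * k')) (x * e)"
    by (rule cong_left[OF e])
  finally show ?thesis .
next
  assume r: "cong_rel R (k * x * k') (c \<star> x)"
  have x: "cong_rel R x (inverse c \<star> (k * x * k'))"
    using cong_scal[OF cong_sym[OF r], of "inverse c"] c by (simp add: scal_scal)
  have "cong_rel R (e * x) (e * (inverse c \<star> (k * x * k')))"
    by (rule cong_left[OF x])
  also have "e * (inverse c \<star> (k * x * k')) = inverse c \<star> ((e * k) * (x * k'))"
    by (simp add: scal_mult_right mult.assoc)
  also have "cong_rel R \<dots> (inverse c \<star> (k * (x * k')))"
    by (intro cong_scal cong_right ke)
  also have "inverse c \<star> (k * (x * k')) = inverse c \<star> (k * x * k')"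
    by (simp add: mult.assoc)
  also have "cong_rel R \<dots> x"
    by (rule cong_sym[OF x])
  finally have 1: "cong_rel R (e * x) x" .
  have "cong_rel R (x * e) ((inverse c \<star> (k * x * k')) * e)"
    by (rule cong_right[OF x])
  also have "(inverse c \<star> (k * x * k')) * e = inverse c \<star> (k * x * (k' * e))"
    by (simp add: scal_mult_left mult.assoc)
  also have "cong_rel R \<dots> (inverse c \<star> (k * x * k'))"
    by (intro cong_scal cong_left ke)
  also have "cong_rel R \<dots> x"
    by (rule cong_sym[OF x])
  finally show ?thesis
    using 1 cong_sym cong_trans by blast
qed

lemma qi_nonzero: "i \<in> I \<Longrightarrow> (q ^ s i) powi n \<noteq> 0"
  using q0 by simp

lemma J_power_central:
  assumes m: "m \<ge> 2" and p: "p \<in> FW"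
  shows "cong_rel (WR m) (var J ^ (m - 1) * p) (p * var J ^ (m - 1))"
  using p
proof (induction rule: free_carrier_induct)
  case (var x)
  have EF: "cong_rel (WR m) (var J ^ (m - 1) * var (E i)) (var (E i) * var J ^ (m - 1))"
    "cong_rel (WR m) (var J ^ (m - 1) * var (F i)) (var (F i) * var J ^ (m - 1))" if i: "i \<in> I" for i
  proof -
    have K: "K i \<in> wtorus I" "Kbar i \<in> wtorus I"
      using i by (auto simp: wtorus_def)
    note t = torus_rel(1)[OF m i] J_power_torus[OF K(1) m] torus_rel(4)[OF m K(2)]
    have "cong_rel (WR m) (var (K i) * var (E i)) (((q ^ s i) powi A i i) \<star> (var (E i) * var (K i))) \<and>
        cong_rel (WR m) (var (Kbar i) * var (E i)) (((q ^ s i) powi (- A i i)) \<star> (var (E i) * var (Kbar i))) \<or>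
        cong_rel (WR m) (var (K i) * var (E i) * var (Kbar i)) (((q ^ s i) powi A i i) \<star> var (E i))"
      using types(1)[OF i] i by (auto intro!: cong_base wrels.intros)
    then show "cong_rel (WR m) (var J ^ (m - 1) * var (E i)) (var (E i) * var J ^ (m - 1))"
      by (intro idem_commute[OF t, of "(q ^ s i) powi A i i"] qi_nonzero[OF i])
        (simp only: power_int_minus)
    have "cong_rel (WR m) (var (K i) * var (F i)) (((q ^ s i) powi (- A i i)) \<star> (var (F i) * var (K i))) \<and>
        cong_rel (WR m) (var (Kbar i) * var (F i)) (((q ^ s i) powi A i i) \<star> (var (F i) * var (Kbar i))) \<or>
        cong_rel (WR m) (var (K i) * var (F i) * var (Kbar i)) (((q ^ s i) powi (- A i i)) \<star> var (F i))"
      using types(2)[OF i] i by (auto intro!: cong_base wrels.intros)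
    then show "cong_rel (WR m) (var J ^ (m - 1) * var (F i)) (var (F i) * var J ^ (m - 1))"
      by (intro idem_commute[OF t, of "(q ^ s i) powi (- A i i)"] qi_nonzero[OF i])
        (simp only: power_int_minus inverse_inverse_eq)
  qed
  from var consider "x = J" | "x \<in> wtorus I" | i where "i \<in> I" "x = E i" | i where "i \<in> I" "x = F i"
    by (auto simp: wgens_def)
  then show ?case
  proof cases
    case 1
    then show ?thesis by (simp add: power_commutes)
  next
    case 2
    then show ?thesis
      using J_power_torus[OF 2 m] torus_rel(4)[OF m 2] cong_sym cong_trans by blast
  qed (use EF in auto)
next
  case (add p r)
  then show ?case
    using cong_add[OF add] by (simp add: distrib_left distrib_right)
next
  case (mult p r)
  have "cong_rel (WR m) (var J ^ (m - 1) * p * r) (p * var J ^ (m - 1) * r)"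
    by (rule cong_right[OF mult(1)])
  also have "p * var J ^ (m - 1) * r = p * (var J ^ (m - 1) * r)"
    by (simp add: mult.assoc)
  also have "cong_rel (WR m) (p * (var J ^ (m - 1) * r)) (p * (r * var J ^ (m - 1)))"
    by (rule cong_left[OF mult(2)])
  finally show ?case
    by (simp add: mult.assoc)
next
  case (scal c p)
  then show ?case
    using cong_scal[OF scal, of c] by (simp add: scal_mult_left scal_mult_right)
qed simp_all


section \<open>The homomorphism onto the quantum algebra\<close>

text \<open>The value at \<open>J\<close> matches \<open>phi J = 1\<close>, the \<open>q\<close>-power of \<open>0\<close>; the values at \<open>E\<^sub>i\<close> and \<open>F\<^sub>i\<close> are
  defaults.\<close>

fun torus_weight :: "nat wgen \<Rightarrow> (nat coroot \<Rightarrow>\<^sub>0 int)" where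
  "torus_weight (K i) = Poly_Mapping.single (Hc i) (int (s i))"
| "torus_weight (Kbar i) = - Poly_Mapping.single (Hc i) (int (s i))"
| "torus_weight (D i) = Poly_Mapping.single (Dc i) 1"
| "torus_weight (Dbar i) = - Poly_Mapping.single (Dc i) 1"
| "torus_weight _ = 0"

fun phi :: "nat wgen \<Rightarrow> (nat ugen, 'k) free" where
  "phi (E i) = var (Ue i)"
| "phi (F i) = var (Uf i)"
| "phi J = 1"
| "phi x = var (Uq (torus_weight x))"

lemma torus_weight_coweights: "x \<in> insert J (wtorus I) \<Longrightarrow> torus_weight x \<in> coweights I"
  by (auto simp: wtorus_def)

lemma phi_carrier: "x \<in> wgens I \<Longrightarrow> phi x \<in> FU"
  using torus_weight_coweights by (cases x) auto

lemma Uq_add: "\<lbrakk>h \<in> coweights I; h' \<in> coweights I\<rbrakk> \<Longrightarrow> cong_rel UR (var (Uq h) * var (Uq h')) (var (Uq (h + h')))"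
  by (intro cong_base urels.intros)

lemma Uq_0: "cong_rel UR (var (Uq 0)) 1"
  by (intro cong_base urels.intros)

lemma Uq_inverse: 
  assumes "h \<in> coweights I" 
  shows "cong_rel UR (var (Uq h) * var (Uq (- h))) 1" "cong_rel UR (var (Uq (- h)) * var (Uq h)) 1"
  using Uq_add[OF assms coweights_closed(3)[OF assms]] Uq_add[OF coweights_closed(3)[OF assms] assms]
    Uq_0 cong_trans by auto

lemma Uq_commute: "\<lbrakk>h \<in> coweights I; h' \<in> coweights I\<rbrakk> \<Longrightarrow> cong_rel UR (var (Uq h) * var (Uq h')) (var (Uq h') * var (Uq h))"
  using cong_trans[OF Uq_add[of h h'] cong_sym[OF Uq_add[of h' h, unfolded add.commute[of h' h]]]] by blast

lemma phi_torus: "x \<in> insert J (wtorus I) \<Longrightarrow> cong_rel UR (phi x) (var (Uq (torus_weight x)))"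
  using cong_sym[OF Uq_0] by (cases x) (auto simp: wtorus_def)

lemma Uq_e:
  assumes "h \<in> coweights I" "i \<in> I"
  shows "cong_rel UR (var (Uq h) * var (Ue i)) (q powi simple_root A i h \<star> (var (Ue i) * var (Uq h)))"
    and "cong_rel UR (var (Uq h) * var (Uf i)) (q powi (- simple_root A i h) \<star> (var (Uf i) * var (Uq h)))"
proof -
  have "cong_rel UR (var (Uq h) * var (Ue i) * var (Uq (- h))) (q powi simple_root A i h \<star> var (Ue i))"
    "cong_rel UR (var (Uq h) * var (Uf i) * var (Uq (- h))) (q powi (- simple_root A i h) \<star> var (Uf i))"
    using assms by (auto intro!: cong_base urels.intros)
  from this[THEN cong_move_right[OF _ Uq_inverse(2)[OF assms(1)]]]
  show "cong_rel UR (var (Uq h) * var (Ue i)) (q powi simple_root A i h \<star> (var (Ue i) * var (Uq h)))"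
    "cong_rel UR (var (Uq h) * var (Uf i)) (q powi (- simple_root A i h) \<star> (var (Uf i) * var (Uq h)))"
    by (simp_all add: scal_mult_left)
qed

text \<open>Here symmetrizability enters: \<open>W\<^sub>m\<close> uses \<open>q\<close> to the power \<open>s\<^sub>i a\<^sub>i\<^sub>j\<close>, while \<open>U\<^sub>q\<close> gives
  \<open>\<alpha>\<^sub>i(s\<^sub>j h\<^sub>j) = s\<^sub>j a\<^sub>j\<^sub>i\<close>.\<close>

lemma qi_powi: "\<lbrakk>i \<in> I; j \<in> I\<rbrakk> \<Longrightarrow> (q ^ s i) powi A i j = q powi (int (s j) * A j i)"
  "\<lbrakk>i \<in> I; j \<in> I\<rbrakk> \<Longrightarrow> (q ^ s i) powi (- A i j) = q powi (- (int (s j) * A j i))"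
  by (simp_all add: sym[symmetric] power_int_mult power_int_minus)

lemma phi_rel:
  assumes "(l, r) \<in> WR m"
  shows "cong_rel UR (subst phi l) (subst phi r)"
proof -
  have co: "Poly_Mapping.single (Hc i) (int (s i)) \<in> coweights I" "Poly_Mapping.single (Dc i) 1 \<in> coweights I"
    if "i \<in> I" for i
    using that by auto
  note inv = Uq_inverse[OF co(1)] Uq_inverse[OF co(2)]
  note e = Uq_e[OF co(1)] Uq_e[OF co(2)] Uq_e[OF coweights_closed(3)[OF co(1)]] Uq_e[OF coweights_closed(3)[OF co(2)]]
  have ee: "i \<in> I \<Longrightarrow> h \<in> coweights I \<Longrightarrow> 
      cong_rel UR (var (Uq h) * var (Ue i) * var (Uq (- h))) (q powi simple_root A i h \<star> var (Ue i))"
    "i \<in> I \<Longrightarrow> h \<in> coweights I \<Longrightarrow> 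
      cong_rel UR (var (Uq h) * var (Uf i) * var (Uq (- h))) (q powi (- simple_root A i h) \<star> var (Uf i))" for h i
    by (auto intro!: cong_base urels.intros)
  note ee' = ee[OF _ co(1)] ee[OF _ co(2)]
  have ef: "cong_rel UR (var (Ue i) * var (Uf i) - var (Uf i) * var (Ue i))
      (inverse (q ^ s i - inverse (q ^ s i)) \<star> (var (Uq (Poly_Mapping.single (Hc i) (int (s i)))) -
        var (Uq (- Poly_Mapping.single (Hc i) (int (s i))))))"
    "j \<in> I \<Longrightarrow> i \<noteq> j \<Longrightarrow> cong_rel UR (var (Ue i) * var (Uf j) - var (Uf j) * var (Ue i)) 0"
    if "i \<in> I" for i j
    using urels.intros(5)[where i = i and j = i and I = I and A = A and s = s and q = q] urels.intros(5)[where i = i and j = j and I = I and A = A and s = s and q = q] that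
    by (auto intro: cong_base)
  show ?thesis
    using assms
  proof cases
    case (4 x y)
    have "cong_rel UR (phi x * phi y) (var (Uq (torus_weight x)) * var (Uq (torus_weight y)))"
      "cong_rel UR (phi y * phi x) (var (Uq (torus_weight y)) * var (Uq (torus_weight x)))"
      using 4 by (auto intro!: cong_mult phi_torus simp del: phi.simps torus_weight.simps)
    then show ?thesis
      using Uq_commute[of "torus_weight x" "torus_weight y"] torus_weight_coweights 4
      by simp (meson cong_sym cong_trans)
  next
    case (18 i j)
    then show ?thesis
      by (simp add: ef)
  qed (simp_all add: inv[THEN cong_sym] e[unfolded simple_root_uminus simple_root_single minus_minus mult_1]
      ee'[unfolded simple_root_single mult_1] qi_powi cong_base urels.intros split del: if_split del: One_nat_def)
qed


section \<open>The module of equivariant functions\<close>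

text \<open>The relations of \<open>V = W\<^sub>m / (1 - J)\<close>.\<close>

abbreviation VR where "VR m \<equiv> insert (var J, 1) (WR m)"

lemma VR_WR: "cong_rel (WR m) x y \<Longrightarrow> cong_rel (VR m) x y"
  by (rule cong_mono[rotated]) auto

lemma VR_J: "cong_rel (VR m) (var J) 1"
  by (rule cong_base) simp

lemma VR_J_power: "cong_rel (VR m) (var J ^ n) 1"
proof (induction n)
  case (Suc n)
  show ?case
    using cong_mult[OF VR_J Suc] by simp
qed simp

lemma VR_commute: "\<lbrakk>x \<in> wtorus I; y \<in> wtorus I; m \<ge> 2\<rbrakk> \<Longrightarrow> cong_rel (VR m) (var x * var y) (var y * var x)"
  by (intro VR_WR torus_rel) auto

lemma VR_inverse:
  assumes m: "m \<ge> 2" and i: "i \<in> I"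
  shows "cong_rel (VR m) (var (K i) * var (Kbar i)) 1" "cong_rel (VR m) (var (Kbar i) * var (K i)) 1"
    "cong_rel (VR m) (var (D i) * var (Dbar i)) 1" "cong_rel (VR m) (var (Dbar i) * var (D i)) 1"
proof -
  have t: "K i \<in> wtorus I" "Kbar i \<in> wtorus I" "D i \<in> wtorus I" "Dbar i \<in> wtorus I"
    using i by (auto simp: wtorus_def)
  show 1: "cong_rel (VR m) (var (K i) * var (Kbar i)) 1" "cong_rel (VR m) (var (D i) * var (Dbar i)) 1"
    using torus_rel(1,2)[OF m i] VR_WR VR_J_power cong_trans by blast+
  show "cong_rel (VR m) (var (Kbar i) * var (K i)) 1" "cong_rel (VR m) (var (Dbar i) * var (D i)) 1"
    using 1 t m VR_commute cong_trans by blast+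
qed

definition torus_pos :: "nat wgen set" where
  "torus_pos = (\<Union>i\<in>I. {K i, D i})"

lemma torus_pos_wtorus: "t \<in> torus_pos \<Longrightarrow> t \<in> wtorus I"
  by (auto simp: torus_pos_def wtorus_def)

text \<open>Modulo \<open>1 - J\<close> the torus is invertible, and the two types of generators can no longer be
  told apart.\<close>

lemma VR_torus_EF:
  assumes m: "m \<ge> 2" and t: "t \<in> torus_pos" and i: "i \<in> I"
  shows "cong_rel (VR m) (var t * var (E i)) (q powi simple_root A i (torus_weight t) \<star> (var (E i) * var t))"
    and "cong_rel (VR m) (var t * var (F i)) (q powi (- simple_root A i (torus_weight t)) \<star> (var (F i) * var t))"
proof -
  consider j where "j \<in> I" "t = K j" | j where "j \<in> I" "t = D j"
    using t by (auto simp: torus_pos_def)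
  then have "cong_rel (VR m) (var t * var (E i)) (q powi simple_root A i (torus_weight t) \<star> (var (E i) * var t)) \<and>
    cong_rel (VR m) (var t * var (F i)) (q powi (- simple_root A i (torus_weight t)) \<star> (var (F i) * var t))"
  proof cases
    case (1 j)
    have "cong_rel (VR m) (var (K j) * var (E i)) ((q ^ s i) powi A i j \<star> (var (E i) * var (K j)))"
    proof (cases "\<kappa> i = 1")
      case True
      with i 1 show ?thesis by (intro VR_WR cong_base wrels.intros)
    next
      case False
      then have "\<kappa> i = 0" using types i by auto
      with i 1 have "cong_rel (VR m) (var (K j) * var (E i) * var (Kbar j)) ((q ^ s i) powi A i j \<star> var (E i))"
        by (intro VR_WR cong_base wrels.intros)
      from cong_move_right[OF this VR_inverse(2)[OF m 1(1)]] show ?thesis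
        by (simp add: scal_mult_left)
    qed
    moreover have "cong_rel (VR m) (var (K j) * var (F i)) ((q ^ s i) powi (- A i j) \<star> (var (F i) * var (K j)))"
    proof (cases "\<kappa>' i = 1")
      case True
      with i 1 show ?thesis by (intro VR_WR cong_base wrels.intros)
    next
      case False
      then have "\<kappa>' i = 0" using types i by auto
      with i 1 have "cong_rel (VR m) (var (K j) * var (F i) * var (Kbar j)) ((q ^ s i) powi (- A i j) \<star> var (F i))"
        by (intro VR_WR cong_base wrels.intros)
      from cong_move_right[OF this VR_inverse(2)[OF m 1(1)]] show ?thesis
        by (simp add: scal_mult_left)
    qed
    ultimately show ?thesis
      using 1 i by (simp add: qi_powi)
  next
    case (2 j)
    have "cong_rel (VR m) (var (D j) * var (E i)) (q powi kron i j \<star> (var (E i) * var (D j)))"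
    proof (cases "\<kappa> i = 1")
      case True
      with i 2 show ?thesis by (intro VR_WR cong_base wrels.intros)
    next
      case False
      then have "\<kappa> i = 0" using types i by auto
      with i 2 have "cong_rel (VR m) (var (D j) * var (E i) * var (Dbar j)) (q powi kron i j \<star> var (E i))"
        by (intro VR_WR cong_base wrels.intros)
      from cong_move_right[OF this VR_inverse(4)[OF m 2(1)]] show ?thesis
        by (simp add: scal_mult_left)
    qed
    moreover have "cong_rel (VR m) (var (D j) * var (F i)) (q powi (- kron i j) \<star> (var (F i) * var (D j)))"
    proof (cases "\<kappa>' i = 1")
      case True
      with i 2 show ?thesis by (intro VR_WR cong_base wrels.intros)
    next
      case False
      then have "\<kappa>' i = 0" using types i by auto
      with i 2 have "cong_rel (VR m) (var (D j) * var (F i) * var (Dbar j)) (q powi (- kron i j) \<star> var (F i))"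
        by (intro VR_WR cong_base wrels.intros)
      from cong_move_right[OF this VR_inverse(4)[OF m 2(1)]] show ?thesis
        by (simp add: scal_mult_left)
    qed
    ultimately show ?thesis
      using 2 by simp
  qed
  then show "cong_rel (VR m) (var t * var (E i)) (q powi simple_root A i (torus_weight t) \<star> (var (E i) * var t))"
    "cong_rel (VR m) (var t * var (F i)) (q powi (- simple_root A i (torus_weight t)) \<star> (var (F i) * var t))"
    by auto
qed

type_synonym 'c weight_fun = "(nat coroot \<Rightarrow>\<^sub>0 int) \<Rightarrow> (nat wgen, 'c) free"

definition scale_fun :: "'k \<Rightarrow> 'k weight_fun \<Rightarrow> 'k weight_fun" where
  "scale_fun c \<Phi> = (\<lambda>x. c \<star> \<Phi> x)"

text \<open>The values are representatives of elements of \<open>V\<close>. Letters with index outside \<open>I\<close> act by \<open>0\<close>,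
  so that every letter preserves equivariance.\<close>

fun letter_op :: "nat ugen \<Rightarrow> 'k weight_fun \<Rightarrow> 'k weight_fun" where
  "letter_op (Ue i) \<Phi> = (\<lambda>x. if i \<in> I then q powi (- simple_root A i x) \<star> (var (E i) * \<Phi> x) else 0)"
| "letter_op (Uf i) \<Phi> = (\<lambda>x. if i \<in> I then q powi simple_root A i x \<star> (var (F i) * \<Phi> x) else 0)"
| "letter_op (Uq h) \<Phi> = (\<lambda>x. \<Phi> (x - h))"

sublocale U: free_action scale_fun letter_op
proof
  fix u c and \<Phi> \<Psi> :: "'k weight_fun"
  show "letter_op u (\<Phi> + \<Psi>) = letter_op u \<Phi> + letter_op u \<Psi>"
    by (cases u) (auto simp: fun_eq_iff distrib_left scal_add_right)
  show "letter_op u (scale_fun c \<Phi>) = scale_fun c (letter_op u \<Phi>)"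
    by (cases u) (auto simp: fun_eq_iff scale_fun_def scal_mult_right scal_scal mult.commute)
qed (auto simp: fun_eq_iff scale_fun_def scal_add_right scal_add_left scal_scal)

abbreviation uact :: "(nat ugen, 'k) free \<Rightarrow> 'k weight_fun \<Rightarrow> 'k weight_fun" where
  "uact \<equiv> act scale_fun letter_op"

lemma uact_single_apply: "uact (Poly_Mapping.single w c) \<Phi> x = c \<star> foldr letter_op (letters w) \<Phi> x"
  unfolding U.act_single scale_fun_def ..

lemma uact_scal_apply: "uact (c \<star> p) \<Phi> x = c \<star> uact p \<Phi> x"
  unfolding U.act_scal scale_fun_def ..

text \<open>These are the functions of the module induced from \<open>V\<close>: translation by an element of \<open>P'\<close>
  has to agree with multiplication by the corresponding torus element of \<open>V\<close>. For the inverse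
  generators \<open>Kbar\<^sub>i\<close> and \<open>Dbar\<^sub>i\<close> this follows.\<close>

definition equivariant :: "nat \<Rightarrow> 'k weight_fun \<Rightarrow> bool" where
  "equivariant m \<Phi> \<longleftrightarrow> (\<forall>t\<in>torus_pos. \<forall>x. cong_rel (VR m) (\<Phi> (x - torus_weight t)) (var t * \<Phi> x))"

text \<open>The scalar by which \<open>x \<mapsto> q\<^bsup>-\<alpha>\<^esup>\<close>, \<open>\<alpha> = \<alpha>\<^sub>i(x)\<close>, changes under translation is the one by which
  the torus generator commutes with \<open>E\<^sub>i\<close>.\<close>

lemma equivariant_letter:
  assumes m: "m \<ge> 2" and \<Phi>: "equivariant m \<Phi>"
  shows "equivariant m (letter_op u \<Phi>)"
  unfolding equivariant_def
proof (intro ballI allI)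
  fix t x assume t: "t \<in> torus_pos"
  let ?h = "torus_weight t"
  have eq: "cong_rel (VR m) (\<Phi> (y - ?h)) (var t * \<Phi> y)" for y
    using \<Phi> t by (auto simp: equivariant_def)
  have move: "cong_rel (VR m) (q powi (a + c) \<star> (y * \<Phi> (x - ?h))) (var t * (q powi a \<star> (y * \<Phi> x)))"
    if y: "cong_rel (VR m) (var t * y) (q powi c \<star> (y * var t))" for y a c
  proof -
    have "cong_rel (VR m) (q powi (a + c) \<star> (y * \<Phi> (x - ?h))) (q powi (a + c) \<star> (y * (var t * \<Phi> x)))"
      by (intro cong_scal cong_left eq)
    also have "q powi (a + c) \<star> (y * (var t * \<Phi> x)) = q powi a \<star> ((q powi c \<star> (y * var t)) * \<Phi> x)"
      using q0 by (simp add: power_int_add scal_scal scal_mult_left mult.assoc)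
    also have "cong_rel (VR m) \<dots> (q powi a \<star> ((var t * y) * \<Phi> x))"
      by (intro cong_scal cong_right cong_sym[OF y])
    also have "\<dots> = var t * (q powi a \<star> (y * \<Phi> x))"
      by (simp add: scal_mult_right mult.assoc)
    finally show ?thesis .
  qed
  show "cong_rel (VR m) (letter_op u \<Phi> (x - ?h)) (var t * letter_op u \<Phi> x)"
  proof (cases u)
    case (Ue i)
    show ?thesis
    proof (cases "i \<in> I")
      case True
      from move[OF VR_torus_EF(1)[OF m t True], of "- simple_root A i x"] show ?thesis
        by (simp add: Ue True simple_root_diff)
    qed (simp add: Ue)
  next
    case (Uf i)
    show ?thesis
    proof (cases "i \<in> I")
      case True
      from move[OF VR_torus_EF(2)[OF m t True], of "simple_root A i x"] show ?thesis
        by (simp add: Uf True simple_root_diff)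
    qed (simp add: Uf)
  next
    case (Uq h)
    show ?thesis
      using eq[of "x - h"] by (simp only: Uq letter_op.simps cancel_ab_semigroup_add_class.diff_right_commute[of x ?h h])
  qed
qed

lemma equivariant_act:
  assumes m: "m \<ge> 2" and \<Phi>: "equivariant m \<Phi>"
  shows "equivariant m (uact p \<Phi>)"
proof (induction p rule: poly_mapping_add_induct)
  case zero
  then show ?case by (simp add: equivariant_def)
next
  case (single w c)
  have foldr: "equivariant m (foldr letter_op us \<Phi>)" for us
    by (induction us) (auto simp: \<Phi> intro: equivariant_letter[OF m])
  have "equivariant m (scale_fun c \<Psi>)" if "equivariant m \<Psi>" for \<Psi>
    using that by (auto simp: equivariant_def scale_fun_def scal_mult_right intro: cong_scal)
  with foldr show ?case
    by (simp add: U.act_single)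
next
  case (add p r)
  then show ?case
    by (auto simp: equivariant_def U.act_add distrib_left intro: cong_add)
qed

lemma tideal_scal: "x \<in> tideal R \<Longrightarrow> c \<star> x \<in> tideal R"
  by (simp add: scal_def tideal_mult_left)

lemma act_tideal:
  assumes "\<And>x. \<Phi> x \<in> tideal R"
  shows "uact p \<Phi> x \<in> tideal R"
proof (induction p rule: poly_mapping_add_induct)
  case (single w c)
  have "letter_op u \<Psi> y \<in> tideal R" if "\<And>y. \<Psi> y \<in> tideal R" for u \<Psi> y
    using that by (cases u) (auto intro!: tideal_scal tideal_mult_left tideal.zero)
  then have "foldr letter_op us \<Phi> y \<in> tideal R" for us y
    by (induction us arbitrary: y) (auto simp: assms)
  then show ?case
    by (simp add: uact_single_apply tideal_scal)
qed (simp_all add: tideal.zero U.act_add tideal_add)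

text \<open>The relations between the \<open>e\<^sub>i\<close>, and those between the \<open>f\<^sub>i\<close>, are homogeneous. So at each
  point \<open>x\<close> they act as a common scalar times the corresponding relation of \<open>V\<close>; this notion
  makes the scalar explicit.\<close>

definition twisted :: "((nat coroot \<Rightarrow>\<^sub>0 int) \<Rightarrow> 'k) \<Rightarrow> (nat wgen, 'k) free \<Rightarrow> (nat ugen, 'k) free \<Rightarrow> bool" where
  "twisted c a p \<longleftrightarrow> (\<forall>\<Phi> x. uact p \<Phi> x = c x \<star> (a * \<Phi> x))"

lemma twisted_letter:
  "i \<in> I \<Longrightarrow> twisted (\<lambda>x. q powi (- simple_root A i x)) (var (E i)) (var (Ue i))"
  "i \<in> I \<Longrightarrow> twisted (\<lambda>x. q powi simple_root A i x) (var (F i)) (var (Uf i))"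
  by (simp_all add: twisted_def)

lemma twisted_mult: "twisted c a p \<Longrightarrow> twisted d b r \<Longrightarrow> twisted (\<lambda>x. c x * d x) (a * b) (p * r)"
  by (simp add: twisted_def U.act_mult scal_mult_right scal_scal mult.assoc)

lemma twisted_one: "twisted (\<lambda>x. 1) 1 1"
  by (simp add: twisted_def)

lemma twisted_power: "twisted c a p \<Longrightarrow> twisted (\<lambda>x. c x ^ n) (a ^ n) (p ^ n)"
  by (induction n) (auto intro: twisted_mult twisted_one)

lemma twisted_diff: "twisted c a p \<Longrightarrow> twisted c b r \<Longrightarrow> twisted c (a - b) (p - r)"
  by (simp add: twisted_def U.act_diff left_diff_distrib scal_diff_right)

lemma twisted_scal: "twisted c a p \<Longrightarrow> twisted c (d \<star> a) (d \<star> p)"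
  by (simp add: twisted_def uact_scal_apply scal_scal scal_mult_left mult.commute)

lemma twisted_sum: "(\<And>r. r \<in> T \<Longrightarrow> twisted c (f r) (g r)) \<Longrightarrow> twisted c (\<Sum>r\<in>T. f r) (\<Sum>r\<in>T. g r)"
  by (induction T rule: infinite_finite_induct)
    (auto simp: twisted_def U.act_add distrib_right scal_add_right)

lemma twisted_serre:
  assumes "twisted c a p" "twisted d b r"
  shows "twisted (\<lambda>x. c x ^ nat (1 - n) * d x) (serre z n a b) (serre z n p r)"
  unfolding serre_def Let_def
proof (intro twisted_sum twisted_scal)
  fix k assume "k \<in> {0..nat (1 - n)}"
  then have "nat (1 - n) = (nat (1 - n) - k) + k" by simp
  then have "c x ^ nat (1 - n) = c x ^ (nat (1 - n) - k) * c x ^ k" for x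
    by (metis power_add)
  moreover have "twisted (\<lambda>x. c x ^ (nat (1 - n) - k) * d x * c x ^ k) (a ^ (nat (1 - n) - k) * b * a ^ k)
    (p ^ (nat (1 - n) - k) * r * p ^ k)"
    by (intro twisted_mult twisted_power assms)
  ultimately show "twisted (\<lambda>x. c x ^ nat (1 - n) * d x) (a ^ (nat (1 - n) - k) * b * a ^ k)
    (p ^ (nat (1 - n) - k) * r * p ^ k)"
    by (simp add: mult_ac)
qed

lemma twisted_cong_0:
  assumes "twisted c a p" "(a, 0) \<in> VR m"
  shows "cong_rel (VR m) (uact p \<Phi> x) 0"
proof -
  have "a \<in> tideal (VR m)"
    using cong_base[OF assms(2)] by (simp add: cong_0_iff)
  then show ?thesis
    using assms(1) by (simp add: twisted_def cong_0_iff tideal_scal tideal_mult_left tideal_mult_right)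
qed

text \<open>The first four relations hold on all functions. The commutator of \<open>e\<^sub>i\<close> and \<open>f\<^sub>i\<close> has weight zero and
  acts as \<open>K\<^sub>i - Kbar\<^sub>i\<close> up to a constant; equivariance turns this into the difference of the two
  translations.\<close>

lemma act_relation:
  assumes m: "m \<ge> 2" and \<Phi>: "equivariant m \<Phi>" and rel: "(l, r) \<in> UR"
  shows "cong_rel (VR m) (uact l \<Phi> x) (uact r \<Phi> x)"
  using rel
proof cases
  case 1
  then show ?thesis by simp
next
  case (2 h h')
  then show ?thesis by (simp add: U.act_mult algebra_simps)
next
  case (3 h i)
  then show ?thesis
    using q0 by (simp add: U.act_mult uact_scal_apply scal_scal simple_root_diff
      power_int_add[symmetric])
next
  case (4 h i)
  then show ?thesis
    using q0 by (simp add: U.act_mult uact_scal_apply scal_scal simple_root_diff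
      power_int_add[symmetric])
next
  case (5 i j)
  have "twisted (\<lambda>x. q powi (- simple_root A i x) * q powi simple_root A j x)
      (var (E i) * var (F j)) (var (Ue i) * var (Uf j))"
    by (intro twisted_mult twisted_letter 5)
  moreover have "twisted (\<lambda>x. q powi simple_root A j x * q powi (- simple_root A i x))
      (var (F j) * var (E i)) (var (Uf j) * var (Ue i))"
    by (intro twisted_mult twisted_letter 5)
  ultimately have tw: "twisted (\<lambda>x. q powi (- simple_root A i x) * q powi simple_root A j x)
      (var (E i) * var (F j) - var (F j) * var (E i)) (var (Ue i) * var (Uf j) - var (Uf j) * var (Ue i))"
    by (intro twisted_diff) (simp_all add: mult.commute)
  note EF = wrels.intros(18)[where i = i and j = j and I = I and A = A and s = s and q = q and m = m
      and \<kappa> = \<kappa> and \<kappa>' = \<kappa>', OF 5(3,4)]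
  show ?thesis
  proof (cases "i = j")
    case False
    then show ?thesis
      using twisted_cong_0[OF tw] EF 5 by simp
  next
    case True
    let ?c = "inverse (q ^ s i - inverse (q ^ s i))" and ?h = "Poly_Mapping.single (Hc i) (int (s i))"
    have K: "cong_rel (VR m) (\<Phi> (y - ?h)) (var (K i) * \<Phi> y)" for y
      using \<Phi> 5 by (auto simp: equivariant_def torus_pos_def)
    have Kb: "cong_rel (VR m) (var (Kbar i) * \<Phi> x) (\<Phi> (x + ?h))"
      using cong_inverse_unique[OF VR_inverse(2)[OF m 5(3)], of "\<Phi> x" "\<Phi> (x + ?h)"] K[of "x + ?h"] by simp
    have "uact l \<Phi> x = (var (E i) * var (F i) - var (F i) * var (E i)) * \<Phi> x"
      using tw q0 by (simp add: twisted_def 5 True power_int_minus)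
    also have "cong_rel (VR m) \<dots> ((?c \<star> (var (K i) - var (Kbar i))) * \<Phi> x)"
      by (rule cong_right, rule cong_base) (use EF True in simp)
    also have "\<dots> = ?c \<star> (var (K i) * \<Phi> x - var (Kbar i) * \<Phi> x)"
      by (simp add: scal_mult_left left_diff_distrib)
    also have "cong_rel (VR m) \<dots> (?c \<star> (\<Phi> (x - ?h) - \<Phi> (x + ?h)))"
      by (intro cong_scal cong_diff Kb cong_sym[OF K])
    also have "\<dots> = uact r \<Phi> x"
      by (simp add: 5 True U.act_scal U.act_diff scale_fun_def)
    finally show ?thesis .
  qed
next
  case (6 i j)
  with twisted_cong_0[OF twisted_serre[OF twisted_letter(1) twisted_letter(1)], of i j] show ?thesis
    by (simp add: wrels.intros)
next
  case (7 i j)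
  with twisted_cong_0[OF twisted_serre[OF twisted_letter(2) twisted_letter(2)], of i j] show ?thesis
    by (simp add: wrels.intros)
next
  case (8 i j)
  have "twisted (\<lambda>x. q powi (- simple_root A i x) * q powi (- simple_root A j x))
      (var (E i) * var (E j) - var (E j) * var (E i)) (var (Ue i) * var (Ue j) - var (Ue j) * var (Ue i))"
    using twisted_mult[OF twisted_letter(1)[of i] twisted_letter(1)[of j]]
      twisted_mult[OF twisted_letter(1)[of j] twisted_letter(1)[of i]] 8
    by (intro twisted_diff) (simp_all add: mult.commute)
  from twisted_cong_0[OF this] 8 show ?thesis
    by (simp add: wrels.intros)
next
  case (9 i j)
  have "twisted (\<lambda>x. q powi simple_root A i x * q powi simple_root A j x)
      (var (F i) * var (F j) - var (F j) * var (F i)) (var (Uf i) * var (Uf j) - var (Uf j) * var (Uf i))"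
    using twisted_mult[OF twisted_letter(2)[of i] twisted_letter(2)[of j]]
      twisted_mult[OF twisted_letter(2)[of j] twisted_letter(2)[of i]] 9
    by (intro twisted_diff) (simp_all add: mult.commute)
  from twisted_cong_0[OF this] 9 show ?thesis
    by (simp add: wrels.intros)
qed

lemma act_tideal_UR:
  assumes m: "m \<ge> 2" and \<Phi>: "equivariant m \<Phi>" and "p \<in> tideal UR"
  shows "uact p \<Phi> x \<in> tideal (VR m)"
  using assms(3)
proof (induction)
  case (step l r p u v)
  have "uact (l - r) (uact v \<Phi>) y \<in> tideal (VR m)" for y
    using act_relation[OF m equivariant_act[OF m \<Phi>] step(1)] by (simp add: cong_rel_def U.act_diff)
  then have "uact u (uact (l - r) (uact v \<Phi>)) x \<in> tideal (VR m)"
    by (rule act_tideal)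
  with step show ?case
    by (simp add: U.act_add U.act_mult tideal_add)
qed (simp add: tideal.zero)

text \<open>At the origin the twists \<open>q\<close> to the power \<open>\<alpha>\<^sub>i(0)\<close> are one, and translations become torus
  elements by equivariance.\<close>

lemma act_phi:
  assumes m: "m \<ge> 2" and "p \<in> FW" and "equivariant m \<Phi>"
  shows "cong_rel (VR m) (uact (subst phi p) \<Phi> 0) (p * \<Phi> 0)"
  using assms(2,3)
proof (induction arbitrary: \<Phi> rule: free_carrier_induct)
  case (var x)
  have inv: "cong_rel (VR m) (\<Phi> h) (var y * \<Phi> 0)"
    if "t \<in> torus_pos" "torus_weight t = h" "cong_rel (VR m) (var y * var t) 1" for t y h
  proof -
    have "cong_rel (VR m) (\<Phi> 0) (var t * \<Phi> h)"
      using var that by (force simp: equivariant_def dest: spec[of _ h])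
    from cong_inverse_unique[OF that(3) this] show ?thesis
      by (rule cong_sym)
  qed
  have pos: "cong_rel (VR m) (\<Phi> (- torus_weight t)) (var t * \<Phi> 0)" if "t \<in> torus_pos" for t
    using var that by (force simp: equivariant_def dest: spec[of _ 0])
  have t: "K i \<in> torus_pos" "D i \<in> torus_pos" if "i \<in> I" for i
    using that by (auto simp: torus_pos_def)
  have "cong_rel (VR m) (\<Phi> (torus_weight (K i))) (var (Kbar i) * \<Phi> 0)"
    "cong_rel (VR m) (\<Phi> (torus_weight (D i))) (var (Dbar i) * \<Phi> 0)" if i: "i \<in> I" for i
    using inv[OF t(1)[OF i] refl VR_inverse(2)[OF m i]] inv[OF t(2)[OF i] refl VR_inverse(4)[OF m i]] .
  then show ?case
    using var(1) pos[OF t(1)] pos[OF t(2)] cong_sym[OF cong_right[OF VR_J[of m], of "\<Phi> 0"]]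
    by (cases x) simp_all
next
  case (mult p r)
  have "cong_rel (VR m) (uact (subst phi p) (uact (subst phi r) \<Phi>) 0) (p * uact (subst phi r) \<Phi> 0)"
    by (rule mult(1)[OF equivariant_act[OF m mult(3)]])
  also have "cong_rel (VR m) (p * uact (subst phi r) \<Phi> 0) (p * (r * \<Phi> 0))"
    by (rule cong_left[OF mult(2)[OF mult(3)]])
  finally show ?case
    by (simp add: U.act_mult mult.assoc)
next
  case (add p r)
  then show ?case
    using cong_add[OF add(1,2)[OF add(3)]] by (simp add: U.act_add distrib_right)
next
  case (scal c p)
  then show ?case
    using cong_scal[OF scal(1)[OF scal(2)], of c] by (simp add: uact_scal_apply scal_mult_left)
qed simp_all

end

section \<open>An equivariant function with value one at the origin\<close>

text \<open>The power with integer exponent, if \<open>v\<close> represents the inverse of \<open>u\<close>.\<close>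

definition int_pow :: "'r::ring_1 \<Rightarrow> 'r \<Rightarrow> int \<Rightarrow> 'r" where
  "int_pow u v k = (if k \<ge> 0 then u ^ nat k else v ^ nat (- k))"

lemma int_pow_0 [simp]: "int_pow u v 0 = 1"
  by (simp add: int_pow_def)

lemma int_pow_Suc:
  assumes "cong_rel R (u * v) 1"
  shows "cong_rel R (int_pow u v (k + 1)) (u * int_pow u v k)"
proof (cases "k \<ge> 0")
  case True
  then have "nat (k + 1) = Suc (nat k)" by simp
  with True show ?thesis by (simp add: int_pow_def)
next
  case False
  define n where "n = nat (- (k + 1))"
  have k: "nat (- k) = Suc n"
    using False by (simp add: n_def)
  have "cong_rel R (1 * v ^ n) (u * v * v ^ n)"
    by (rule cong_right[OF cong_sym[OF assms]])
  moreover have "int_pow u v (k + 1) = v ^ n"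
    using False by (cases "k = -1") (auto simp: int_pow_def n_def)
  ultimately show ?thesis
    using False k by (simp add: int_pow_def mult.assoc)
qed

lemma cong_commute_mult:
  assumes "cong_rel R (t * a) (a * t)" "cong_rel R (t * b) (b * t)"
  shows "cong_rel R (t * (a * b)) (a * b * t)"
proof -
  have "cong_rel R (t * a * b) (a * t * b)"
    by (rule cong_right[OF assms(1)])
  also have "a * t * b = a * (t * b)"
    by (simp add: mult.assoc)
  also have "cong_rel R \<dots> (a * (b * t))"
    by (rule cong_left[OF assms(2)])
  finally show ?thesis by (simp add: mult.assoc)
qed

lemma cong_commute_int_pow:
  assumes "cong_rel R (t * u) (u * t)" "cong_rel R (t * v) (v * t)"
  shows "cong_rel R (t * int_pow u v k) (int_pow u v k * t)"
  using assms[THEN cong_sym, THEN cong_commute_power, THEN cong_sym] by (simp add: int_pow_def)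

text \<open>The torus generators commute only modulo the relations, so the products in \<open>V\<close> are written in
  the order of the indices; a new factor \<open>t\<close> at position \<open>i\<close> has to be moved to the front.\<close>

lemma cong_ordered_prod:
  fixes a b :: "nat \<Rightarrow> 'r::ring_1"
  assumes comm: "\<And>j. cong_rel R (t * b j) (b j * t)"
    and same: "\<And>j. j \<noteq> i \<Longrightarrow> a j = b j" and change: "cong_rel R (a i) (t * b i)"
  shows "cong_rel R (prod_list (map a [0..<n]))
    (if i < n then t * prod_list (map b [0..<n]) else prod_list (map b [0..<n]))"
proof (induction n)
  case (Suc n)
  let ?P = "\<lambda>f. prod_list (map f [0..<n])"
  have comm_P: "cong_rel R (t * prod_list (map b [0..<k])) (prod_list (map b [0..<k]) * t)" for k
    by (induction k) (simp_all add: cong_commute_mult comm)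
  consider "n = i" | "n \<noteq> i" by blast
  then show ?case
  proof cases
    case 1
    have "cong_rel R (?P a * a n) (?P b * (t * b n))"
      using Suc change 1 by (intro cong_mult) simp_all
    also have "?P b * (t * b n) = (?P b * t) * b n"
      by (simp add: mult.assoc)
    also have "cong_rel R \<dots> ((t * ?P b) * b n)"
      by (rule cong_right[OF cong_sym[OF comm_P]])
    finally show ?thesis
      using 1 by (simp add: mult.assoc)
  next
    case 2
    then show ?thesis
      using cong_right[OF Suc, of "b n"] same[of n] by (cases "i < n") (simp_all add: mult.assoc)
  qed
qed simp

context quantum_datum
begin

text \<open>For \<open>x\<close> in \<open>P'\<close>, the component at \<open>i\<close> of the torus element of \<open>V\<close> with weight \<open>- x\<close>. The sign comes from the
  translation by \<open>x - h\<close> in the definition of equivariance.\<close>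

definition torus_factor :: "(nat coroot \<Rightarrow>\<^sub>0 int) \<Rightarrow> nat \<Rightarrow> (nat wgen, 'k) free" where
  "torus_factor x i = (if i \<in> I then
     int_pow (var (K i)) (var (Kbar i)) (- (Poly_Mapping.lookup x (Hc i) div int (s i))) *
     int_pow (var (D i)) (var (Dbar i)) (- Poly_Mapping.lookup x (Dc i)) else 1)"

definition torus_monomial :: "(nat coroot \<Rightarrow>\<^sub>0 int) \<Rightarrow> nat \<Rightarrow> (nat wgen, 'k) free" where
  "torus_monomial x n = prod_list (map (torus_factor x) [0..<n])"

definition supported_below :: "(nat coroot \<Rightarrow>\<^sub>0 int) \<Rightarrow> nat \<Rightarrow> bool" where
  "supported_below x n \<longleftrightarrow> (\<forall>i\<ge>n. Poly_Mapping.lookup x (Hc i) = 0 \<and> Poly_Mapping.lookup x (Dc i) = 0)"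

lemma supported_below_exists: "\<exists>n. supported_below x n"
proof -
  have "finite ((\<lambda>b. case b of Hc i \<Rightarrow> i | Dc i \<Rightarrow> i) ` Poly_Mapping.keys x)" (is "finite ?T")
    by simp
  then obtain n where n: "\<forall>i\<in>?T. i < n"
    by (meson finite_nat_set_iff_bounded)
  have "supported_below x n"
    unfolding supported_below_def
  proof (intro allI impI conjI; rule ccontr)
    fix i assume "i \<ge> n"
    then have "i \<notin> ?T" using n by fastforce
    then show "Poly_Mapping.lookup x (Hc i) \<noteq> 0 \<Longrightarrow> False" "Poly_Mapping.lookup x (Dc i) \<noteq> 0 \<Longrightarrow> False"
      by (force simp: in_keys_iff[symmetric])+
  qed
  then show ?thesis ..
qed

lemma torus_monomial_eq:
  assumes "supported_below x k" "supported_below x n"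
  shows "torus_monomial x k = torus_monomial x n"
proof -
  have "torus_monomial x n = torus_monomial x k" if "k \<le> n" "supported_below x k" for k n
    using that(1)
  proof (induction n rule: dec_induct)
    case (step n)
    then show ?case
      using that(2) by (simp add: torus_monomial_def torus_factor_def supported_below_def)
  qed simp
  then show ?thesis
    using assms by (metis nat_le_linear)
qed

text \<open>The product over all indices is cut off at any bound for the support, since the later factors
  are one.\<close>

definition torus_section :: "(nat coroot \<Rightarrow>\<^sub>0 int) \<Rightarrow> (nat wgen, 'k) free" where
  "torus_section x =
     (if x \<in> coweights' I s then torus_monomial x (SOME n. supported_below x n) else 0)"

lemma torus_section_eq:
  assumes "x \<in> coweights' I s" "supported_below x n"
  shows "torus_section x = torus_monomial x n"
  using assms torus_monomial_eq[OF someI[of "supported_below x", OF assms(2)] assms(2)]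
  by (simp only: torus_section_def if_True)

lemma torus_section_0: "torus_section 0 = 1"
proof -
  have "supported_below 0 0" "0 \<in> coweights' I s"
    by (simp_all add: supported_below_def coweights'_def)
  then show ?thesis
    using torus_section_eq[of 0 0] by (simp add: torus_monomial_def)
qed

lemma torus_pos_coweights':
  assumes "t \<in> torus_pos"
  shows "x - torus_weight t \<in> coweights' I s \<longleftrightarrow> x \<in> coweights' I s"
proof -
  have t: "torus_weight t \<in> coweights I" "int (s j) dvd Poly_Mapping.lookup (torus_weight t) (Hc j)" for j
    using assms by (auto simp: torus_pos_def lookup_single when_def)
  have "x - torus_weight t \<in> coweights I \<longleftrightarrow> x \<in> coweights I"
    using t(1) coweights_closed(2)[of "x - torus_weight t" I "torus_weight t"] by auto
  moreover have "int (s j) dvd Poly_Mapping.lookup (x - torus_weight t) (Hc j) \<longleftrightarrow>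
      int (s j) dvd Poly_Mapping.lookup x (Hc j)" for j
    using t(2)[of j] by (simp add: lookup_minus dvd_diff_left_iff)
  ultimately show ?thesis
    by (simp add: coweights'_def)
qed

lemma torus_section_equivariant:
  assumes m: "m \<ge> 2"
  shows "equivariant m torus_section"
  unfolding equivariant_def
proof (intro ballI allI)
  fix t x assume t: "t \<in> torus_pos"
  let ?y = "x - torus_weight t"
  show "cong_rel (VR m) (torus_section ?y) (var t * torus_section x)"
  proof (cases "x \<in> coweights' I s")
    case False
    then show ?thesis
      by (simp add: torus_section_def torus_pos_coweights'[OF t])
  next
    case True
    obtain k k' where k: "supported_below x k" "supported_below ?y k'"
      using supported_below_exists by blast
    obtain i where i: "i \<in> I" "t = K i \<or> t = D i"
      using t by (auto simp: torus_pos_def)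
    define n where "n = max (max k k') (Suc i)"
    have n: "supported_below x n" "supported_below ?y n" "i < n"
      using k by (auto simp: supported_below_def n_def)
    have W: "K j \<in> wtorus I" "Kbar j \<in> wtorus I" "D j \<in> wtorus I" "Dbar j \<in> wtorus I" if "j \<in> I" for j
      using that by (auto simp: wtorus_def)
    note comm = VR_commute[OF _ _ m]
    have "cong_rel (VR m) (var t * torus_factor x j) (torus_factor x j * var t)" for j
      using torus_pos_wtorus[OF t] W
      by (auto simp: torus_factor_def intro!: cong_commute_mult cong_commute_int_pow comm)
    moreover have "torus_factor ?y j = torus_factor x j" if "j \<noteq> i" for j
      using i that by (auto simp: torus_factor_def lookup_minus lookup_single when_def)
    moreover have "cong_rel (VR m) (torus_factor ?y i) (var t * torus_factor x i)"
      using i(2)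
    proof
      assume tK: "t = K i"
      let ?k = "- (Poly_Mapping.lookup x (Hc i) div int (s i))"
      have "(a - int (s i)) div int (s i) = a div int (s i) - 1" for a
        using s_pos[OF i(1)] div_mult_self2[of "int (s i)" a "- 1"] by simp
      then have "- (Poly_Mapping.lookup ?y (Hc i) div int (s i)) = ?k + 1"
        by (simp add: tK lookup_minus)
      moreover have "Poly_Mapping.lookup ?y (Dc i) = Poly_Mapping.lookup x (Dc i)"
        by (simp add: tK lookup_minus lookup_single)
      ultimately show ?thesis
        using cong_right[OF int_pow_Suc[OF VR_inverse(1)[OF m i(1)], of ?k],
            of "int_pow (var (D i)) (var (Dbar i)) (- Poly_Mapping.lookup x (Dc i))"] i(1)
        by (simp add: torus_factor_def tK mult.assoc)
    next
      assume tD: "t = D i"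
      let ?k = "- Poly_Mapping.lookup x (Dc i)"
        and ?P = "int_pow (var (K i)) (var (Kbar i)) (- (Poly_Mapping.lookup x (Hc i) div int (s i)))"
      have y: "- Poly_Mapping.lookup ?y (Dc i) = ?k + 1"
        "Poly_Mapping.lookup ?y (Hc i) = Poly_Mapping.lookup x (Hc i)"
        by (simp_all add: tD lookup_minus lookup_single)
      have "cong_rel (VR m) (?P * int_pow (var (D i)) (var (Dbar i)) (?k + 1))
          (?P * (var (D i) * int_pow (var (D i)) (var (Dbar i)) ?k))"
        by (rule cong_left[OF int_pow_Suc[OF VR_inverse(3)[OF m i(1)]]])
      also have "\<dots> = (?P * var (D i)) * int_pow (var (D i)) (var (Dbar i)) ?k"
        by (simp add: mult.assoc)
      also have "cong_rel (VR m) \<dots> ((var (D i) * ?P) * int_pow (var (D i)) (var (Dbar i)) ?k)"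
        using W[OF i(1)] by (intro cong_right cong_sym[OF cong_commute_int_pow] comm)
      finally show ?thesis
        using i(1) unfolding torus_factor_def y unfolding tD by (simp add: mult.assoc)
    qed
    ultimately have "cong_rel (VR m) (torus_monomial ?y n) (var t * torus_monomial x n)"
      using cong_ordered_prod[of "VR m" "var t" "torus_factor x" i "torus_factor ?y" n] n(3)
      by (simp add: torus_monomial_def)
    then show ?thesis
      using True n torus_section_eq torus_pos_coweights'[OF t] by simp
  qed
qed

text \<open>Apply \<open>phi p\<close> to the function just constructed: its value at the origin is, in \<open>V\<close>, both \<open>p\<close>
  and \<open>0\<close>.\<close>

lemma phi_kernel:
  assumes m: "m \<ge> 2" and p: "p \<in> FW" and "subst phi p \<in> tideal UR"
  shows "p \<in> tideal (VR m)"
proof -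
  note eqv = torus_section_equivariant[OF m]
  have "uact (subst phi p) torus_section 0 \<in> tideal (VR m)"
    by (rule act_tideal_UR[OF m eqv assms(3)])
  moreover have "cong_rel (VR m) (uact (subst phi p) torus_section 0) p"
    using act_phi[OF m p eqv] by (simp add: torus_section_0)
  ultimately show ?thesis
    using cong_in_tideal by blast
qed


section \<open>The image of the torus\<close>

definition in_phi_image :: "(nat coroot \<Rightarrow>\<^sub>0 int) \<Rightarrow> bool" where
  "in_phi_image h \<longleftrightarrow> h \<in> coweights I \<and> (\<exists>p\<in>FW. cong_rel UR (subst phi p) (var (Uq h)))"

lemma in_phi_image_0: "in_phi_image 0"
  unfolding in_phi_image_def using cong_sym[OF Uq_0] by (intro conjI bexI[of _ 1]) auto

lemma in_phi_image_add:
  assumes "in_phi_image h" "in_phi_image h'"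
  shows "in_phi_image (h + h')"
proof -
  from assms obtain p r where "p \<in> FW" "r \<in> FW" "h \<in> coweights I" "h' \<in> coweights I"
    and "cong_rel UR (subst phi p) (var (Uq h))" "cong_rel UR (subst phi r) (var (Uq h'))"
    by (auto simp: in_phi_image_def)
  then have "cong_rel UR (subst phi (p * r)) (var (Uq (h + h')))"
    using cong_trans[OF cong_mult Uq_add] by simp
  with \<open>p \<in> FW\<close> \<open>r \<in> FW\<close> \<open>h \<in> coweights I\<close> \<open>h' \<in> coweights I\<close> show ?thesis
    by (auto simp: in_phi_image_def intro!: bexI[of _ "p * r"])
qed

lemma in_phi_image_torus: "t \<in> wtorus I \<Longrightarrow> in_phi_image (torus_weight t)"
  unfolding in_phi_image_def using torus_weight_coweights[of t] phi_torus[of t] wtorus_wgens[of t]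
  by (auto intro!: bexI[of _ "var t"])

lemma in_phi_image_multiple:
  assumes "in_phi_image (Poly_Mapping.single b c)" "in_phi_image (- Poly_Mapping.single b c)"
  shows "in_phi_image (Poly_Mapping.single b (c * k))"
proof -
  have nat: "in_phi_image (Poly_Mapping.single b (d * int n))"
    if "in_phi_image (Poly_Mapping.single b d)" for d n
  proof (induction n)
    case (Suc n)
    then show ?case
      using in_phi_image_add[OF that Suc] by (simp add: single_add[symmetric] distrib_left)
  qed (simp add: in_phi_image_0)
  show ?thesis
  proof (cases "k \<ge> 0")
    case True
    then show ?thesis using nat[OF assms(1), of "nat k"] by simp
  next
    case False
    then show ?thesis using nat[of "- c" "nat (- k)"] assms(2) by (simp add: single_uminus)
  qed
qed

lemma in_phi_image_coweights':
  assumes h: "h \<in> coweights' I s"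
  shows "in_phi_image h"
proof -
  have single: "in_phi_image (Poly_Mapping.single b (Poly_Mapping.lookup h b))"
    if "b \<in> Poly_Mapping.keys h" for b
  proof -
    from that h consider i where "i \<in> I" "b = Hc i" | i where "i \<in> I" "b = Dc i"
      by (auto simp: coweights'_def coweights_iff)
    then show ?thesis
    proof cases
      case (1 i)
      then obtain k where "Poly_Mapping.lookup h b = int (s i) * k"
        using h by (auto simp: coweights'_def)
      then show ?thesis
        using in_phi_image_multiple[of b "int (s i)" k] in_phi_image_torus[of "K i"] in_phi_image_torus[of "Kbar i"] 1
        by (auto simp: wtorus_def)
    next
      case (2 i)
      then show ?thesis
        using in_phi_image_multiple[of b 1] in_phi_image_torus[of "D i"] in_phi_image_torus[of "Dbar i"]
        by (auto simp: wtorus_def)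
    qed
  qed
  have "in_phi_image (\<Sum>b\<in>T. Poly_Mapping.single b (Poly_Mapping.lookup h b))"
    if "T \<subseteq> Poly_Mapping.keys h" for T
    using finite_subset[OF that finite_keys] that
    by (induction T rule: finite_induct) (auto intro: in_phi_image_0 in_phi_image_add single)
  from this[of "Poly_Mapping.keys h"]
  have "in_phi_image (\<Sum>b\<in>Poly_Mapping.keys h. Poly_Mapping.single b (Poly_Mapping.lookup h b))"
    by simp
  moreover have "(\<Sum>b\<in>Poly_Mapping.keys h. Poly_Mapping.single b (Poly_Mapping.lookup h b)) = h"
    by (intro poly_mapping_eqI)
      (simp add: lookup_sum lookup_single when_def in_keys_iff)
  ultimately show ?thesis by simp
qed


section \<open>Comparison with the case \<open>m = 2\<close>\<close>

text \<open>The substitution for the homomorphism from the case \<open>m = 2\<close> to the general one: \<open>J\<close> must go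
  to an idempotent, and \<open>K\<^sub>i Kbar\<^sub>i\<close> forces which one.\<close>

definition theta :: "nat \<Rightarrow> nat wgen \<Rightarrow> (nat wgen, 'k) free" where
  "theta m x = (if x = J then var J ^ (m - 1) else var x)"

lemma theta_simps [simp]:
  "theta m J = var J ^ (m - 1)" "theta m (E i) = var (E i)" "theta m (F i) = var (F i)"
  "theta m (K i) = var (K i)" "theta m (Kbar i) = var (Kbar i)" "theta m (D i) = var (D i)"
  "theta m (Dbar i) = var (Dbar i)"
  by (simp_all add: theta_def)

lemma theta_torus: "x \<in> wtorus I \<Longrightarrow> theta m x = var x"
  by (auto simp: wtorus_def)

lemma theta_carrier: "x \<in> wgens I \<Longrightarrow> theta m x \<in> FW"
  by (auto simp: theta_def)

lemma theta_rel:
  assumes m: "m \<ge> 2" and "(l, r) \<in> WR 2"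
  shows "cong_rel (WR m) (subst (theta m) l) (subst (theta m) r)"
  using assms(2)
proof cases
  case (1 i)
  then show ?thesis
    using cong_sym[OF torus_rel(1)[OF m]] by simp
next
  case (2 i)
  then show ?thesis
    using cong_sym[OF torus_rel(2)[OF m]] by simp
next
  case 3
  then show ?thesis
    using J_power_idem[OF m] by (simp add: power2_eq_square)
next
  case (4 x y)
  have J: "cong_rel (WR m) (var J ^ (m - 1) * var z) (var z * var J ^ (m - 1))"
    if "z \<in> insert J (wtorus I)" for z
    using torus_rel(3)[OF m _ that] by (intro cong_commute_power) simp
  consider "x = J" "y = J" | "x = J" "y \<in> wtorus I" | "x \<in> wtorus I" "y = J" | "x \<in> wtorus I" "y \<in> wtorus I"
    using 4 by auto
  then show ?thesis
    using 4 J torus_rel(3)[OF m, of x y] cong_sym[OF J] by cases (simp_all add: theta_torus)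
next
  case (5 x)
  then show ?thesis
    using torus_rel(4)[OF m] by (simp add: theta_torus)
next
  case (18 i j)
  have "(l, r) \<in> WR m"
    unfolding 18(1,2) by (rule wrels.intros) (rule 18)+
  moreover have "subst (theta m) l = l" "subst (theta m) r = r"
    using 18 by auto
  ultimately show ?thesis
    by (simp add: cong_base)
qed (simp_all add: cong_base wrels.intros split del: if_split)

lemma J_power_2: "n \<ge> 1 \<Longrightarrow> cong_rel (WR 2) (var J ^ n) (var J)"
proof (induction n rule: dec_induct)
  case (step n)
  have "cong_rel (WR 2) (var J * var J ^ n) (var J * var J)"
    by (rule cong_left[OF step(3)])
  also have "cong_rel (WR 2) (var J * var J) (var J)"
    using cong_base[OF wrels.intros(3)[where m = 2]] by (simp only: power2_eq_square)
  finally show ?case by simp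
qed simp

text \<open>With \<open>J\<close> idempotent, the relations for \<open>m = 2\<close> imply those for every \<open>m \<ge> 2\<close>.\<close>

lemma retract_rel:
  assumes m: "m \<ge> 2" and "(l, r) \<in> WR m"
  shows "cong_rel (WR 2) l r"
  using assms(2)
proof cases
  case (1 i)
  have "cong_rel (WR 2) (var J ^ (m - 1)) (var J ^ (2 - 1))"
    using J_power_2[of "m - 1"] m by simp
  then show ?thesis
    unfolding 1(1,2) using 1(3) by (intro cong_trans[OF _ cong_sym[OF torus_rel(1)[of 2 i]]]) simp_all
next
  case (2 i)
  have "cong_rel (WR 2) (var J ^ (m - 1)) (var J ^ (2 - 1))"
    using J_power_2[of "m - 1"] m by simp
  then show ?thesis
    unfolding 2(1,2) using 2(3) by (intro cong_trans[OF _ cong_sym[OF torus_rel(2)[of 2 i]]]) simp_all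
next
  case 3
  then show ?thesis
    using J_power_2 m by simp
next
  case (5 x)
  have "cong_rel (WR 2) (var x * var J ^ (m - 1)) (var x * var J ^ (2 - 1))"
    using J_power_2[of "m - 1"] m by (intro cong_left) simp
  then show ?thesis
    unfolding 5(1,2) using 5(3) by (intro cong_trans[OF _ torus_rel(4)[of 2 x]]) simp_all
qed (simp_all add: cong_base wrels.intros split del: if_split)

lemma phi_theta: "p \<in> FW \<Longrightarrow> subst phi (subst (theta m) p) = subst phi p"
proof (induction rule: free_carrier_induct)
  case (var x)
  then show ?case by (cases x) simp_all
qed simp_all

lemma theta_retract: 
  assumes m: "m \<ge> 2" 
  shows "p \<in> FW \<Longrightarrow> cong_rel (WR 2) (subst (theta m) p) p"
proof (induction rule: free_carrier_induct)
  case (var x)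
  then show ?case using J_power_2[of "m - 1"] m by (cases x) simp_all
qed (simp_all add: cong_add cong_mult cong_scal)

section \<open>The isomorphisms\<close>

abbreviation Wm where "Wm m \<equiv> wU I A s q m \<kappa> \<kappa>'"
abbreviation Wc where "Wc m \<equiv> cls (wgens I) (WR m)"
abbreviation Uc where "Uc \<equiv> cls (ugens I) UR"
abbreviation wg where "wg m \<equiv> wU_gen I A s q m \<kappa> \<kappa>'"
abbreviation idem where "idem m \<equiv> wg m J [^]\<^bsub>Wm m\<^esub> (m - 1)"

lemma wg_Wc: "wg m x = Wc m (var x)"
  by (simp add: wU_gen_def presented_gen_cls)

lemma W_assoc_alg: "assoc_alg (Wm m)"
  unfolding wU_def by (rule presented_assoc_alg[OF presented_by_WR])

lemma U_assoc_alg: "assoc_alg (U_q I A s q)"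
  unfolding U_q_def by (rule presented_assoc_alg[OF presented_by_UR])

lemmas W_simps = presented_simps[OF presented_by_WR, folded wU_def]
  and U_simps = presented_simps[OF presented_by_UR, folded U_q_def]

lemma wg_carrier: "x \<in> wgens I \<Longrightarrow> wg m x \<in> carrier (Wm m)"
  by (simp add: wg_Wc W_simps)

lemma W_gen_subalgebra:
  assumes "assoc_alg B" "h \<in> alg_map (Wm m) B" "h \<one>\<^bsub>Wm m\<^esub> = u" "S \<subseteq> h ` carrier (Wm m)"
    and "\<And>x. x \<in> wgens I \<Longrightarrow> h (wg m x) \<in> alg_span B (insert u S)"
  shows "gen_subalgebra B u S = sub_alg B (h ` carrier (Wm m)) u"
  using gen_subalgebra_eq_image[OF presented_by_WR assms(1), of h m S, folded wU_def wU_gen_def] assms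
  by simp

lemma idem_Wc: "idem m = Wc m (var J ^ (m - 1))"
  unfolding wg_Wc unfolding wU_def by (rule presented_power[OF presented_by_WR]) simp

lemma idem_facts:
  assumes m: "m \<ge> 2"
  shows "idem m \<in> carrier (Wm m)" "idem m \<otimes>\<^bsub>Wm m\<^esub> idem m = idem m"
    "x \<in> carrier (Wm m) \<Longrightarrow> idem m \<otimes>\<^bsub>Wm m\<^esub> x = x \<otimes>\<^bsub>Wm m\<^esub> idem m"
proof -
  show "idem m \<in> carrier (Wm m)"
    unfolding idem_Wc by (simp add: W_simps)
  show "idem m \<otimes>\<^bsub>Wm m\<^esub> idem m = idem m"
    using J_power_idem[OF m] unfolding idem_Wc by (simp add: W_simps cls_eq_iff[OF presented_by_WR])
  show "idem m \<otimes>\<^bsub>Wm m\<^esub> x = x \<otimes>\<^bsub>Wm m\<^esub> idem m" if "x \<in> carrier (Wm m)"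
  proof -
    obtain p where p: "p \<in> FW" "x = Wc m p"
      using \<open>x \<in> carrier (Wm m)\<close> by (auto simp: W_simps)
    then show ?thesis
      using J_power_central[OF m p(1)] unfolding idem_Wc by (simp add: W_simps cls_eq_iff[OF presented_by_WR])
  qed
qed

lemma obtain_Phi:
  obtains h where "h \<in> alg_map (Wm m) (U_q I A s q)" "\<And>p. p \<in> FW \<Longrightarrow> h (Wc m p) = Uc (subst phi p)"
  unfolding wU_def U_q_def
  by (rule presented_lift[OF presented_by_WR presented_by_UR, where g = phi and m1 = m])
    (erule phi_carrier, erule phi_rel, blast)

lemma torus_weight_coweights': "t \<in> wtorus I \<Longrightarrow> torus_weight t \<in> coweights' I s"
  by (auto simp: wtorus_def coweights'_def lookup_single when_def)

lemma U_q'_image: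
  assumes h: "h \<in> alg_map (Wm m) (U_q I A s q)" and hc: "\<And>p. p \<in> FW \<Longrightarrow> h (Wc m p) = Uc (subst phi p)"
  shows "U_q' I A s q = sub_alg (U_q I A s q) (h ` carrier (Wm m)) \<one>\<^bsub>U_q I A s q\<^esub>"
proof -
  let ?S = "presented_gen (ugens I) UR ` ((\<Union>i\<in>I. {Ue i, Uf i}) \<union> Uq ` coweights' I s)"
  interpret U: assoc_alg "U_q I A s q" by (rule U_assoc_alg)
  have h1: "h \<one>\<^bsub>Wm m\<^esub> = \<one>\<^bsub>U_q I A s q\<^esub>"
    by (simp add: W_simps U_simps hc)
  have S: "?S \<subseteq> h ` carrier (Wm m)"
  proof -
    have "Uc (var (Ue i)) \<in> h ` carrier (Wm m)" "Uc (var (Uf i)) \<in> h ` carrier (Wm m)" if "i \<in> I" for i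
      using that hc[of "var (E i)"] hc[of "var (F i)"] by (force simp: W_simps)+
    moreover have "Uc (var (Uq h')) \<in> h ` carrier (Wm m)" if h': "h' \<in> coweights' I s" for h'
    proof -
      obtain p where p: "p \<in> FW" "cong_rel UR (subst phi p) (var (Uq h'))" "h' \<in> coweights I"
        using in_phi_image_coweights'[OF h'] by (auto simp: in_phi_image_def)
      have "subst phi p \<in> FU"
        by (rule subst_carrier[OF phi_carrier p(1)])
      then have "h (Wc m p) = Uc (var (Uq h'))"
        using p by (simp add: hc cls_eq_iff[OF presented_by_UR])
      then show ?thesis
        using p by (force simp: W_simps)
    qed
    ultimately show ?thesis
      by (auto simp: presented_gen_cls)
  qed
  have gens: "h (wg m x) \<in> alg_span (U_q I A s q) (insert \<one>\<^bsub>U_q I A s q\<^esub> ?S)"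
    if x: "x \<in> wgens I" for x
  proof -
    have "h (wg m x) = Uc (phi x)"
      using x by (simp add: wg_Wc hc)
    moreover have "Uc (phi x) \<in> insert \<one>\<^bsub>U_q I A s q\<^esub> ?S"
      using x torus_weight_coweights'[of x]
      by (cases x) (auto simp: U_simps presented_gen_cls wtorus_def simp del: torus_weight.simps)
    ultimately have "h (wg m x) \<in> insert \<one>\<^bsub>U_q I A s q\<^esub> ?S"
      by (simp only:)
    then show ?thesis
      by (rule subsetD[OF U.alg_span_superset])
  qed
  show ?thesis
    unfolding U_q'_def using U_assoc_alg h h1 S gens by (rule W_gen_subalgebra)
qed

text \<open>Dividing out the relations first and \<open>1 - J\<close> afterwards is the same as dividing out all at
  once.\<close>

lemma VR_kernel:
  assumes p: "p \<in> FW" "p \<in> tideal (VR m)"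
  shows "Wc m p \<in> Idl\<^bsub>Wm m\<^esub> {\<one>\<^bsub>Wm m\<^esub> \<ominus>\<^bsub>Wm m\<^esub> wg m J}"
proof -
  let ?N = "Idl\<^bsub>Wm m\<^esub> {\<one>\<^bsub>Wm m\<^esub> \<ominus>\<^bsub>Wm m\<^esub> wg m J}"
  let ?A = "free_algebra (wgens I) :: ('k, (nat wgen, 'k) free) module"
  interpret W: assoc_alg "Wm m" by (rule W_assoc_alg)
  interpret F: assoc_alg ?A by (rule free_assoc_alg)
  have gJ: "wg m J \<in> carrier (Wm m)"
    by (simp add: wg_Wc W_simps)
  interpret N: ideal ?N "Wm m"
    by (rule W.genideal_ideal) (simp add: gJ)
  have pres: "presented_by (wgens I) (VR m)"
    using presented_by_WR[of m] by (simp add: presented_by_def)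
  have "ring_hom_ring ?A (Wm m) (Wc m)"
    by (rule ring_hom_ringI) (auto simp: W_simps W.ring_axioms F.ring_axioms)
  then have ideal: "ideal {r \<in> FW. Wc m r \<in> ?N} ?A"
    by (rule ring_hom_ring.ideal_vimage) (rule N.ideal_axioms)
  have "{l - r | l r. (l, r) \<in> VR m} \<subseteq> {r \<in> FW. Wc m r \<in> ?N}"
  proof (rule subsetI, elim CollectE exE conjE)
    fix x l r assume x: "x = l - r" and lr: "(l, r) \<in> VR m"
    then have c: "l \<in> FW" "r \<in> FW"
      using pres by (auto simp: presented_by_def)
    from lr consider "l = var J" "r = 1" | "(l, r) \<in> WR m" by auto
    then have "Wc m (l - r) \<in> ?N"
    proof cases
      case 1
      have "\<one>\<^bsub>Wm m\<^esub> \<ominus>\<^bsub>Wm m\<^esub> wg m J \<in> ?N"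
        using W.genideal_self[of "{\<one>\<^bsub>Wm m\<^esub> \<ominus>\<^bsub>Wm m\<^esub> wg m J}"] gJ by simp
      then have "\<ominus>\<^bsub>Wm m\<^esub> (\<one>\<^bsub>Wm m\<^esub> \<ominus>\<^bsub>Wm m\<^esub> wg m J) \<in> ?N"
        by (rule N.a_inv_closed)
      moreover have "\<one>\<^bsub>Wm m\<^esub> \<ominus>\<^bsub>Wm m\<^esub> wg m J = Wc m (1 - var J)"
        using presented_minus[OF presented_by_WR, of 1 "var J" m, folded wU_def]
        by (simp add: wg_Wc W_simps)
      moreover have "\<ominus>\<^bsub>Wm m\<^esub> Wc m (1 - var J) = Wc m (l - r)"
        using 1 by (intro W.minus_equality) (simp_all add: W_simps)
      ultimately show ?thesis by simp
    next
      case 2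
      then have "Wc m (l - r) = \<zero>\<^bsub>Wm m\<^esub>"
        using cong_base[OF 2] c by (simp add: W_simps cls_eq_iff[OF presented_by_WR] cong_rel_def)
      then show ?thesis
        using N.zero_closed by simp
    qed
    then show "x \<in> {r \<in> FW. Wc m r \<in> ?N}"
      using c x by simp
  qed
  then have "rel_ideal (wgens I) (VR m) \<subseteq> {r \<in> FW. Wc m r \<in> ?N}"
    unfolding rel_ideal_def by (rule F.genideal_minimal[OF ideal])
  then show ?thesis
    using p rel_ideal_iff[OF pres p(1)] by blast
qed

text \<open>This is the form in which the kernel of \<open>phi\<close> is used: it is applied to the quotient map, and to
  the map from \<open>W\<^sub>2\<close> onto the truncated algebra.\<close>

lemma phi_kernel_subset:
  assumes m: "m \<ge> 2" and B: "assoc_alg B" and f: "f \<in> alg_map (Wm m) B"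
    and J: "f (\<one>\<^bsub>Wm m\<^esub> \<ominus>\<^bsub>Wm m\<^esub> wg m J) = \<zero>\<^bsub>B\<^esub>"
    and p: "p \<in> FW" "Uc (subst phi p) = \<zero>\<^bsub>U_q I A s q\<^esub>"
  shows "f (Wc m p) = \<zero>\<^bsub>B\<^esub>"
proof -
  interpret f: alg_map_locale "Wm m" B f
    by (rule alg_map_localeI[OF W_assoc_alg B f])
  have gJ: "wg m J \<in> carrier (Wm m)"
    by (simp add: wg_Wc W_simps)
  have "subst phi p \<in> FU"
    by (rule subst_carrier[OF phi_carrier p(1)])
  then have "subst phi p \<in> tideal UR"
    using p(2) by (simp add: U_simps cls_eq_iff[OF presented_by_UR] cong_0_iff)
  then have "Wc m p \<in> Idl\<^bsub>Wm m\<^esub> {\<one>\<^bsub>Wm m\<^esub> \<ominus>\<^bsub>Wm m\<^esub> wg m J}"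
    by (intro VR_kernel phi_kernel[OF m] p(1))
  also have "\<dots> \<subseteq> {x \<in> carrier (Wm m). f x = \<zero>\<^bsub>B\<^esub>}"
    by (rule f.A.genideal_minimal[OF f.kernel_ideal]) (simp add: J gJ)
  finally show ?thesis by simp
qed

lemma quotient_isomorphic:
  assumes m: "m \<ge> 2"
  shows "alg_isomorphic (alg_quot (Wm m) (Idl\<^bsub>Wm m\<^esub> {\<one>\<^bsub>Wm m\<^esub> \<ominus>\<^bsub>Wm m\<^esub> wg m J})) (U_q' I A s q)"
proof -
  let ?N = "Idl\<^bsub>Wm m\<^esub> {\<one>\<^bsub>Wm m\<^esub> \<ominus>\<^bsub>Wm m\<^esub> wg m J}"
  obtain h where h: "h \<in> alg_map (Wm m) (U_q I A s q)" and hc: "\<And>p. p \<in> FW \<Longrightarrow> h (Wc m p) = Uc (subst phi p)"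
    using obtain_Phi[where m = m] by blast
  interpret h: alg_map_locale "Wm m" "U_q I A s q" h
    by (rule alg_map_localeI[OF W_assoc_alg U_assoc_alg h])
  have "wg m J \<in> carrier (Wm m)"
    by (simp add: wg_Wc W_simps)
  then have x: "\<one>\<^bsub>Wm m\<^esub> \<ominus>\<^bsub>Wm m\<^esub> wg m J \<in> carrier (Wm m)"
    by simp
  have N: "ideal ?N (Wm m)"
    by (rule h.A.genideal_ideal) (use x in simp)
  have minus: "\<one>\<^bsub>Wm m\<^esub> \<ominus>\<^bsub>Wm m\<^esub> wg m J = Wc m (1 - var J)"
    using presented_minus[OF presented_by_WR, of 1 "var J" m, folded wU_def] by (simp add: wg_Wc W_simps)
  have "?N \<subseteq> {x \<in> carrier (Wm m). h x = \<zero>\<^bsub>U_q I A s q\<^esub>}"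
    by (rule h.A.genideal_minimal[OF h.kernel_ideal]) (use x in \<open>simp add: minus hc U_simps\<close>)
  then have hN: "h n = \<zero>\<^bsub>U_q I A s q\<^esub>" if "n \<in> ?N" for n
    using that by auto
  obtain k where k: "k \<in> alg_map (alg_quot (Wm m) ?N) (U_q I A s q)"
    and kh: "\<And>x. x \<in> carrier (Wm m) \<Longrightarrow> k (?N +>\<^bsub>Wm m\<^esub> x) = h x"
    by (rule h.A.alg_quot_lift[OF N U_assoc_alg h hN]) blast+
  let ?f = "\<lambda>x. ?N +>\<^bsub>Wm m\<^esub> x"
  note Q = h.A.alg_quot_simps[OF N]
  have f: "?f \<in> alg_map (Wm m) (alg_quot (Wm m) ?N)"
    by (rule h.A.quot_map[OF N])
  have f1J: "?f (\<one>\<^bsub>Wm m\<^esub> \<ominus>\<^bsub>Wm m\<^esub> wg m J) = \<zero>\<^bsub>alg_quot (Wm m) ?N\<^esub>"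
  proof -
    have "\<one>\<^bsub>Wm m\<^esub> \<ominus>\<^bsub>Wm m\<^esub> wg m J \<in> ?N"
      using h.A.genideal_self[of "{\<one>\<^bsub>Wm m\<^esub> \<ominus>\<^bsub>Wm m\<^esub> wg m J}"] x by simp
    moreover have "y \<ominus>\<^bsub>Wm m\<^esub> \<zero>\<^bsub>Wm m\<^esub> = y" if "y \<in> carrier (Wm m)" for y
      using that by (simp add: a_minus_def)
    ultimately show ?thesis
      unfolding Q(3) h.A.coset_eq_iff[OF N x h.A.zero_closed] by (simp only: x)
  qed
  have "alg_isomorphic (sub_alg (alg_quot (Wm m) ?N) (?f ` carrier (Wm m)) (?f \<one>\<^bsub>Wm m\<^esub>))
    (sub_alg (U_q I A s q) ((\<lambda>x. k (?f x)) ` carrier (Wm m)) (k (?f \<one>\<^bsub>Wm m\<^esub>)))"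
  proof (rule image_alg_isomorphic[OF W_assoc_alg h.A.alg_quot_assoc_alg[OF N] U_assoc_alg f k])
    fix c assume c: "c \<in> carrier (Wm m)" "k (?f c) = \<zero>\<^bsub>U_q I A s q\<^esub>"
    then obtain p where p: "p \<in> FW" "c = Wc m p"
      by (auto simp: W_simps)
    then have "Uc (subst phi p) = \<zero>\<^bsub>U_q I A s q\<^esub>"
      using c by (simp add: kh hc)
    from phi_kernel_subset[OF m h.A.alg_quot_assoc_alg[OF N] f f1J p(1) this]
    show "?f c = \<zero>\<^bsub>alg_quot (Wm m) ?N\<^esub>"
      by (simp add: p)
  qed
  moreover have "sub_alg (alg_quot (Wm m) ?N) (?f ` carrier (Wm m)) (?f \<one>\<^bsub>Wm m\<^esub>) = alg_quot (Wm m) ?N"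
    using sub_alg_carrier[of "alg_quot (Wm m) ?N"] by (simp add: Q)
  moreover have "sub_alg (U_q I A s q) ((\<lambda>x. k (?f x)) ` carrier (Wm m)) (k (?f \<one>\<^bsub>Wm m\<^esub>)) = U_q' I A s q"
  proof -
    have "(\<lambda>x. k (?f x)) ` carrier (Wm m) = h ` carrier (Wm m)"
      by (rule image_cong) (simp_all add: kh)
    moreover have "k (?f \<one>\<^bsub>Wm m\<^esub>) = \<one>\<^bsub>U_q I A s q\<^esub>"
      by (simp add: kh) (simp add: W_simps hc U_simps)
    ultimately show ?thesis
      by (simp add: U_q'_image[OF h hc])
  qed
  ultimately show ?thesis by simp
qed

lemma obtain_Theta:
  assumes "m \<ge> 2"
  obtains h where "h \<in> alg_map (Wm 2) (Wm m)" "\<And>p. p \<in> FW \<Longrightarrow> h (Wc 2 p) = Wc m (subst (theta m) p)"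
  unfolding wU_def
  by (rule presented_lift[OF presented_by_WR presented_by_WR, where g = "theta m" and m2 = 2 and m1 = m])
    (erule theta_carrier, erule theta_rel[OF assms], blast)

text \<open>The algebra generated by the \<open>E\<^sub>i e\<close>, \<open>F\<^sub>i e\<close> and the torus does not contain \<open>J e = J\<close> in general,
  so it may be smaller than the summand \<open>W\<^sub>m e\<close>. It is the image of \<open>\<rho>(x) = \<theta>(x) e\<close>.\<close>

lemma truncation_isomorphic:
  assumes m: "m \<ge> 2"
  shows "alg_isomorphic
    (gen_subalgebra (Wm m) (idem m)
      ((\<Union>i\<in>I. {wg m (E i) \<otimes>\<^bsub>Wm m\<^esub> idem m, wg m (F i) \<otimes>\<^bsub>Wm m\<^esub> idem m}) \<union> wg m ` wtorus I))
    (U_q' I A s q)"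
proof -
  let ?S = "(\<Union>i\<in>I. {wg m (E i) \<otimes>\<^bsub>Wm m\<^esub> idem m, wg m (F i) \<otimes>\<^bsub>Wm m\<^esub> idem m}) \<union> wg m ` wtorus I"
  interpret W: assoc_alg "Wm m" by (rule W_assoc_alg)
  obtain \<Theta> where \<Theta>: "\<Theta> \<in> alg_map (Wm 2) (Wm m)" and \<Theta>c: "\<And>p. p \<in> FW \<Longrightarrow> \<Theta> (Wc 2 p) = Wc m (subst (theta m) p)"
    using obtain_Theta[OF m] by blast
  obtain h where h: "h \<in> alg_map (Wm m) (U_q I A s q)" and hc: "\<And>p. p \<in> FW \<Longrightarrow> h (Wc m p) = Uc (subst phi p)"
    using obtain_Phi[where m = m] by blast
  obtain h2 where h2: "h2 \<in> alg_map (Wm 2) (U_q I A s q)" and h2c: "\<And>p. p \<in> FW \<Longrightarrow> h2 (Wc 2 p) = Uc (subst phi p)"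
    using obtain_Phi[where m = 2] by blast
  define \<rho> where "\<rho> x = \<Theta> x \<otimes>\<^bsub>Wm m\<^esub> idem m" for x
  have \<theta>c: "subst (theta m) p \<in> FW" if "p \<in> FW" for p
    using theta_carrier that by (rule subst_carrier)
  have \<rho>: "\<rho> \<in> alg_map (Wm 2) (Wm m)"
    unfolding \<rho>_def by (rule alg_map_comp[OF \<Theta> W.mult_map[OF idem_facts[OF m]]])
  have \<rho>c: "\<rho> (Wc 2 p) = Wc m (subst (theta m) p * var J ^ (m - 1))" if "p \<in> FW" for p
    using that \<theta>c by (simp add: \<rho>_def \<Theta>c idem_Wc W_simps del: One_nat_def)
  have \<rho>1: "\<rho> \<one>\<^bsub>Wm 2\<^esub> = idem m"
    by (simp add: W_simps \<rho>c idem_Wc del: One_nat_def)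
  have \<rho>E: "wg m (E i) \<otimes>\<^bsub>Wm m\<^esub> idem m = \<rho> (wg 2 (E i))" "wg m (F i) \<otimes>\<^bsub>Wm m\<^esub> idem m = \<rho> (wg 2 (F i))"
    if "i \<in> I" for i
    using that unfolding idem_Wc unfolding wg_Wc by (simp_all add: \<rho>c W_simps)
  have \<rho>t: "wg m t = \<rho> (wg 2 t)" if "t \<in> wtorus I" for t
    using that wtorus_wgens[OF that] cong_sym[OF torus_rel(4)[OF m that]]
    by (simp add: wg_Wc \<rho>c theta_torus cls_eq_iff[OF presented_by_WR])
  have \<rho>J: "\<rho> (wg 2 J) = idem m"
    using J_power_idem[OF m] unfolding idem_Wc unfolding wg_Wc
    by (simp add: \<rho>c cls_eq_iff[OF presented_by_WR])
  have S: "?S \<subseteq> \<rho> ` carrier (Wm 2)"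
    by (auto simp: \<rho>E \<rho>t simp del: One_nat_def intro!: imageI wg_carrier intro: wtorus_wgens)
  have gens: "\<rho> (wg 2 x) \<in> alg_span (Wm m) (insert (idem m) ?S)"
    if x: "x \<in> wgens I" for x
  proof -
    from x have "\<rho> (wg 2 x) \<in> insert (idem m) ?S"
      by (auto simp: wgens_def \<rho>J \<rho>E[symmetric] \<rho>t[symmetric] simp del: One_nat_def)
    then show ?thesis
      by (rule subsetD[OF W.alg_span_superset])
  qed
  have "gen_subalgebra (Wm m) (idem m) ?S = sub_alg (Wm m) (\<rho> ` carrier (Wm 2)) (idem m)"
    using W_assoc_alg \<rho> \<rho>1 S gens by (rule W_gen_subalgebra)
  moreover have "alg_isomorphic (sub_alg (Wm m) (\<rho> ` carrier (Wm 2)) (\<rho> \<one>\<^bsub>Wm 2\<^esub>))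
    (sub_alg (U_q I A s q) ((\<lambda>x. h (\<rho> x)) ` carrier (Wm 2)) (h (\<rho> \<one>\<^bsub>Wm 2\<^esub>)))"
  proof (rule image_alg_isomorphic[OF W_assoc_alg W_assoc_alg U_assoc_alg \<rho> h])
    fix c assume c: "c \<in> carrier (Wm 2)" "h (\<rho> c) = \<zero>\<^bsub>U_q I A s q\<^esub>"
    then obtain p where p: "p \<in> FW" "c = Wc 2 p"
      by (auto simp: W_simps)
    then have "Uc (subst phi p) = \<zero>\<^bsub>U_q I A s q\<^esub>"
      using c \<theta>c by (simp add: \<rho>c hc phi_theta)
    moreover have "\<rho> (\<one>\<^bsub>Wm 2\<^esub> \<ominus>\<^bsub>Wm 2\<^esub> wg 2 J) = \<zero>\<^bsub>Wm m\<^esub>"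
    proof -
      interpret \<rho>: alg_map_locale "Wm 2" "Wm m" \<rho>
        by (rule alg_map_localeI[OF W_assoc_alg W_assoc_alg \<rho>])
      have "wg 2 J \<in> carrier (Wm 2)"
        by (simp add: wg_Wc W_simps)
      then show ?thesis
        using idem_facts(1)[OF m] by (simp add: \<rho>.hom_diff \<rho>1 \<rho>J W.diff_eq_zero_iff)
    qed
    ultimately show "\<rho> c = \<zero>\<^bsub>Wm m\<^esub>"
      using phi_kernel_subset[OF _ W_assoc_alg \<rho>] p by simp
  qed
  moreover have "sub_alg (U_q I A s q) ((\<lambda>x. h (\<rho> x)) ` carrier (Wm 2)) (h (\<rho> \<one>\<^bsub>Wm 2\<^esub>)) = U_q' I A s q"
  proof -
    have "h (\<rho> c) = h2 c" if c: "c \<in> carrier (Wm 2)" for c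
    proof -
      obtain p where "p \<in> FW" "c = Wc 2 p"
        using c by (auto simp: W_simps)
      then show ?thesis
        using \<theta>c by (simp add: \<rho>c hc h2c phi_theta)
    qed
    then have "(\<lambda>x. h (\<rho> x)) ` carrier (Wm 2) = h2 ` carrier (Wm 2)"
      by (rule image_cong[OF refl])
    moreover have "h (\<rho> \<one>\<^bsub>Wm 2\<^esub>) = \<one>\<^bsub>U_q I A s q\<^esub>"
      by (simp add: \<rho>1 idem_Wc hc U_simps del: One_nat_def)
    ultimately show ?thesis
      by (simp add: U_q'_image[OF h2 h2c])
  qed
  ultimately show ?thesis
    by (simp add: \<rho>1)
qed

text \<open>The subalgebra need not contain \<open>J\<close>, but it contains \<open>\<theta>(J) = e = K\<^sub>i Kbar\<^sub>i\<close>, so it is all of the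
  image of \<open>\<theta>\<close>.\<close>

lemma generated_isomorphic:
  assumes m: "m \<ge> 2"
  shows "alg_isomorphic
    (gen_subalgebra (Wm m) \<one>\<^bsub>Wm m\<^esub> (wg m ` (wtorus I \<union> (\<Union>i\<in>I. {E i, F i}))))
    (yang_algebra I A s q \<kappa> \<kappa>')"
proof -
  let ?S = "wg m ` (wtorus I \<union> (\<Union>i\<in>I. {E i, F i}))"
  interpret W: assoc_alg "Wm m" by (rule W_assoc_alg)
  obtain \<Theta> where \<Theta>: "\<Theta> \<in> alg_map (Wm 2) (Wm m)" and \<Theta>c: "\<And>p. p \<in> FW \<Longrightarrow> \<Theta> (Wc 2 p) = Wc m (subst (theta m) p)"
    using obtain_Theta[OF m] by blast
  interpret \<Theta>: alg_map_locale "Wm 2" "Wm m" \<Theta>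
    by (rule alg_map_localeI[OF W_assoc_alg W_assoc_alg \<Theta>])
  obtain \<pi> where \<pi>: "\<pi> \<in> alg_map (Wm m) (Wm 2)" and \<pi>c: "\<And>p. p \<in> FW \<Longrightarrow> \<pi> (Wc m p) = Wc 2 p"
  proof -
    have rel: "cong_rel (WR 2) (subst var l) (subst var r)" if "(l, r) \<in> WR m" for l r
      using retract_rel[OF m that] by (simp only: subst_var)
    show ?thesis
      by (rule presented_lift[OF presented_by_WR presented_by_WR, where g = var and m2 = m and m1 = 2])
        (simp, erule rel, rule that, simp_all only: wU_def subst_var)
  qed
  have \<theta>c: "subst (theta m) p \<in> FW" if "p \<in> FW" for p
    using theta_carrier that by (rule subst_carrier)
  have \<Theta>1: "\<Theta> \<one>\<^bsub>Wm 2\<^esub> = \<one>\<^bsub>Wm m\<^esub>"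
    by (simp add: W_simps \<Theta>c)
  have \<Theta>g: "wg m x = \<Theta> (wg 2 x)" if "x \<in> wtorus I \<union> (\<Union>i\<in>I. {E i, F i})" for x
    using that wtorus_wgens by (auto simp: wg_Wc \<Theta>c theta_torus)
  have S: "?S \<subseteq> \<Theta> ` carrier (Wm 2)"
    by (auto simp: \<Theta>g intro!: imageI wg_carrier intro: wtorus_wgens)
  have gens: "\<Theta> (wg 2 x) \<in> alg_span (Wm m) (insert \<one>\<^bsub>Wm m\<^esub> ?S)"
    if x: "x \<in> wgens I" for x
  proof (cases "x = J")
    case False
    then have x': "x \<in> wtorus I \<union> (\<Union>i\<in>I. {E i, F i})"
      using x by (auto simp: wgens_def)
    then have "\<Theta> (wg 2 x) \<in> insert \<one>\<^bsub>Wm m\<^esub> ?S"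
      by (simp add: \<Theta>g[OF x', symmetric])
    then show ?thesis
      by (rule subsetD[OF W.alg_span_superset])
  next
    case True
    obtain i where i: "i \<in> I" using nonempty by blast
    then have "wg m (K i) \<in> ?S" "wg m (Kbar i) \<in> ?S"
      by (auto simp: wtorus_def)
    then have "wg m (K i) \<otimes>\<^bsub>Wm m\<^esub> wg m (Kbar i) \<in> alg_span (Wm m) (insert \<one>\<^bsub>Wm m\<^esub> ?S)"
      by (intro W.alg_span_mult subsetD[OF W.alg_span_superset] insertI2)
    moreover have "wg m (K i) \<otimes>\<^bsub>Wm m\<^esub> wg m (Kbar i) = \<Theta> (wg 2 J)"
      using i torus_rel(1)[OF m i] by (simp add: wg_Wc \<Theta>c W_simps cls_eq_iff[OF presented_by_WR])
    ultimately show ?thesis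
      by (simp add: True)
  qed
  have "gen_subalgebra (Wm m) \<one>\<^bsub>Wm m\<^esub> ?S = sub_alg (Wm m) (\<Theta> ` carrier (Wm 2)) \<one>\<^bsub>Wm m\<^esub>"
    using W_assoc_alg \<Theta> \<Theta>1 S gens by (rule W_gen_subalgebra)
  moreover have \<pi>\<Theta>: "\<pi> (\<Theta> c) = c" if c: "c \<in> carrier (Wm 2)" for c
  proof -
    obtain p where p: "p \<in> FW" "c = Wc 2 p"
      using c by (auto simp: W_simps)
    then show ?thesis
      using \<theta>c[OF p(1)] theta_retract[OF m p(1)] by (simp add: \<Theta>c \<pi>c cls_eq_iff[OF presented_by_WR])
  qed
  moreover have "alg_isomorphic (sub_alg (Wm m) (\<Theta> ` carrier (Wm 2)) (\<Theta> \<one>\<^bsub>Wm 2\<^esub>))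
    (sub_alg (Wm 2) ((\<lambda>x. \<pi> (\<Theta> x)) ` carrier (Wm 2)) (\<pi> (\<Theta> \<one>\<^bsub>Wm 2\<^esub>)))"
    by (rule image_alg_isomorphic[OF W_assoc_alg W_assoc_alg W_assoc_alg \<Theta> \<pi>])
      (simp add: \<pi>\<Theta> \<Theta>.hom_zero)
  moreover have "(\<lambda>x. \<pi> (\<Theta> x)) ` carrier (Wm 2) = carrier (Wm 2)"
    using \<pi>\<Theta> by simp
  ultimately show ?thesis
    using \<Theta>.A.one_closed by (simp add: \<Theta>1[symmetric] sub_alg_carrier yang_algebra_def)
qed

end

theorem mainTheorem5:
  fixes I :: "nat set" and A :: "nat \<Rightarrow> nat \<Rightarrow> int" and s :: "nat \<Rightarrow> nat"
    and q :: "'k::field_char_0" and m :: nat and \<kappa> \<kappa>' :: "nat \<Rightarrow> nat"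
  defines "W \<equiv> wU I A s q m \<kappa> \<kappa>'"
    and "g \<equiv> wU_gen I A s q m \<kappa> \<kappa>'"
  defines "e \<equiv> g J [^]\<^bsub>W\<^esub> (m - 1)"
  assumes "(\<exists>n\<ge>1. I = {1..n}) \<or> I = {1..}"
    and "borcherds_cartan I A" and "symmetrized_by I A s"
    and "\<forall>i\<in>I. q ^ s i \<noteq> 1 \<and> q ^ s i \<noteq> - 1 \<and> q ^ s i \<noteq> 0"
    and "m \<ge> 2"
    and "\<forall>i\<in>I. \<kappa> i \<in> {0, 1} \<and> \<kappa>' i \<in> {0, 1}"
  shows "alg_direct_sum W (alg_part W e) (alg_part W (\<one>\<^bsub>W\<^esub> \<ominus>\<^bsub>W\<^esub> e)) \<and>
    alg_isomorphic (alg_quot W (Idl\<^bsub>W\<^esub> {\<one>\<^bsub>W\<^esub> \<ominus>\<^bsub>W\<^esub> g J})) (U_q' I A s q) \<and>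
    alg_isomorphic
      (gen_subalgebra W e
        ((\<Union>i\<in>I. {g (E i) \<otimes>\<^bsub>W\<^esub> e, g (F i) \<otimes>\<^bsub>W\<^esub> e}) \<union> g ` wtorus I))
      (U_q' I A s q) \<and>
    (semisimple (envelope I A :: ('k, _) module) (kac_moody I A) \<longrightarrow>
      alg_isomorphic
        (gen_subalgebra W \<one>\<^bsub>W\<^esub> (g ` (wtorus I \<union> (\<Union>i\<in>I. {E i, F i}))))
        (yang_algebra I A s q \<kappa> \<kappa>'))"
proof -
  have one: "1 \<in> I"
    using assms(4) by auto
  interpret quantum_datum I A s q \<kappa> \<kappa>'
  proof
    show "q \<noteq> 0"
      using assms(6,7) one by (auto simp: symmetrized_by_def)
  qed (use assms one in \<open>auto simp: symmetrized_by_def\<close>)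
  note m = \<open>m \<ge> 2\<close>
  have "alg_direct_sum W (alg_part W e) (alg_part W (\<one>\<^bsub>W\<^esub> \<ominus>\<^bsub>W\<^esub> e))"
    using idem_facts[OF m] unfolding W_def g_def e_def
    by (intro assoc_alg.central_idempotent_direct_sum[OF W_assoc_alg])
  then show ?thesis
    using quotient_isomorphic[OF m] truncation_isomorphic[OF m] generated_isomorphic[OF m]
    unfolding W_def g_def e_def by (intro conjI impI)
qed

end
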